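(* Let $g:(\mathbb{R}^2,\mathbf{0})\to(\mathbb{R}^3,\mathbf{0})$ be a Whitney umbrella given in normal form, with double point locus $\mathcal{D}$ in the parameter space parameterized by $\gamma$. For $\mathbf{w}_0\in S^2$ let $\mathcal{P}_{\mathbf{w}_0}$ be the plane in $\mathbb{R}^3$ through the origin with normal vector $\mathbf{w}_0$, and let $h(u,v)=\langle g(u,v),\mathbf{w}_0\rangle$ be the height function on $g$ in the direction $\mathbf{w}_0$. Then the following hold. (1) Suppose that $\mathcal{P}_{\mathbf{w}_0}$ contains the tangent line at the origin to the image of $\mathcal{D}$ under $g$, and that $h(\gamma(v))$ is not flat at $v=0$. (a) Suppose that $h$ is non-singular at $(0,0)$. Then $h^{-1}(0)$ and $\mathcal{D}$, in the parameter space, have $2k$-point contact at $(0,0)$ for some integer $k\ge 2$. Moreover, with this $k$, the local intersection of $g$ with $\mathcal{P}_{\mathbf{w}_0}$ has a singularity of type $A_{2k}$ as a curve in the plane $\mathcal{P}_{\mathbf{w}_0}$. (b) Suppose that $h$ is singular at $(0,0)$. Then the local component of $h^{-1}(0)$ which is not the $u$-axis and $\mathcal{D}$, in the parameter space, have $(2k+1)$-point contact at $(0,0)$ for some integer $k\ge 1$. Moreover, with this $k$, the local intersection of $g$ with $\mathcal{P}_{\mathbf{w}_0}$ has a singularity of type $D_{2k+3}$ as a curve in the plane $\mathcal{P}_{\mathbf{w}_0}$. (2) Suppose that $\mathcal{P}_{\mathbf{w}_0}$ does not contain the tangent line at the origin to the image of $\mathcal{D}$ under $g$, and that $h$ has an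 $A_k^{\pm}$ singularity at $(0,0)$, where $k\ge0$. Then the local intersection of $g$ with $\mathcal{P}_{\mathbf{w}_0}$ has a singularity of type $A_{k+2}$ as a curve in the plane $\mathcal{P}_{\mathbf{w}_0}$.
   Context: **Whitney umbrella and normal form.** A smooth map germ $g:(\mathbb{R}^2,\mathbf{0})\to(\mathbb{R}^3,\mathbf{0})$ is a Whitney umbrella if it is $\mathcal{A}$-equivalent (equivalent under germs of diffeomorphisms of source and target) to $(u,v)\mapsto(u,uv,v^2)$. It is given in normal form if, for some integer $N\ge 3$, $$g(u,v)=\Bigl(u,\ uv+\sum_{i=3}^N\frac{b_i}{i!}v^i+O(u,v)^{N+1},\ \sum_{m=2}^N A_m(u,v)+O(u,v)^{N+1}\Bigr),\qquad A_m(u,v)=\sum_{i+j=m}\frac{a_{ij}}{i!j!}u^iv^j,$$ with real constants $b_i,a_{ij}$ and $a_{02}>0$. Here $O(u,v)^{N+1}$ denotes smooth terms of order at least $N+1$. **Double point locus.** $\mathcal{D}\subset(\mathbb{R}^2,\mathbf 0)$ is the germ of the closure of the set of points $(u_1,v_1)$ for which there is $(u_2,v_2)\ne(u_1,v_1)$ near the origin with $g(u_1,v_1)=g(u_2,v_2)$. It is a regular curve germ through the origin, parameterized by a smooth $\gamma(v)=\bigl(-\tfrac{b_3}{6}v^2+O(v^3),\,v\bigr)$. The tangent line at the origin to the image $g(\mathcal{D})$ is $\{t(-b_3,0,3a_{02}) : t\in\mathbb{R}\}$. **Flatness and contact.** A function of $v$ is flat at $v=0$ if all its derivatives vanish at $v=0$.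 A regular curve germ $C=\{f=0\}$ at the origin of $\mathbb{R}^2$ (with $f(\mathbf 0)=0$, $df(\mathbf 0)\neq0$) has $m$-point contact with $\mathcal{D}$ at $(0,0)$ if $f(\gamma(v))$ vanishes to order exactly $m$ at $v=0$. **Local components in (1)(b).** In this case $h$ is, up to sign, the second component $uv+\sum_{i=3}^{N}\frac{b_i}{i!}v^i+O(u,v)^{N+1}$ of $g$, so $h^{-1}(0)$ consists locally of two regular transverse branches. One is the $u$-axis (exactly so when the remainder term is divisible by $v$; in general it is the branch tangent to the $u$-axis). "The local component which is not the $u$-axis" is the other branch, which is tangent to the $v$-axis. **Local intersection.** The local intersection of $g$ with $\mathcal{P}_{\mathbf w_0}$ is the set germ $g(h^{-1}(0))$ at the origin in $\mathcal{P}_{\mathbf w_0}\cong\mathbb{R}^2$, where $h^{-1}(0)$ is understood as a germ at $(0,0)$. **Singularity types of functions.** $h$ has an $A_k$ singularity ($k\ge1$) at $(0,0)$ if it is right-equivalent, up to overall sign, to $v^2+u^{k+1}$ or $v^2-u^{k+1}$ (denoted $A_k^+$ and $A_k^-$ respectively when $k$ is odd; the sign is irrelevant for $k$ even). By convention $A_0$ means that $h$ is non-singular at $(0,0)$. **Singularity types of plane curves.** A set germ in the plane has a singularity of type $A_n$ if it is the image, under a diffeomorphism germ of the plane, of the germ at $\mathbf 0$ of $\{y^2+x^{n+1}=0\}$ or $\{y^2-x^{n+1}=0\}$ (for $n$ odd, the first is an isolated point). It has a singularity of type $D_n$ with $n$ odd if it is the image, under a diffeomorphism germ of the plane, of the germ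 at $\mathbf 0$ of $\{x^2y+y^{n-1}=0\}$. *)

theory Defs
  imports "HOL-Analysis.Analysis" "HOL-Library.Landau_Symbols"
begin

section \<open>Smooth map germs and set germs at the origin\<close>

text \<open>
  All germs are taken at the origin and are represented by total functions, resp. by sets, whose
  behaviour away from the origin is irrelevant. The plane is \<open>real \<times> real\<close>, with coordinates
  \<open>(u, v)\<close>, and three-space is \<open>real \<times> real \<times> real\<close>, both with the Euclidean inner product.
\<close>

primrec Ck_on :: "nat \<Rightarrow> 'a::real_normed_vector set \<Rightarrow> ('a \<Rightarrow> 'b::real_normed_vector) \<Rightarrow> bool" where
  "Ck_on 0 S f \<longleftrightarrow> continuous_on S f"
| "Ck_on (Suc k) S f \<longleftrightarrow>
     (\<forall>x\<in>S. f differentiable (at x)) \<and> (\<forall>d. Ck_on k S (\<lambda>x. frechet_derivative f (at x) d))"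

definition smooth_on :: "'a::real_normed_vector set \<Rightarrow> ('a \<Rightarrow> 'b::real_normed_vector) \<Rightarrow> bool" where
  "smooth_on S f \<longleftrightarrow> open S \<and> (\<forall>k. Ck_on k S f)"

definition smooth_germ :: "('a::real_normed_vector \<Rightarrow> 'b::real_normed_vector) \<Rightarrow> bool" where
  "smooth_germ f \<longleftrightarrow> (\<exists>U. 0 \<in> U \<and> smooth_on U f)"

definition diffeo_germ :: "('a::real_normed_vector \<Rightarrow> 'a) \<Rightarrow> bool" where
  "diffeo_germ \<phi> \<longleftrightarrow> \<phi> 0 = 0 \<and>
     (\<exists>U V \<psi>. 0 \<in> U \<and> homeomorphism U V \<phi> \<psi> \<and> smooth_on U \<phi> \<and> smooth_on V \<psi>)"

definition germ_eq :: "'a::real_normed_vector set \<Rightarrow> 'a set \<Rightarrow> bool" where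
  "germ_eq X Y \<longleftrightarrow> (\<forall>\<^sub>F p in nhds 0. p \<in> X \<longleftrightarrow> p \<in> Y)"

text \<open>
  \<open>germ_image f X Y\<close>: the germ of \<open>Y\<close> is the image under \<open>f\<close> of the germ of \<open>X\<close>, i.e. the image
  of every sufficiently small representative of \<open>X\<close> represents \<open>Y\<close>.
\<close>

definition germ_image ::
  "('a::real_normed_vector \<Rightarrow> 'b::real_normed_vector) \<Rightarrow> 'a set \<Rightarrow> 'b set \<Rightarrow> bool" where
  "germ_image f X Y \<longleftrightarrow> (\<forall>\<^sub>F r in at_right 0. germ_eq (f ` (X \<inter> ball 0 r)) Y)"


section \<open>Whitney umbrellas, normal form, double point locus\<close>

definition whitney_umbrella :: "(real \<times> real \<Rightarrow> real \<times> real \<times> real) \<Rightarrow> bool" where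
  "whitney_umbrella g \<longleftrightarrow> smooth_germ g \<and> g 0 = 0 \<and>
     (\<exists>\<phi> \<Psi>. diffeo_germ \<phi> \<and> diffeo_germ \<Psi> \<and>
        (\<forall>\<^sub>F (u, v) in nhds 0. g (\<phi> (u, v)) = \<Psi> (u, u * v, v\<^sup>2)))"

definition normal_form ::
  "(real \<times> real \<Rightarrow> real \<times> real \<times> real) \<Rightarrow> nat \<Rightarrow> (nat \<Rightarrow> real) \<Rightarrow> (nat \<Rightarrow> nat \<Rightarrow> real) \<Rightarrow> bool" where
  "normal_form g N b a \<longleftrightarrow> N \<ge> 3 \<and> a 0 2 > 0 \<and>
     (\<exists>r\<^sub>2 r\<^sub>3. smooth_germ r\<^sub>2 \<and> r\<^sub>2 \<in> O[nhds 0](\<lambda>p. norm p ^ (N + 1)) \<and>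
             smooth_germ r\<^sub>3 \<and> r\<^sub>3 \<in> O[nhds 0](\<lambda>p. norm p ^ (N + 1)) \<and>
        (\<forall>\<^sub>F (u, v) in nhds 0. g (u, v) =
           (u,
            u * v + (\<Sum>i=3..N. b i / fact i * v ^ i) + r\<^sub>2 (u, v),
            (\<Sum>m=2..N. \<Sum>(i, j)\<in>{(i, j). i + j = m}. a i j / (fact i * fact j) * u ^ i * v ^ j)
              + r\<^sub>3 (u, v))))"

definition double_points :: "('a \<Rightarrow> 'b) \<Rightarrow> 'a set \<Rightarrow> 'a set" where
  "double_points g U = {p \<in> U. \<exists>q\<in>U. q \<noteq> p \<and> g p = g q}"

definition double_point_locus ::
  "(real \<times> real \<Rightarrow> real \<times> real \<times> real) \<Rightarrow> (real \<times> real) set \<Rightarrow> bool" where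
  "double_point_locus g D \<longleftrightarrow>
     (\<forall>\<^sub>F r in at_right 0. germ_eq D (closure (double_points g (ball 0 r))))"

text \<open>\<open>\<gamma>(v) = (-b\<^sub>3/6 v\<^sup>2 + O(v\<^sup>3), v)\<close> is a smooth parameterization of the germ \<open>D\<close>.\<close>

definition parameterizes_locus ::
  "real \<Rightarrow> (real \<Rightarrow> real \<times> real) \<Rightarrow> (real \<times> real) set \<Rightarrow> bool" where
  "parameterizes_locus b\<^sub>3 \<gamma> D \<longleftrightarrow> smooth_germ \<gamma> \<and> germ_image \<gamma> UNIV D \<and>
     (\<forall>\<^sub>F v in nhds 0. snd (\<gamma> v) = v) \<and>
     (\<lambda>v. fst (\<gamma> v) - (- b\<^sub>3 / 6 * v\<^sup>2)) \<in> O[nhds 0](\<lambda>v. v ^ 3)"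

text \<open>
  The image of the double point locus under \<open>g\<close> is a curve which stops at the origin, where
  \<open>g \<circ> \<gamma>\<close> has zero velocity. Its tangent line is therefore defined as the limit of secants.
\<close>

definition tangent_line :: "'a::real_normed_vector set \<Rightarrow> 'a set \<Rightarrow> bool" where
  "tangent_line S L \<longleftrightarrow> (\<exists>d. d \<noteq> 0 \<and> L = range (\<lambda>t. t *\<^sub>R d)) \<and> 0 islimpt S \<and>
     ((\<lambda>p. infdist p L / norm p) \<longlongrightarrow> 0) (at 0 within S)"

definition image_tangent_line ::
  "(real \<times> real \<Rightarrow> real \<times> real \<times> real) \<Rightarrow> (real \<times> real) set \<Rightarrow> (real \<times> real \<times> real) set \<Rightarrow> bool" where
  "image_tangent_line g D L \<longleftrightarrow> (\<exists>Y. germ_image g D Y \<and> tangent_line Y L)"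


section \<open>Height functions and local intersections with planes\<close>

definition plane :: "real \<times> real \<times> real \<Rightarrow> (real \<times> real \<times> real) set" where
  "plane w = {x. inner x w = 0}"

definition height ::
  "(real \<times> real \<Rightarrow> real \<times> real \<times> real) \<Rightarrow> real \<times> real \<times> real \<Rightarrow> real \<times> real \<Rightarrow> real" where
  "height g w p = inner (g p) w"

definition local_intersection ::
  "(real \<times> real \<Rightarrow> real \<times> real \<times> real) \<Rightarrow> real \<times> real \<times> real \<Rightarrow> (real \<times> real \<times> real) set \<Rightarrow> bool" where
  "local_intersection g w Y \<longleftrightarrow> germ_image g {p. height g w p = 0} Y"


section \<open>Flatness, regular curves, contact\<close>

definition flat_at_0 :: "(real \<Rightarrow> real) \<Rightarrow> bool" where
  "flat_at_0 F \<longleftrightarrow> (\<forall>n. (deriv ^^ n) F 0 = 0)"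

definition vanishes_to_order :: "nat \<Rightarrow> (real \<Rightarrow> real) \<Rightarrow> bool" where
  "vanishes_to_order m F \<longleftrightarrow> (\<forall>i<m. (deriv ^^ i) F 0 = 0) \<and> (deriv ^^ m) F 0 \<noteq> 0"

definition nonsingular :: "(real \<times> real \<Rightarrow> real) \<Rightarrow> bool" where
  "nonsingular f \<longleftrightarrow> (\<exists>d. frechet_derivative f (at 0) d \<noteq> 0)"

definition defines_curve :: "(real \<times> real \<Rightarrow> real) \<Rightarrow> (real \<times> real) set \<Rightarrow> bool" where
  "defines_curve f C \<longleftrightarrow>
     smooth_germ f \<and> f 0 = 0 \<and> nonsingular f \<and> germ_eq C {p. f p = 0}"

definition regular_curve_tangent_to :: "(real \<times> real) set \<Rightarrow> real \<times> real \<Rightarrow> bool" where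
  "regular_curve_tangent_to C d \<longleftrightarrow>
     (\<exists>f. defines_curve f C \<and> frechet_derivative f (at 0) d = 0)"

definition point_contact :: "nat \<Rightarrow> (real \<times> real) set \<Rightarrow> (real \<Rightarrow> real \<times> real) \<Rightarrow> bool" where
  "point_contact m C \<gamma> \<longleftrightarrow> (\<exists>f. defines_curve f C \<and> vanishes_to_order m (f \<circ> \<gamma>))"

text \<open>
  \<open>C\<close> is the component of \<open>h = 0\<close> other than the \<open>u\<close>-axis: the zero set is the union of two
  regular branches, \<open>C'\<close> tangent to the \<open>u\<close>-axis and \<open>C\<close> tangent to the \<open>v\<close>-axis. Since the
  tangents differ, the germs of \<open>C\<close> and \<open>C'\<close> are determined by \<open>h\<close>. In general \<open>C'\<close> is
  the \<open>u\<close>-axis only up to first order.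
\<close>

definition non_u_axis_component :: "(real \<times> real \<Rightarrow> real) \<Rightarrow> (real \<times> real) set \<Rightarrow> bool" where
  "non_u_axis_component h C \<longleftrightarrow>
     (\<exists>C'. germ_eq {p. h p = 0} (C \<union> C') \<and>
        regular_curve_tangent_to C' (1, 0) \<and> regular_curve_tangent_to C (0, 1))"


section \<open>Singularity types\<close>

definition A_singularity :: "nat \<Rightarrow> (real \<times> real \<Rightarrow> real) \<Rightarrow> bool" where
  "A_singularity k h \<longleftrightarrow>
     (if k = 0 then nonsingular h
      else \<exists>\<phi>. diffeo_germ \<phi> \<and> (\<exists>s\<in>{1, -1}. \<exists>e\<in>{1, -1}.
             \<forall>\<^sub>F (u, v) in nhds 0. h (\<phi> (u, v)) = s * (v\<^sup>2 + e * u ^ (k + 1))))"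

text \<open>
  A linear isomorphism \<open>\<iota>\<close> identifies the two-dimensional subspace \<open>P\<close> with the plane; the choice
  of \<open>\<iota>\<close> is immaterial, as it can be absorbed into the diffeomorphism germ \<open>\<phi>\<close>.
\<close>

definition diffeomorphic_in_plane ::
  "(real \<times> real \<times> real) set \<Rightarrow> (real \<times> real) set \<Rightarrow> (real \<times> real \<times> real) set \<Rightarrow> bool" where
  "diffeomorphic_in_plane P Z Y \<longleftrightarrow>
     (\<exists>\<iota> \<phi>. linear \<iota> \<and> inj \<iota> \<and> range \<iota> = P \<and> diffeo_germ \<phi> \<and> germ_image (\<iota> \<circ> \<phi>) Z Y)"

definition A_curve ::
  "(real \<times> real \<times> real) set \<Rightarrow> nat \<Rightarrow> (real \<times> real \<times> real) set \<Rightarrow> bool" where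
  "A_curve P n Y \<longleftrightarrow>
     diffeomorphic_in_plane P {(x, y). y\<^sup>2 + x ^ (n + 1) = 0} Y \<or>
     diffeomorphic_in_plane P {(x, y). y\<^sup>2 - x ^ (n + 1) = 0} Y"

definition D_curve ::
  "(real \<times> real \<times> real) set \<Rightarrow> nat \<Rightarrow> (real \<times> real \<times> real) set \<Rightarrow> bool" where
  "D_curve P n Y \<longleftrightarrow> odd n \<and> diffeomorphic_in_plane P {(x, y). x\<^sup>2 * y + y ^ (n - 1) = 0} Y"

end

theory Submission
  imports Defs
begin

text \<open>
  The definition of a Whitney umbrella provides coordinates of source and target in which \<open>g\<close> is the
  standard umbrella \<open>(u, v) \<mapsto> (u, u v, v\<^sup>2)\<close>, with image \<open>y\<^sup>2 = x\<^sup>2 z\<close>, \<open>z \<ge> 0\<close>. In these coordinates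
  the umbrella is explicit and the plane becomes a smooth surface \<open>H = 0\<close> (locale \<open>umbrella_chart\<close>).
  The double point locus is the axis \<open>u = 0\<close>, its image is the half-axis \<open>x = y = 0 \<le> z\<close>, and along the locus
  the height function is \<open>H(0, 0, v\<^sup>2)\<close>. Hence its order along the locus is even, the plane contains the
  tangent line of the image of the locus exactly if \<open>H\<^sub>z(0) = 0\<close>, and the height function is
  nonsingular exactly if \<open>H\<^sub>x(0) \<noteq> 0\<close>. One of the partial derivatives of \<open>H\<close> does not vanish at
  the origin, so the surface is a graph over a coordinate plane, and the section becomes a plane curve
  with an explicit equation (lemma \<open>diffeomorphic_in_plane_section_curve\<close>):

  \<^item> If \<open>H\<^sub>x(0) \<noteq> 0\<close>, the surface is \<open>x = U(y, z)\<close> and the section is \<open>y\<^sup>2 = z U(y, z)\<^sup>2\<close>. If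
    \<open>U(0, z)\<close> has order \<open>k\<close>, completing the square turns this into \<open>y\<^sup>2 = z\<^sup>2\<^sup>k\<^sup>+\<^sup>1\<close>
    (\<open>cusp_normal_form\<close>). The number \<open>k\<close> is also the order of \<open>H(0, 0, z)\<close>.

  \<^item> If \<open>H\<^sub>x(0) = H\<^sub>z(0) = 0\<close>, the surface is \<open>y = V(x, z)\<close> and the section is
    \<open>V(x, z)\<^sup>2 = x\<^sup>2 z\<close>, \<open>z \<ge> 0\<close>. The zero set \<open>u v = V(u, v\<^sup>2)\<close> in the source has a branch
    \<open>v = u \<tau>(u)\<close>, whose image \<open>z = (x \<tau>(x))\<^sup>2\<close> is a smooth component of the section. Dividing its
    equation out (\<open>branch_division\<close>) leaves a cusp, again treated by \<open>cusp_normal_form\<close>.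

  \<^item> If \<open>H\<^sub>x(0) = 0 \<noteq> H\<^sub>z(0)\<close>, the surface is \<open>z = Q(x, y)\<close> and the section is
    \<open>y\<^sup>2 = x\<^sup>2 Q(x, y)\<close>, while the height function is a unit times \<open>v\<^sup>2 - Q(u, u v)\<close>. A single second-order
    expansion of \<open>Q\<close> (\<open>critical_expansion\<close>) brings the function into the form \<open>t\<^sup>2 - u\<^sup>2 e(u)\<close> and
    the section into the form \<open>y\<^sup>2 = x\<^sup>4 e(x)\<close>, so that the exponent rises by two. That \<open>u\<^sup>2 e(u)\<close> has
    order exactly \<open>k + 1\<close> for an \<open>A\<^sub>k\<close> singularity follows by comparing how fast the first-order jets
    of contact equivalent functions decay (\<open>A_singularity_order\<close>).

  In the second case the normal form shows that the height function is a multiple of \<open>u v + O(3)\<close>,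
  which makes the first branch tangent to the \<open>u\<close>-axis (\<open>tangent_to_u_axis\<close>).

  The smooth calculus behind this is Hadamard's lemma with parameters, which makes every
  division above smooth, and an implicit function theorem for one variable with parameters.
\<close>

section \<open>Finite differentiability\<close>

lemma Ck_on_has_derivative:
  "Ck_on (Suc k) S f \<Longrightarrow> x \<in> S \<Longrightarrow> (f has_derivative frechet_derivative f (at x)) (at x)"
  by (simp add: frechet_derivative_works[symmetric])

lemma Ck_on_cong:
  assumes "open S" "\<And>x. x \<in> S \<Longrightarrow> f x = g x" "Ck_on k S f"
  shows "Ck_on k S g"
  using assms(2,3)
proof (induction k arbitrary: f g)
  case 0
  then show ?case
    using continuous_on_cong[of S S f g] by auto
next
  case (Suc k)
  have D: "(g has_derivative frechet_derivative f (at x)) (at x)" if "x \<in> S" for x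
    using Ck_on_has_derivative[OF Suc.prems(2) that]
    by (rule has_derivative_transform_within_open[OF _ assms(1) that]) (use Suc.prems(1) in auto)
  have "Ck_on k S (\<lambda>x. frechet_derivative g (at x) d)" for d
  proof (rule Suc.IH)
    show "Ck_on k S (\<lambda>x. frechet_derivative f (at x) d)" using Suc.prems by simp
    show "frechet_derivative f (at x) d = frechet_derivative g (at x) d" if "x \<in> S" for x
      using frechet_derivative_at[OF D[OF that]] by simp
  qed
  with D show ?case
    by (auto simp: differentiable_def)
qed

lemma Ck_on_SucI:
  assumes "open S" "\<And>x. x \<in> S \<Longrightarrow> (f has_derivative f' x) (at x)" "\<And>d. Ck_on k S (\<lambda>x. f' x d)"
  shows "Ck_on (Suc k) S f"
proof -
  have "f' x d = frechet_derivative f (at x) d" if "x \<in> S" for x d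
    using frechet_derivative_at[OF assms(2)[OF that]] by simp
  then have "Ck_on k S (\<lambda>x. frechet_derivative f (at x) d)" for d
    by (intro Ck_on_cong[OF assms(1) _ assms(3)[of d]]) simp
  then show ?thesis using assms(2) by (auto simp: differentiable_def)
qed

lemma Ck_on_Suc_lower: "Ck_on (Suc k) S f \<Longrightarrow> Ck_on k S f"
proof (induction k arbitrary: f)
  case 0
  then have "\<forall>x\<in>S. isCont f x"
    by (auto intro: differentiable_imp_continuous_within)
  then show ?case by (simp add: continuous_at_imp_continuous_on)
next
  case (Suc k)
  then show ?case by simp
qed

lemma Ck_on_continuous: "Ck_on k S f \<Longrightarrow> continuous_on S f"
proof (induction k)
  case (Suc k)
  then show ?case using Ck_on_Suc_lower by blast
qed simp

lemma Ck_on_subset: "Ck_on k S f \<Longrightarrow> T \<subseteq> S \<Longrightarrow> Ck_on k T f"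
proof (induction k arbitrary: f)
  case 0
  then show ?case using continuous_on_subset by auto
next
  case (Suc k)
  then show ?case by (metis (no_types) Ck_on.simps(2) subsetD)
qed

lemma Ck_on_const: "open S \<Longrightarrow> Ck_on k S (\<lambda>x. c)"
  by (induction k arbitrary: c) simp_all

lemma Ck_on_linear:
  assumes "bounded_linear L" "open S" "Ck_on k S f"
  shows "Ck_on k S (\<lambda>x. L (f x))"
  using assms(3)
proof (induction k arbitrary: f)
  case 0
  then show ?case using bounded_linear.continuous_on[OF assms(1)] by auto
next
  case (Suc k)
  show ?case
  proof (rule Ck_on_SucI[OF assms(2)])
    show "((\<lambda>x. L (f x)) has_derivative (\<lambda>d. L (frechet_derivative f (at x) d))) (at x)"
      if "x \<in> S" for x
      using bounded_linear.has_derivative[OF assms(1) Ck_on_has_derivative[OF Suc.prems that]] .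
    show "Ck_on k S (\<lambda>x. L (frechet_derivative f (at x) d))" for d
      using Suc.prems by (intro Suc.IH) simp
  qed
qed

lemma Ck_on_id: "open S \<Longrightarrow> Ck_on k S (\<lambda>x. x)"
  by (cases k) (simp_all add: Ck_on_const)

lemma Ck_on_add:
  assumes "open S" "Ck_on k S f" "Ck_on k S g"
  shows "Ck_on k S (\<lambda>x. f x + g x)"
  using assms(2,3)
proof (induction k arbitrary: f g)
  case 0
  then show ?case by (auto intro: continuous_on_add)
next
  case (Suc k)
  show ?case
  proof (rule Ck_on_SucI[OF assms(1)])
    show "((\<lambda>x. f x + g x) has_derivative
       (\<lambda>d. frechet_derivative f (at x) d + frechet_derivative g (at x) d)) (at x)" if "x \<in> S" for x
      using Suc.prems that by (intro has_derivative_add Ck_on_has_derivative)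
    show "Ck_on k S (\<lambda>x. frechet_derivative f (at x) d + frechet_derivative g (at x) d)" for d
      using Suc.prems by (intro Suc.IH) simp_all
  qed
qed

lemma Ck_on_sum:
  assumes "open S" "\<And>i. i \<in> I \<Longrightarrow> Ck_on k S (f i)"
  shows "Ck_on k S (\<lambda>x. \<Sum>i\<in>I. f i x)"
  using assms(2)
proof (induction I rule: infinite_finite_induct)
  case (insert i I)
  then have "Ck_on k S (\<lambda>x. f i x + (\<Sum>i\<in>I. f i x))"
    by (intro Ck_on_add[OF assms(1)]) simp_all
  with insert show ?case by simp
qed (simp_all add: Ck_on_const[OF assms(1)])

lemma Ck_on_bilinear:
  assumes "bounded_bilinear B" "open S" "Ck_on k S f" "Ck_on k S g"
  shows "Ck_on k S (\<lambda>x. B (f x) (g x))"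
  using assms(3,4)
proof (induction k arbitrary: f g)
  case 0
  then show ?case using bounded_bilinear.continuous_on[OF assms(1)] by auto
next
  case (Suc k)
  show ?case
  proof (rule Ck_on_SucI[OF assms(2)])
    show "((\<lambda>x. B (f x) (g x)) has_derivative
       (\<lambda>d. B (f x) (frechet_derivative g (at x) d) + B (frechet_derivative f (at x) d) (g x))) (at x)"
      if "x \<in> S" for x
      using bounded_bilinear.FDERIV[OF assms(1) Ck_on_has_derivative[OF Suc.prems(1) that]
          Ck_on_has_derivative[OF Suc.prems(2) that]] .
    show "Ck_on k S (\<lambda>x. B (f x) (frechet_derivative g (at x) d) + B (frechet_derivative f (at x) d) (g x))" for d
      using Suc.prems Ck_on_Suc_lower[OF Suc.prems(1)] Ck_on_Suc_lower[OF Suc.prems(2)]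
      by (intro Ck_on_add[OF assms(2)] Suc.IH) simp_all
  qed
qed

lemma Ck_on_Pair:
  assumes "open S" "Ck_on k S f" "Ck_on k S g"
  shows "Ck_on k S (\<lambda>x. (f x, g x))"
proof -
  have "bounded_linear (\<lambda>a. (a, 0 :: 'c))" "bounded_linear (\<lambda>b. (0 :: 'b, b))"
    by (intro bounded_linear_Pair bounded_linear_ident bounded_linear_zero)+
  from Ck_on_add[OF assms(1) Ck_on_linear[OF this(1) assms(1,2)] Ck_on_linear[OF this(2) assms(1,3)]]
  show ?thesis by simp
qed

text \<open>The chain rule is iterated by expanding the inner derivative in an orthonormal basis: the
  derivative of a composition then is a sum of products of functions that are again compositions.\<close>

lemma Ck_on_compose:
  fixes f :: "'b::euclidean_space \<Rightarrow> 'c::real_normed_vector"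
    and g :: "'a::real_normed_vector \<Rightarrow> 'b"
  assumes "open S" "Ck_on k T f" "Ck_on k S g" "g ` S \<subseteq> T"
  shows "Ck_on k S (\<lambda>x. f (g x))"
  using assms(2-4)
proof (induction k arbitrary: f g)
  case 0
  then show ?case by (auto intro: continuous_on_compose2)
next
  case (Suc k)
  show ?case
  proof (rule Ck_on_SucI[OF assms(1)])
    show "((\<lambda>x. f (g x)) has_derivative
        (\<lambda>d. \<Sum>i\<in>Basis. (frechet_derivative g (at x) d \<bullet> i) *\<^sub>R frechet_derivative f (at (g x)) i)) (at x)"
      if "x \<in> S" for x
    proof -
      have gx: "g x \<in> T" using that Suc.prems by auto
      note f' = Ck_on_has_derivative[OF Suc.prems(1) gx]
      note g' = Ck_on_has_derivative[OF Suc.prems(2) that]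
      interpret l: linear "frechet_derivative f (at (g x))"
        using f' has_derivative_linear by blast
      have "frechet_derivative f (at (g x)) (frechet_derivative g (at x) d) =
          (\<Sum>i\<in>Basis. (frechet_derivative g (at x) d \<bullet> i) *\<^sub>R frechet_derivative f (at (g x)) i)" for d
        using l.sum[of "\<lambda>i. (frechet_derivative g (at x) d \<bullet> i) *\<^sub>R i" Basis]
        by (simp only: euclidean_representation l.scaleR)
      then show ?thesis
        by (intro has_derivative_eq_rhs[OF has_derivative_compose[OF g' f']] ext)
    qed
    show "Ck_on k S (\<lambda>x. \<Sum>i\<in>Basis. (frechet_derivative g (at x) d \<bullet> i) *\<^sub>R frechet_derivative f (at (g x)) i)" for d
    proof (intro Ck_on_sum[OF assms(1)] Ck_on_bilinear[OF bounded_bilinear_scaleR assms(1)])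
      fix i :: 'b
      show "Ck_on k S (\<lambda>x. frechet_derivative g (at x) d \<bullet> i)"
        using Suc.prems by (intro Ck_on_linear[OF bounded_linear_inner_left assms(1)]) auto
      show "Ck_on k S (\<lambda>x. frechet_derivative f (at (g x)) i)"
        using Suc.prems by (intro Suc.IH[OF _ Ck_on_Suc_lower[OF Suc.prems(2)]]) simp_all
    qed
  qed
qed

lemma Ck_on_inverse: "Ck_on k (- {0}) (inverse :: real \<Rightarrow> real)"
proof (induction k)
  case 0
  then show ?case by (auto intro!: continuous_intros)
next
  case (Suc k)
  have op: "open (- {0 :: real})" by auto
  show ?case
  proof (rule Ck_on_SucI[OF op])
    show "(inverse has_derivative (\<lambda>h. - (inverse x * h * inverse x))) (at x)" if "x \<in> - {0}" for x :: real
      using has_derivative_inverse'[of x UNIV] that by auto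
    have "Ck_on k (- {0}) (\<lambda>x::real. (- d) * (inverse x * inverse x))" for d
      by (intro Ck_on_bilinear[OF bounded_bilinear_mult op] Ck_on_const Suc op)
    then show "Ck_on k (- {0}) (\<lambda>x::real. - (inverse x * d * inverse x))" for d
      by (simp add: algebra_simps)
  qed
qed

lemma Ck_on_sqrt: "Ck_on k {0<..} sqrt"
proof (induction k)
  case 0
  then show ?case by (auto intro!: continuous_intros)
next
  case (Suc k)
  have op: "open {0 :: real<..}" by auto
  show ?case
  proof (rule Ck_on_SucI[OF op])
    show "(sqrt has_derivative (\<lambda>h. h * (inverse (sqrt x) / 2))) (at x)" if "x \<in> {0<..}" for x :: real
    proof -
      have "(\<lambda>h. h * (inverse (sqrt x) / 2)) = (*) (inverse (sqrt x) / 2)"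
        by (simp add: fun_eq_iff mult.commute)
      with that DERIV_real_sqrt[of x] show ?thesis by (simp only: has_field_derivative_def) simp
    qed
    have "Ck_on k {0<..} (\<lambda>x. inverse (sqrt x))"
      by (rule Ck_on_compose[OF op Ck_on_inverse Suc]) auto
    then have "Ck_on k {0<..} (\<lambda>x. (d / 2) * inverse (sqrt x))" for d
      by (intro Ck_on_bilinear[OF bounded_bilinear_mult op] Ck_on_const op)
    then show "Ck_on k {0<..} (\<lambda>x. d * (inverse (sqrt x) / 2))" for d
      by (simp add: algebra_simps)
  qed
qed

text \<open>A directional derivative of the integral is the integral of a directional derivative of the integrand,
  that is, of a function of the same kind with one degree of differentiability less.\<close>

lemma Ck_on_integral:
  fixes K :: "'a::euclidean_space \<times> real \<Rightarrow> real"
  assumes "open U" "convex U" "open V" "{0..1} \<subseteq> V" "Ck_on k (U \<times> V) K"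
  shows "Ck_on k U (\<lambda>x. integral {0..1} (\<lambda>t. K (x, t)))"
  using assms(5)
proof (induction k arbitrary: K)
  case 0
  have "continuous_on (U \<times> cbox 0 1) (\<lambda>(x, t). K (x, t))"
    using 0 assms(4) by (auto intro: continuous_on_subset)
  then show ?case
    using integral_continuous_on_param[of U 0 1 "\<lambda>x t. K (x, t)"] by simp
next
  case (Suc k)
  define K' where "K' = (\<lambda>x t d. frechet_derivative K (at (x, t)) (d, 0))"
  have op: "open (U \<times> V)" using assms by (intro open_Times)
  have K': "((\<lambda>x. K (x, t)) has_derivative K' x t) (at x)" if "x \<in> U" "t \<in> V" for x t
  proof -
    have "(K has_derivative frechet_derivative K (at (x, t))) (at (x, t))"
      using Ck_on_has_derivative[OF Suc.prems] that by auto
    from has_derivative_compose[OF has_derivative_Pair[OF has_derivative_ident has_derivative_const] this]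
    show ?thesis by (simp add: K'_def)
  qed
  have CK': "Ck_on k (U \<times> V) (\<lambda>(x, t). K' x t d)" for d
    using Suc.prems by (simp add: K'_def split_def)
  have bl: "blinfun_apply (Blinfun (K' x t)) = K' x t" if "x \<in> U" "t \<in> V" for x t
    by (rule bounded_linear_Blinfun_apply) (use K'[OF that] has_derivative_bounded_linear in blast)
  have sub: "U \<times> cbox 0 1 \<subseteq> U \<times> V" using assms(4) by auto
  have cont: "continuous_on (U \<times> cbox 0 1) (\<lambda>(x, t). Blinfun (K' x t))"
  proof (rule continuous_on_blinfun_componentwise)
    fix i :: 'a assume "i \<in> Basis"
    have "continuous_on (U \<times> cbox 0 1) (\<lambda>(x, t). K' x t i)"
      using continuous_on_subset[OF Ck_on_continuous[OF CK'] sub] .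
    then show "continuous_on (U \<times> cbox 0 1) (\<lambda>x. blinfun_apply (case x of (x, t) \<Rightarrow> Blinfun (K' x t)) i)"
      by (rule continuous_on_eq) (use bl sub in auto)
  qed
  have contK: "continuous_on (U \<times> V) K" using Ck_on_continuous[OF Suc.prems] .
  have D: "((\<lambda>x. integral {0..1} (\<lambda>t. K (x, t))) has_derivative
      blinfun_apply (integral (cbox 0 1) (\<lambda>t. Blinfun (K' x t)))) (at x)" if x: "x \<in> U" for x
  proof -
    have "((\<lambda>x. integral (cbox 0 1) (\<lambda>t. K (x, t))) has_derivative
      blinfun_apply (integral (cbox 0 1) (\<lambda>t. Blinfun (K' x t)))) (at x within U)"
    proof (rule leibniz_rule[OF _ _ cont x assms(2)])
      show "((\<lambda>x. K (x, t)) has_derivative blinfun_apply (Blinfun (K' x t))) (at x within U)"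
        if "x \<in> U" "t \<in> cbox 0 1" for x t
      proof -
        have "t \<in> V" using that assms(4) by auto
        with K' bl that show ?thesis by (simp add: has_derivative_at_withinI)
      qed
      show "(\<lambda>t. K (x, t)) integrable_on cbox 0 1" if "x \<in> U" for x
      proof -
        have "continuous_on (cbox 0 1) (\<lambda>t. K (x, t))"
          by (rule continuous_on_compose2[OF contK]) (use that assms(4) in \<open>auto intro!: continuous_intros\<close>)
        then show ?thesis by (rule integrable_continuous)
      qed
    qed
    then show ?thesis using at_within_open[OF x assms(1)] by simp
  qed
  have app: "blinfun_apply (integral (cbox 0 1) (\<lambda>t. Blinfun (K' x t))) d = integral {0..1} (\<lambda>t. K' x t d)"
    if x: "x \<in> U" for x d
  proof -
    have "continuous_on (cbox 0 1) (\<lambda>t. Blinfun (K' x t))"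
    proof -
      have "continuous_on (cbox 0 1) (\<lambda>t. (x, t))" by (intro continuous_intros)
      from continuous_on_compose2[OF cont this] x show ?thesis by (simp add: image_subset_iff)
    qed
    then have "(\<lambda>t. Blinfun (K' x t)) integrable_on cbox 0 1" by (rule integrable_continuous)
    from blinfun_apply_integral[OF this]
    have "blinfun_apply (integral (cbox 0 1) (\<lambda>t. Blinfun (K' x t))) d
        = integral (cbox 0 1) (\<lambda>t. blinfun_apply (Blinfun (K' x t)) d)" .
    also have "\<dots> = integral (cbox 0 1) (\<lambda>t. K' x t d)"
      by (rule Henstock_Kurzweil_Integration.integral_cong) (use bl x assms(4) in auto)
    finally show ?thesis by simp
  qed
  show ?case
  proof (rule Ck_on_SucI[OF assms(1) D])
    fix d
    have "Ck_on k U (\<lambda>x. integral {0..1} (\<lambda>t. K' x t d))"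
      using Suc.IH[OF CK'[of d]] by simp
    then show "Ck_on k U (\<lambda>x. blinfun_apply (integral (cbox 0 1) (\<lambda>t. Blinfun (K' x t))) d)"
      by (rule Ck_on_cong[OF assms(1), rotated]) (use app in auto)
  qed auto
qed

section \<open>Smooth germs\<close>

lemma smooth_germ_iff: "smooth_germ f \<longleftrightarrow> (\<exists>S. open S \<and> 0 \<in> S \<and> (\<forall>k. Ck_on k S f))"
  unfolding smooth_germ_def smooth_on_def by auto

lemma smooth_germ_cong:
  assumes "\<forall>\<^sub>F x in nhds 0. f x = g x" "smooth_germ f"
  shows "smooth_germ g"
proof -
  obtain S where S: "open S" "0 \<in> S" "\<forall>k. Ck_on k S f" using assms(2) smooth_germ_iff by blast
  obtain T where T: "open T" "0 \<in> T" "\<forall>x\<in>T. f x = g x" using assms(1) by (auto simp: eventually_nhds)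
  have "Ck_on k (S \<inter> T) g" for k
    by (rule Ck_on_cong[of "S \<inter> T" f]) (use S T in \<open>auto intro: Ck_on_subset\<close>)
  then show ?thesis using S T smooth_germ_iff by (metis IntI open_Int)
qed

lemma smooth_germ_const: "smooth_germ (\<lambda>x. c)"
  unfolding smooth_germ_iff by (intro exI[of _ UNIV]) (simp add: Ck_on_const)

lemma smooth_germ_id: "smooth_germ (\<lambda>x. x)"
  unfolding smooth_germ_iff by (intro exI[of _ UNIV]) (simp add: Ck_on_id)

lemma smooth_germ_bounded_linear:
  assumes "bounded_linear L" "smooth_germ f"
  shows "smooth_germ (\<lambda>x. L (f x))"
  using assms Ck_on_linear unfolding smooth_germ_iff by metis

lemmas smooth_germ_fst = smooth_germ_bounded_linear[OF bounded_linear_fst]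
  and smooth_germ_snd = smooth_germ_bounded_linear[OF bounded_linear_snd]
  and smooth_germ_minus = smooth_germ_bounded_linear[OF bounded_linear_minus[OF bounded_linear_ident]]
  and smooth_germ_inner = smooth_germ_bounded_linear[OF bounded_linear_inner_left]

lemma smooth_germ_bilinear:
  assumes "bounded_bilinear B" "smooth_germ f" "smooth_germ g"
  shows "smooth_germ (\<lambda>x. B (f x) (g x))"
proof -
  obtain S where S: "open S" "0 \<in> S" "\<forall>k. Ck_on k S f" using assms smooth_germ_iff by blast
  obtain T where T: "open T" "0 \<in> T" "\<forall>k. Ck_on k T g" using assms smooth_germ_iff by blast
  have "Ck_on k (S \<inter> T) (\<lambda>x. B (f x) (g x))" for k
    using S T by (intro Ck_on_bilinear[OF assms(1)]) (auto intro: Ck_on_subset)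
  then show ?thesis using S T smooth_germ_iff by (metis IntI open_Int)
qed

lemmas smooth_germ_mult = smooth_germ_bilinear[OF bounded_bilinear_mult]

lemma smooth_germ_Pair:
  assumes "smooth_germ f" "smooth_germ g"
  shows "smooth_germ (\<lambda>x. (f x, g x))"
proof -
  obtain S where S: "open S" "0 \<in> S" "\<forall>k. Ck_on k S f" using assms smooth_germ_iff by blast
  obtain T where T: "open T" "0 \<in> T" "\<forall>k. Ck_on k T g" using assms smooth_germ_iff by blast
  have "Ck_on k (S \<inter> T) (\<lambda>x. (f x, g x))" for k
    using S T by (intro Ck_on_Pair) (auto intro: Ck_on_subset)
  then show ?thesis using S T smooth_germ_iff by (metis IntI open_Int)
qed

lemma smooth_germ_add:
  assumes "smooth_germ f" "smooth_germ g"
  shows "smooth_germ (\<lambda>x. f x + g x)"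
proof -
  obtain S where S: "open S" "0 \<in> S" "\<forall>k. Ck_on k S f" using assms smooth_germ_iff by blast
  obtain T where T: "open T" "0 \<in> T" "\<forall>k. Ck_on k T g" using assms smooth_germ_iff by blast
  have "Ck_on k (S \<inter> T) (\<lambda>x. f x + g x)" for k
    using S T by (intro Ck_on_add) (auto intro: Ck_on_subset)
  then show ?thesis using S T smooth_germ_iff by (metis IntI open_Int)
qed

lemma smooth_germ_diff:
  assumes "smooth_germ f" "smooth_germ g"
  shows "smooth_germ (\<lambda>x. f x - g x)"
  using smooth_germ_add[OF assms(1) smooth_germ_minus[OF assms(2)]] by simp

lemma smooth_germ_power:
  fixes f :: "'a::real_normed_vector \<Rightarrow> real"
  assumes "smooth_germ f"
  shows "smooth_germ (\<lambda>x. f x ^ n)"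
  by (induction n) (simp_all add: smooth_germ_const smooth_germ_mult assms)

lemma smooth_germ_continuous:
  assumes "smooth_germ f"
  shows "isCont f 0"
proof -
  obtain S where "open S" "0 \<in> S" "\<forall>k. Ck_on k S f" using assms smooth_germ_iff by blast
  then show ?thesis using Ck_on_continuous continuous_on_eq_continuous_at by blast
qed

lemma smooth_germ_tendsto: "smooth_germ f \<Longrightarrow> (f \<longlongrightarrow> f 0) (nhds 0)"
  using smooth_germ_continuous by (simp add: isCont_def tendsto_nhds_iff)

lemma smooth_germ_tendsto_0: "smooth_germ f \<Longrightarrow> f 0 = 0 \<Longrightarrow> filterlim f (nhds 0) (nhds 0)"
  using smooth_germ_tendsto by metis

lemma smooth_germ_eventually:
  assumes "smooth_germ f" "f 0 = 0" "\<forall>\<^sub>F y in nhds 0. P y"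
  shows "\<forall>\<^sub>F x in nhds 0. P (f x)"
  using eventually_compose_filterlim[OF assms(3) smooth_germ_tendsto_0[OF assms(1,2)]] .

lemma smooth_germ_eventually_greater:
  fixes f :: "'a::real_normed_vector \<Rightarrow> real"
  shows "smooth_germ f \<Longrightarrow> f 0 > c \<Longrightarrow> \<forall>\<^sub>F x in nhds 0. f x > c"
  using order_tendstoD(1)[OF smooth_germ_tendsto] by blast

lemma smooth_germ_eventually_nonzero:
  fixes f :: "'a::real_normed_vector \<Rightarrow> real"
  shows "smooth_germ f \<Longrightarrow> f 0 \<noteq> 0 \<Longrightarrow> \<forall>\<^sub>F x in nhds 0. f x \<noteq> 0"
  using tendsto_imp_eventually_ne[OF smooth_germ_tendsto] by blast

lemma smooth_germ_compose_on:
  fixes f :: "'b::euclidean_space \<Rightarrow> 'c::real_normed_vector"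
  assumes "open T" "\<And>k. Ck_on k T f" "smooth_germ g" "g 0 \<in> T"
  shows "smooth_germ (\<lambda>x. f (g x))"
proof -
  obtain S where S: "open S" "0 \<in> S" "\<forall>k. Ck_on k S g" using assms smooth_germ_iff by blast
  have "continuous_on S g" using S Ck_on_continuous by blast
  then have op: "open (g -` T \<inter> S)" using S assms continuous_on_open_vimage by blast
  have "Ck_on k (g -` T \<inter> S) (\<lambda>x. f (g x))" for k
  proof (rule Ck_on_compose[OF op assms(2)[of k]])
    show "Ck_on k (g -` T \<inter> S) g" using S(3) Ck_on_subset[of k S g] by blast
  qed auto
  then show ?thesis using op S assms(4) smooth_germ_iff by (metis IntI vimageI)
qed

lemma smooth_germ_compose:
  fixes f :: "'b::euclidean_space \<Rightarrow> 'c::real_normed_vector"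
  assumes "smooth_germ f" "smooth_germ g" "g 0 = 0"
  shows "smooth_germ (\<lambda>x. f (g x))"
proof -
  obtain S where S: "open S" "0 \<in> S" "\<And>k. Ck_on k S f" using assms smooth_germ_iff by blast
  then show ?thesis using smooth_germ_compose_on[OF S(1,3) assms(2)] assms(3) by simp
qed

lemma smooth_germ_divide:
  fixes f :: "'a::real_normed_vector \<Rightarrow> real"
  assumes "smooth_germ f" "smooth_germ g" "g 0 \<noteq> 0"
  shows "smooth_germ (\<lambda>x. f x / g x)"
  unfolding divide_inverse
  by (intro smooth_germ_mult assms(1) smooth_germ_compose_on[OF _ Ck_on_inverse assms(2)])
    (use assms(3) in auto)

lemma smooth_germ_sqrt:
  fixes f :: "'a::real_normed_vector \<Rightarrow> real"
  assumes "smooth_germ f" "f 0 > 0"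
  shows "smooth_germ (\<lambda>x. sqrt (f x))"
  by (intro smooth_germ_compose_on[OF _ Ck_on_sqrt assms(1)]) (use assms(2) in auto)

lemmas smooth_intros = smooth_germ_const smooth_germ_id smooth_germ_fst smooth_germ_snd
  smooth_germ_minus smooth_germ_inner smooth_germ_mult smooth_germ_Pair smooth_germ_add
  smooth_germ_diff smooth_germ_power smooth_germ_divide smooth_germ_sqrt

lemma smooth_germ_frechet_derivative:
  assumes "smooth_germ f"
  shows "smooth_germ (\<lambda>x. frechet_derivative f (at x) d)"
proof -
  obtain S where S: "open S" "0 \<in> S" "\<forall>k. Ck_on k S f" using assms smooth_germ_iff by blast
  then have "\<forall>k. Ck_on k S (\<lambda>x. frechet_derivative f (at x) d)" using Ck_on.simps(2) by blast
  then show ?thesis using S smooth_germ_iff by blast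
qed

lemma smooth_germ_eventually_has_derivative:
  assumes "smooth_germ f"
  shows "\<forall>\<^sub>F x in nhds 0. (f has_derivative frechet_derivative f (at x)) (at x)"
proof -
  obtain S where S: "open S" "0 \<in> S" "\<forall>k. Ck_on k S f" using assms smooth_germ_iff by blast
  then show ?thesis using Ck_on_has_derivative unfolding eventually_nhds by blast
qed

lemma smooth_germ_has_derivative:
  "smooth_germ f \<Longrightarrow> (f has_derivative frechet_derivative f (at 0)) (at 0)"
  using smooth_germ_eventually_has_derivative eventually_nhds_x_imp_x by fastforce

lemma has_derivative_cong_eventually:
  assumes "(f has_derivative f') (at x)" "\<forall>\<^sub>F y in nhds x. f y = g y"
  shows "(g has_derivative f') (at x)"
proof -
  obtain S where "open S" "x \<in> S" "\<And>y. y \<in> S \<Longrightarrow> f y = g y"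
    using assms(2) by (auto simp: eventually_nhds)
  then show ?thesis using has_derivative_transform_within_open[OF assms(1)] by blast
qed

lemma frechet_derivative_cong_eventually:
  assumes "\<forall>\<^sub>F y in nhds 0. f y = g y" "smooth_germ f"
  shows "frechet_derivative f (at 0) = frechet_derivative g (at 0)"
  using frechet_derivative_at[OF has_derivative_cong_eventually[OF smooth_germ_has_derivative[OF assms(2)] assms(1)]] .

lemma frechet_derivative_mult_0:
  fixes f g :: "'a::real_normed_vector \<Rightarrow> real"
  assumes "smooth_germ f" "smooth_germ g"
  shows "frechet_derivative (\<lambda>x. f x * g x) (at 0) d =
    f 0 * frechet_derivative g (at 0) d + frechet_derivative f (at 0) d * g 0"
  using fun_cong[OF frechet_derivative_at[OF has_derivative_mult[OF smooth_germ_has_derivative[OF assms(1)]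
      smooth_germ_has_derivative[OF assms(2)]]], of d] by simp

lemma frechet_derivative_compose_0:
  assumes "smooth_germ f" "smooth_germ g" "g 0 = 0"
  shows "frechet_derivative (\<lambda>x. f (g x)) (at 0) d =
    frechet_derivative f (at 0) (frechet_derivative g (at 0) d)"
proof -
  have "(f has_derivative frechet_derivative f (at 0)) (at (g 0))"
    using smooth_germ_has_derivative[OF assms(1)] assms(3) by simp
  from fun_cong[OF frechet_derivative_at[OF has_derivative_compose[OF smooth_germ_has_derivative[OF assms(2)] this]], of d]
  show ?thesis by simp
qed

lemma linear_frechet_derivative: "smooth_germ f \<Longrightarrow> linear (frechet_derivative f (at 0))"
  using smooth_germ_has_derivative has_derivative_linear by blast

text \<open>Hadamard's lemma, with parameters: the quotient is the average of the derivative over the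
  segment from \<open>(0, p)\<close> to \<open>(x, p)\<close>.\<close>

lemma hadamard:
  fixes f :: "real \<times> 'p::euclidean_space \<Rightarrow> real"
  assumes "smooth_germ f"
  shows "\<exists>q. smooth_germ q \<and> (\<forall>\<^sub>F z in nhds 0. f z = f (0, snd z) + fst z * q z)"
proof -
  obtain S where S: "open S" "0 \<in> S" "\<And>k. Ck_on k S f" using assms smooth_germ_iff by blast
  obtain e where e: "e > 0" "ball 0 e \<subseteq> S" using S open_contains_ball by blast
  define U where "U = (ball 0 (e / 2) :: (real \<times> 'p) set)"
  define V where "V = {-2 <..< 2 :: real}"
  define m where "m = (\<lambda>w :: (real \<times> 'p) \<times> real. (snd w * fst (fst w), snd (fst w)))"
  define K where "K = (\<lambda>w. frechet_derivative f (at (m w)) (1, 0))"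
  have mS: "m w \<in> S" if "w \<in> U \<times> V" for w
  proof -
    obtain x p t where w: "w = ((x, p), t)" by (metis surj_pair)
    have t: "\<bar>t\<bar> \<le> 2" and n: "norm (x, p) < e / 2" using that unfolding w U_def V_def by auto
    have "\<bar>t\<bar> * \<bar>x\<bar> \<le> 2 * \<bar>x\<bar>" using t by (intro mult_right_mono) auto
    then have "(t * x)\<^sup>2 \<le> (2 * x)\<^sup>2" using abs_le_square_iff[of "t * x" "2 * x"] by (simp add: abs_mult)
    moreover have "(norm p)\<^sup>2 \<le> (2 * norm p)\<^sup>2" by (intro power_mono) auto
    ultimately have "norm (t * x, p) \<le> sqrt ((2 * x)\<^sup>2 + (2 * norm p)\<^sup>2)"
      unfolding norm_Pair by (intro real_sqrt_le_mono add_mono) auto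
    also have "(2 * x)\<^sup>2 + (2 * norm p)\<^sup>2 = 4 * (x\<^sup>2 + (norm p)\<^sup>2)" by (simp add: power_mult_distrib)
    also have "sqrt \<dots> = 2 * norm (x, p)"
      unfolding norm_Pair real_sqrt_mult by simp
    finally show ?thesis using n e unfolding w m_def by (auto simp: subset_iff)
  qed
  have opU: "open U" and cvU: "convex U" and opV: "open V" and subV: "{0..1} \<subseteq> V"
    unfolding U_def V_def by auto
  have op: "open (U \<times> V)" using opU opV by (rule open_Times)
  have CK: "Ck_on k (U \<times> V) K" for k
    unfolding K_def
  proof (rule Ck_on_compose[OF op, of k S "\<lambda>y. frechet_derivative f (at y) (1, 0)" m])
    show "Ck_on k S (\<lambda>y. frechet_derivative f (at y) (1, 0))" using S(3)[of "Suc k"] by simp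
    show "Ck_on k (U \<times> V) m" unfolding m_def
      by (intro Ck_on_Pair Ck_on_bilinear[OF bounded_bilinear_mult] op
          Ck_on_linear[OF bounded_linear_fst op] Ck_on_linear[OF bounded_linear_snd op] Ck_on_id)
    show "m ` (U \<times> V) \<subseteq> S" using mS by auto
  qed
  define q where "q = (\<lambda>z. integral {0..1} (\<lambda>t. K (z, t)))"
  have "Ck_on k U q" for k
    unfolding q_def by (rule Ck_on_integral[OF opU cvU opV subV CK])
  moreover have "0 \<in> U" using e by (simp add: U_def)
  ultimately have sq: "smooth_germ q" using opU smooth_germ_iff by blast
  have "f z = f (0, snd z) + fst z * q z" if "z \<in> U" for z
  proof -
    obtain x p where z: "z = (x, p)" by fastforce
    have D: "((\<lambda>t. f (t * x, p)) has_vector_derivative x * K (z, t)) (at t within {0..1})" if "t \<in> {0..1}" for t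
    proof -
      have "(z, t) \<in> U \<times> V" using that subV \<open>z \<in> U\<close> by auto
      from mS[OF this] have "(f has_derivative frechet_derivative f (at (t * x, p))) (at (t * x, p))"
        using Ck_on_has_derivative[OF S(3)] by (simp add: m_def z)
      note Df = this
      have "((\<lambda>t. (t * x, p)) has_derivative (\<lambda>h. (h * x, 0))) (at t within {0..1})"
        by (auto intro!: derivative_eq_intros)
      then have "((\<lambda>t. f (t * x, p)) has_derivative (\<lambda>h. frechet_derivative f (at (t * x, p)) (h * x, 0))) (at t within {0..1})"
        by (rule has_derivative_compose[where f = "\<lambda>t. (t * x, p)" and g = f]) (rule Df)
      moreover have "frechet_derivative f (at (t * x, p)) (h * x, 0) = h *\<^sub>R (x * K (z, t))" for h
      proof -
        interpret l: linear "frechet_derivative f (at (t * x, p))"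
          using Df has_derivative_linear by blast
        have "(h * x, 0) = (h * x) *\<^sub>R (1, 0 :: 'p)" by simp
        then show ?thesis by (simp only: l.scaleR) (simp add: K_def m_def z)
      qed
      ultimately show ?thesis by (simp add: has_vector_derivative_def)
    qed
    have "((\<lambda>t. x * K (z, t)) has_integral f (1 * x, p) - f (0 * x, p)) {0..1}"
      by (rule fundamental_theorem_of_calculus[OF _ D]) auto
    then have "integral {0..1} (\<lambda>t. x * K (z, t)) = f (x, p) - f (0, p)" by (auto dest: integral_unique)
    then show ?thesis by (simp add: z q_def)
  qed
  moreover have "\<forall>\<^sub>F z in nhds 0. z \<in> U" using opU \<open>0 \<in> U\<close> by (rule eventually_nhds_in_open)
  ultimately show ?thesis using sq by (auto elim!: eventually_mono)
qed

section \<open>Implicit functions\<close>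

lemma inverse_function_with_parameters:
  fixes F :: "real \<times> 'p::euclidean_space \<Rightarrow> real"
  assumes "smooth_germ F" "F 0 = 0" "frechet_derivative F (at 0) (1, 0) \<noteq> 0"
  shows "\<exists>\<xi>. smooth_germ \<xi> \<and> \<xi> 0 = 0 \<and> (\<forall>\<^sub>F z in nhds 0. \<xi> (F z, snd z) = fst z) \<and>
    (\<forall>\<^sub>F z in nhds 0. F (\<xi> z, snd z) = fst z)"
proof -
  obtain S\<^sub>0 where S0: "open S\<^sub>0" "0 \<in> S\<^sub>0" "\<And>k. Ck_on k S\<^sub>0 F" using assms(1) smooth_germ_iff by blast
  define DF where "DF = (\<lambda>z. frechet_derivative F (at z))"
  have CDF: "Ck_on k S\<^sub>0 (\<lambda>z. DF z d)" for k d
    using S0(3)[of "Suc k"] by (simp add: DF_def del: split_paired_All)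
  define S where "S = (\<lambda>z. DF z (1, 0)) -` (- {0}) \<inter> S\<^sub>0"
  have opS: "open S" unfolding S_def
    using continuous_on_open_vimage[OF S0(1)] Ck_on_continuous[OF CDF] by blast
  have S: "0 \<in> S" "S \<subseteq> S\<^sub>0" "\<And>z. z \<in> S \<Longrightarrow> DF z (1, 0) \<noteq> 0"
    using assms S0 by (auto simp: S_def DF_def)
  have CF: "Ck_on k S F" and CDF: "Ck_on k S (\<lambda>z. DF z d)" for k d
    using S0(3) CDF Ck_on_subset S(2) by blast+
  have dF: "(F has_derivative DF z) (at z)" if "z \<in> S" for z
    using Ck_on_has_derivative[OF CF that] by (simp add: DF_def)
  have DF_split: "DF z d = fst d * DF z (1, 0) + DF z (0, snd d)" if "z \<in> S" for z d
  proof -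
    interpret l: linear "DF z" using dF[OF that] has_derivative_linear by blast
    have "d = fst d *\<^sub>R (1, 0) + (0, snd d)" by (cases d) simp
    then have "DF z d = DF z (fst d *\<^sub>R (1, 0) + (0, snd d))" by simp
    then show ?thesis by (simp only: l.add l.scaleR) simp
  qed
  have blDF: "bounded_linear (DF z)" if "z \<in> S" for z
    using dF[OF that] has_derivative_bounded_linear by blast
  define \<Phi> where "\<Phi> = (\<lambda>z :: real \<times> 'p. (F z, snd z))"
  define \<Phi>' where "\<Phi>' = (\<lambda>z. Blinfun (\<lambda>d. (DF z d, snd d)))"
  have bl: "blinfun_apply (\<Phi>' z) = (\<lambda>d. (DF z d, snd d))" if "z \<in> S" for z
    unfolding \<Phi>'_def
    by (intro bounded_linear_Blinfun_apply bounded_linear_Pair blDF that bounded_linear_snd)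
  have d\<Phi>: "(\<Phi> has_derivative blinfun_apply (\<Phi>' z)) (at z)" if "z \<in> S" for z
    unfolding bl[OF that] \<Phi>_def
    by (intro has_derivative_Pair dF that bounded_linear_imp_has_derivative bounded_linear_snd)
  have c\<Phi>: "continuous_on S \<Phi>'"
  proof (rule continuous_on_blinfun_componentwise)
    fix i :: "real \<times> 'p"
    have "continuous_on S (\<lambda>z. (DF z i, snd i))"
      by (intro continuous_intros Ck_on_continuous[OF CDF])
    then show "continuous_on S (\<lambda>z. blinfun_apply (\<Phi>' z) i)"
      by (rule continuous_on_eq) (simp add: bl)
  qed
  define J where "J = Blinfun (\<lambda>d :: real \<times> 'p. ((fst d - DF 0 (0, snd d)) / DF 0 (1, 0), snd d))"
  have "bounded_linear (\<lambda>d :: real \<times> 'p. ((fst d - DF 0 (0, snd d)) / DF 0 (1, 0), snd d))"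
    by (intro bounded_linear_Pair bounded_linear_divide bounded_linear_compose[OF bounded_linear_divide]
        bounded_linear_sub bounded_linear_fst
        bounded_linear_snd bounded_linear_zero bounded_linear_compose[OF blDF[OF S(1)]])
  then have J: "blinfun_apply J = (\<lambda>d. ((fst d - DF 0 (0, snd d)) / DF 0 (1, 0), snd d))"
    unfolding J_def by (rule bounded_linear_Blinfun_apply)
  have inv: "J o\<^sub>L \<Phi>' 0 = id_blinfun"
  proof (rule blinfun_eqI)
    fix d :: "real \<times> 'p"
    show "blinfun_apply (J o\<^sub>L \<Phi>' 0) d = blinfun_apply id_blinfun d"
      using DF_split[OF S(1), of d] S(3)[OF S(1)] by (simp add: J bl[OF S(1)] prod_eq_iff)
  qed
  obtain U V g g' where g: "open U" "U \<subseteq> S" "0 \<in> U" "open V" "\<Phi> 0 \<in> V" "homeomorphism U V \<Phi> g"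
    and dg: "\<And>y. y \<in> V \<Longrightarrow> (g has_derivative (g' y)) (at y)"
    and g': "\<And>y. y \<in> V \<Longrightarrow> g' y = inv (blinfun_apply (\<Phi>' (g y)))"
    and bij: "\<And>y. y \<in> V \<Longrightarrow> bij (blinfun_apply (\<Phi>' (g y)))"
    using inverse_function_theorem[OF opS d\<Phi> c\<Phi> S(1) inv] by blast
  have gU: "g y \<in> S" if "y \<in> V" for y
    using g(2,6) that homeomorphism_image2 by blast
  have \<Phi>g: "\<Phi> (g y) = y" if "y \<in> V" for y using homeomorphism_apply2[OF g(6) that] .
  have g'_eq: "g' y d = ((fst d - DF (g y) (0, snd d)) / DF (g y) (1, 0), snd d)" if "y \<in> V" for y d
  proof -
    note z = gU[OF that]
    define e where "e = ((fst d - DF (g y) (0, snd d)) / DF (g y) (1, 0), snd d)"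
    have "blinfun_apply (\<Phi>' (g y)) e = d"
      using DF_split[OF z, of e] S(3)[OF z] by (simp add: bl[OF z] e_def prod_eq_iff)
    then have "inv (blinfun_apply (\<Phi>' (g y))) d = e"
      using bij[OF that] by (metis bij_inv_eq_iff)
    then show ?thesis using g'[OF that] e_def by simp
  qed
  \<comment> \<open>Smoothness of the inverse is bootstrapped: its derivative is a rational expression in
    derivatives of \<open>F\<close> composed with the inverse itself.\<close>
  have Cg: "Ck_on k V g" for k
  proof (induction k)
    case 0
    then show ?case using g(6) homeomorphism_cont2 by auto
  next
    case (Suc k)
    have comp: "Ck_on k V (\<lambda>y. DF (g y) d)" for d
      by (rule Ck_on_compose[OF g(4) CDF Suc]) (use gU in auto)
    show ?case
    proof (rule Ck_on_SucI[OF g(4) dg])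
      fix d :: "real \<times> 'p"
      have "Ck_on k V (\<lambda>y. inverse (DF (g y) (1, 0)))"
        by (rule Ck_on_compose[OF g(4) Ck_on_inverse comp]) (intro image_subsetI, simp add: S(3)[OF gU])
      then have "Ck_on k V (\<lambda>y. ((fst d + (- 1) * DF (g y) (0, snd d)) * inverse (DF (g y) (1, 0)), snd d))"
        by (intro Ck_on_Pair Ck_on_bilinear[OF bounded_bilinear_mult] Ck_on_add Ck_on_const comp g(4))
      then show "Ck_on k V (\<lambda>y. g' y d)"
        by (rule Ck_on_cong[OF g(4), rotated]) (simp add: g'_eq divide_inverse)
    qed
  qed
  have \<Phi>0: "\<Phi> 0 = 0" using assms(2) by (simp add: \<Phi>_def zero_prod_def)
  have sg: "smooth_germ g" using g \<Phi>0 Cg smooth_germ_iff by metis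
  have g0: "g 0 = 0" using homeomorphism_apply1[OF g(6,3)] \<Phi>0 by simp
  show ?thesis
  proof (intro exI[of _ "\<lambda>y. fst (g y)"] conjI)
    show "smooth_germ (\<lambda>y. fst (g y))" using smooth_germ_fst[OF sg] .
    show "fst (g 0) = 0" using g0 by simp
    have "\<forall>\<^sub>F z in nhds 0. z \<in> U" using g by (intro eventually_nhds_in_open)
    then show "\<forall>\<^sub>F z in nhds 0. fst (g (F z, snd z)) = fst z"
      by eventually_elim (use homeomorphism_apply1[OF g(6)] in \<open>simp add: \<Phi>_def\<close>)
    have "\<forall>\<^sub>F z in nhds 0. z \<in> V" using g \<Phi>0 by (intro eventually_nhds_in_open) auto
    then show "\<forall>\<^sub>F z in nhds 0. F (fst (g z), snd z) = fst z"
    proof eventually_elim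
      case (elim z)
      have "(F (g z), snd (g z)) = z" using \<Phi>g[OF elim] by (simp add: \<Phi>_def)
      then show ?case by (metis fst_conv prod.collapse snd_conv)
    qed
  qed
qed

text \<open>The implicit function theorem in the form of a preparation theorem. If \<open>x = \<xi>(F, p)\<close> inverts
  \<open>F\<close> in its first variable, Hadamard's lemma splits \<open>\<xi>(F, p)\<close> into \<open>U(p) = \<xi>(0, p)\<close> and a
  multiple of \<open>F\<close>.\<close>

lemma preparation_degree_1:
  fixes F :: "real \<times> 'p::euclidean_space \<Rightarrow> real"
  assumes "smooth_germ F" "F 0 = 0" "frechet_derivative F (at 0) (1, 0) \<noteq> 0"
  shows "\<exists>U \<omega>. smooth_germ U \<and> smooth_germ \<omega> \<and> U 0 = 0 \<and> \<omega> 0 \<noteq> 0 \<and>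
    (\<forall>\<^sub>F z in nhds 0. fst z - U (snd z) = \<omega> z * F z)"
proof -
  obtain \<xi> where \<xi>: "smooth_germ \<xi>" "\<xi> 0 = 0" "\<forall>\<^sub>F z in nhds 0. \<xi> (F z, snd z) = fst z"
    using inverse_function_with_parameters[OF assms] by blast
  obtain q where q: "smooth_germ q" "\<forall>\<^sub>F z in nhds 0. \<xi> z = \<xi> (0, snd z) + fst z * q z"
    using hadamard[OF \<xi>(1)] by blast
  define U where "U = (\<lambda>p. \<xi> (0, p))"
  define \<omega> where "\<omega> = (\<lambda>z. q (F z, snd z))"
  have sm: "smooth_germ (\<lambda>z. (F z, snd z))" and m0: "(F 0, snd (0 :: real \<times> 'p)) = 0"
    using assms by (auto intro!: smooth_intros simp: zero_prod_def)
  have sU: "smooth_germ U" unfolding U_def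
    by (rule smooth_germ_compose[OF \<xi>(1)]) (auto intro!: smooth_intros simp: zero_prod_def)
  have s\<omega>: "smooth_germ \<omega>" unfolding \<omega>_def
    by (rule smooth_germ_compose[OF q(1) sm m0])
  have U0: "U 0 = 0" using \<xi>(2) by (simp add: U_def zero_prod_def)
  have eq: "\<forall>\<^sub>F z in nhds 0. fst z - U (snd z) = \<omega> z * F z"
    using \<xi>(3) smooth_germ_eventually[OF sm m0 q(2)]
    by eventually_elim (simp add: U_def \<omega>_def algebra_simps)
  have "\<omega> 0 \<noteq> 0"
  proof
    assume "\<omega> 0 = 0"
    have s: "smooth_germ (\<lambda>z. fst z - U (snd z))"
      using sU smooth_germ_compose[OF sU smooth_germ_snd[OF smooth_germ_id]] by (auto intro!: smooth_intros)
    have "(U has_derivative frechet_derivative U (at 0)) (at (snd (0 :: real \<times> 'p)))"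
      using smooth_germ_has_derivative[OF sU] by simp
    from has_derivative_compose[OF bounded_linear_imp_has_derivative[OF bounded_linear_snd] this]
    have "((\<lambda>z. fst z - U (snd z)) has_derivative (\<lambda>d. fst d - frechet_derivative U (at 0) (snd d))) (at (0 :: real \<times> 'p))"
      by (intro has_derivative_diff bounded_linear_imp_has_derivative[OF bounded_linear_fst])
    from fun_cong[OF frechet_derivative_at[OF this], of "(1, 0)"]
    have "frechet_derivative (\<lambda>z. fst z - U (snd z)) (at 0) (1, 0) = 1"
      using linear_0[OF linear_frechet_derivative[OF sU]] by simp
    moreover have "frechet_derivative (\<lambda>z. fst z - U (snd z)) (at 0) (1, 0) = 0"
      unfolding frechet_derivative_cong_eventually[OF eq s] frechet_derivative_mult_0[OF s\<omega> assms(1)]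
      using \<open>\<omega> 0 = 0\<close> assms(2) by simp
    ultimately show False by simp
  qed
  with sU s\<omega> U0 eq show ?thesis by blast
qed


section \<open>Orders of vanishing\<close>

lemma hadamard_real:
  fixes f :: "real \<Rightarrow> real"
  assumes "smooth_germ f"
  shows "\<exists>q. smooth_germ q \<and> (\<forall>\<^sub>F x in nhds 0. f x = f 0 + x * q x)"
proof -
  have "smooth_germ (\<lambda>z :: real \<times> real. f (fst z))"
    by (rule smooth_germ_compose[OF assms]) (auto intro!: smooth_intros)
  from hadamard[OF this] obtain q where q: "smooth_germ q"
    "\<forall>\<^sub>F z :: real \<times> real in nhds 0. f (fst z) = f 0 + fst z * q z" by auto
  have s: "smooth_germ (\<lambda>x :: real. (x, 0 :: real))" "(0 :: real, 0 :: real) = 0"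
    by (auto intro!: smooth_intros simp: zero_prod_def)
  have "smooth_germ (\<lambda>x. q (x, 0))" by (rule smooth_germ_compose[OF q(1) s])
  moreover have "\<forall>\<^sub>F x in nhds 0. f x = f 0 + x * q (x, 0)"
    using smooth_germ_eventually[OF s q(2)] by simp
  ultimately show ?thesis by blast
qed

text \<open>A smooth function may be flat, so it need not have an order. Up to any given \<open>m\<close> the alternative is
  decided by repeated division by \<open>x\<close>.\<close>

lemma order_dichotomy:
  fixes f :: "real \<Rightarrow> real"
  assumes "smooth_germ f"
  shows "(\<exists>q. smooth_germ q \<and> (\<forall>\<^sub>F x in nhds 0. f x = x ^ m * q x)) \<or>
    (\<exists>i<m. \<exists>q. smooth_germ q \<and> q 0 \<noteq> 0 \<and> (\<forall>\<^sub>F x in nhds 0. f x = x ^ i * q x))"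
proof (induction m)
  case 0
  then show ?case using assms by auto
next
  case (Suc m)
  then show ?case
  proof (elim disjE)
    assume "\<exists>q. smooth_germ q \<and> (\<forall>\<^sub>F x in nhds 0. f x = x ^ m * q x)"
    then obtain q where q: "smooth_germ q" "\<forall>\<^sub>F x in nhds 0. f x = x ^ m * q x" by blast
    show ?case
    proof (cases "q 0 = 0")
      case True
      obtain r where r: "smooth_germ r" "\<forall>\<^sub>F x in nhds 0. q x = q 0 + x * r x"
        using hadamard_real[OF q(1)] by blast
      have "\<forall>\<^sub>F x in nhds 0. f x = x ^ Suc m * r x"
        using q(2) r(2) by eventually_elim (simp add: True)
      with r(1) show ?thesis by blast
    next
      case False
      with q show ?thesis by blast
    qed
  next
    assume "\<exists>i<m. \<exists>q. smooth_germ q \<and> q 0 \<noteq> 0 \<and> (\<forall>\<^sub>F x in nhds 0. f x = x ^ i * q x)"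
    then show ?case using less_SucI by blast
  qed
qed

lemma frechet_derivative_real_eq_deriv:
  fixes f :: "real \<Rightarrow> real"
  assumes "(f has_derivative f') (at x)"
  shows "deriv f x = f' 1"
proof -
  interpret l: linear f' using assms has_derivative_linear by blast
  have "f' h = f' 1 * h" for h using l.scaleR[of h 1] by simp
  then have "f' = (*) (f' 1)" by (intro ext)
  then show ?thesis using assms DERIV_imp_deriv by (metis has_field_derivative_def)
qed

lemma smooth_germ_deriv:
  fixes f :: "real \<Rightarrow> real"
  assumes "smooth_germ f"
  shows "smooth_germ (deriv f)"
  by (rule smooth_germ_cong[OF _ smooth_germ_frechet_derivative[OF assms, of 1]])
    (use smooth_germ_eventually_has_derivative[OF assms] in eventually_elim,
      simp add: frechet_derivative_real_eq_deriv)

lemma smooth_germ_eventually_DERIV: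
  fixes f :: "real \<Rightarrow> real"
  assumes "smooth_germ f"
  shows "\<forall>\<^sub>F x in nhds 0. (f has_real_derivative deriv f x) (at x)"
  using smooth_germ_eventually_has_derivative[OF assms]
proof eventually_elim
  case (elim x)
  then have "f differentiable (at x)" by (auto simp: differentiable_def)
  then show ?case
    by (simp add: DERIV_deriv_iff_real_differentiable)
qed

lemma eventually_deriv_cong:
  fixes f g :: "real \<Rightarrow> real"
  assumes "\<forall>\<^sub>F x in nhds 0. f x = g x"
  shows "\<forall>\<^sub>F x in nhds 0. deriv f x = deriv g x"
proof -
  have "\<forall>\<^sub>F x in nhds 0. \<forall>\<^sub>F y in nhds x. f y = g y"
    using assms by (simp only: eventually_eventually)
  then show ?thesis by eventually_elim (rule deriv_cong_ev[OF _ refl])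
qed

lemma iterated_deriv_factor:
  fixes f q :: "real \<Rightarrow> real"
  assumes "smooth_germ q" "\<forall>\<^sub>F x in nhds 0. f x = x ^ m * q x"
  shows "(\<forall>i<m. (deriv ^^ i) f 0 = 0) \<and> (deriv ^^ m) f 0 = fact m * q 0"
  using assms
proof (induction m arbitrary: f q)
  case 0
  then show ?case using eventually_nhds_x_imp_x by fastforce
next
  case (Suc m)
  define r where "r = (\<lambda>x. real (Suc m) * q x + x * deriv q x)"
  have r: "smooth_germ r" unfolding r_def
    by (intro smooth_intros smooth_germ_deriv Suc.prems)
  have "\<forall>\<^sub>F x in nhds 0. deriv f x = deriv (\<lambda>x. x ^ Suc m * q x) x"
    using eventually_deriv_cong[OF Suc.prems(2)] .
  then have "\<forall>\<^sub>F x in nhds 0. deriv f x = x ^ m * r x"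
    using smooth_germ_eventually_DERIV[OF Suc.prems(1)]
  proof eventually_elim
    case (elim x)
    have "((\<lambda>x. x ^ Suc m * q x) has_real_derivative x ^ m * r x) (at x)"
      by (rule derivative_eq_intros elim refl)+ (simp add: r_def algebra_simps)
    with elim(1) show ?case using DERIV_imp_deriv by simp
  qed
  note IH = Suc.IH[OF r this]
  have "(deriv ^^ i) f 0 = 0" if "i < Suc m" for i
  proof (cases i)
    case 0
    then show ?thesis using eventually_nhds_x_imp_x[OF Suc.prems(2)] by simp
  next
    case (Suc j)
    then show ?thesis using IH that by (simp add: funpow_swap1 del: funpow.simps) (simp add: funpow_swap1[symmetric])
  qed
  moreover have "(deriv ^^ Suc m) f 0 = fact (Suc m) * q 0"
    using IH by (simp add: funpow_swap1 r_def algebra_simps)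
  ultimately show ?case by blast
qed

lemma vanishes_to_order_factor:
  assumes "smooth_germ q" "q 0 \<noteq> 0" "\<forall>\<^sub>F x in nhds 0. f x = x ^ m * q x"
  shows "vanishes_to_order m f"
  using iterated_deriv_factor[OF assms(1,3)] assms(2) by (simp add: vanishes_to_order_def)


lemma leading_coefficient_zero:
  fixes c :: "real \<Rightarrow> real"
  assumes "smooth_germ c" "\<forall>\<^sub>F t in nhds 0. \<bar>t ^ n * c t\<bar> \<le> C * \<bar>t\<bar> ^ Suc n"
  shows "c 0 = 0"
proof -
  have "\<forall>\<^sub>F t in at 0. \<bar>t ^ n * c t\<bar> \<le> C * \<bar>t\<bar> ^ Suc n"
    using assms(2) by (simp add: eventually_nhds_conv_at)
  then have "\<forall>\<^sub>F t in at 0. \<bar>c t\<bar> \<le> C * \<bar>t\<bar>"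
    using eventually_neq_at_within[of 0]
  proof eventually_elim
    case (elim t)
    have "\<bar>t\<bar> ^ n * \<bar>c t\<bar> \<le> \<bar>t\<bar> ^ n * (C * \<bar>t\<bar>)"
      using elim(1) by (simp add: abs_mult power_abs algebra_simps)
    then show ?case using elim(2) by (simp add: mult_le_cancel_left_pos)
  qed
  moreover have "((\<lambda>t. C * \<bar>t\<bar>) \<longlongrightarrow> C * \<bar>0\<bar>) (at (0 :: real))" by (intro tendsto_intros)
  moreover have "((\<lambda>t. \<bar>c t\<bar>) \<longlongrightarrow> \<bar>c 0\<bar>) (at 0)"
    using smooth_germ_continuous[OF assms(1)] by (intro tendsto_intros) (simp add: isCont_def)
  ultimately have "\<bar>c 0\<bar> \<le> C * \<bar>0\<bar>"
    using tendsto_le[of "at (0 :: real)"] by fastforce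
  then show ?thesis by simp
qed


section \<open>Diffeomorphism germs\<close>

text \<open>Carrying the inverse along as a total function lets all identities be stated eventually at the
  origin, without domains.\<close>

definition inverse_germs :: "('a::real_normed_vector \<Rightarrow> 'b::real_normed_vector) \<Rightarrow> ('b \<Rightarrow> 'a) \<Rightarrow> bool" where
  "inverse_germs \<phi> \<psi> \<longleftrightarrow> smooth_germ \<phi> \<and> smooth_germ \<psi> \<and> \<phi> 0 = 0 \<and> \<psi> 0 = 0 \<and>
     (\<forall>\<^sub>F x in nhds 0. \<psi> (\<phi> x) = x) \<and> (\<forall>\<^sub>F y in nhds 0. \<phi> (\<psi> y) = y)"

lemma inverse_germs_sym: "inverse_germs \<phi> \<psi> \<Longrightarrow> inverse_germs \<psi> \<phi>"
  by (auto simp: inverse_germs_def)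

lemma inverse_germs_compose:
  fixes \<phi> :: "'a::euclidean_space \<Rightarrow> 'b::euclidean_space" and \<eta> :: "'b \<Rightarrow> 'c::euclidean_space"
  assumes "inverse_germs \<phi> \<phi>'" "inverse_germs \<eta> \<eta>'"
  shows "inverse_germs (\<lambda>x. \<eta> (\<phi> x)) (\<lambda>y. \<phi>' (\<eta>' y))"
proof -
  note a = assms[unfolded inverse_germs_def]
  have "\<forall>\<^sub>F x in nhds 0. \<eta>' (\<eta> (\<phi> x)) = \<phi> x" "\<forall>\<^sub>F y in nhds 0. \<phi> (\<phi>' (\<eta>' y)) = \<eta>' y"
    using a by (auto intro: smooth_germ_eventually[of \<phi> "\<lambda>y. \<eta>' (\<eta> y) = y"]
        smooth_germ_eventually[of \<eta>' "\<lambda>y. \<phi> (\<phi>' y) = y"])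
  then have "\<forall>\<^sub>F x in nhds 0. \<phi>' (\<eta>' (\<eta> (\<phi> x))) = x" "\<forall>\<^sub>F y in nhds 0. \<eta> (\<phi> (\<phi>' (\<eta>' y))) = y"
    using a by (auto elim: eventually_elim2)
  then show ?thesis
    using a smooth_germ_compose[of \<eta> \<phi>] smooth_germ_compose[of \<phi>' \<eta>'] by (simp add: inverse_germs_def)
qed

lemma diffeo_germ_imp_inverse_germs:
  assumes "diffeo_germ \<phi>"
  obtains \<psi> where "inverse_germs \<phi> \<psi>"
proof -
  from assms obtain U V \<psi> where a: "\<phi> 0 = 0" "0 \<in> U" "homeomorphism U V \<phi> \<psi>"
    "smooth_on U \<phi>" "smooth_on V \<psi>" unfolding diffeo_germ_def by blast
  have "0 \<in> V" using a homeomorphism_image1 by fastforce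
  have op: "open U" "open V" using a by (auto simp: smooth_on_def)
  have "inverse_germs \<phi> \<psi>"
    unfolding inverse_germs_def
  proof (intro conjI)
    show "smooth_germ \<phi>" "smooth_germ \<psi>" using a \<open>0 \<in> V\<close> smooth_germ_def by blast+
    show "\<phi> 0 = 0" by fact
    show "\<psi> 0 = 0" using a homeomorphism_apply1 by fastforce
    show "\<forall>\<^sub>F x in nhds 0. \<psi> (\<phi> x) = x"
      using eventually_nhds_in_open[OF op(1) a(2)] by eventually_elim (rule homeomorphism_apply1[OF a(3)])
    show "\<forall>\<^sub>F x in nhds 0. \<phi> (\<psi> x) = x"
      using eventually_nhds_in_open[OF op(2) \<open>0 \<in> V\<close>] by eventually_elim (rule homeomorphism_apply2[OF a(3)])
  qed
  then show ?thesis using that by blast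
qed

lemma inverse_germs_imp_diffeo_germ:
  fixes \<phi> :: "'a::real_normed_vector \<Rightarrow> 'a"
  assumes "inverse_germs \<phi> \<psi>"
  shows "diffeo_germ \<phi>"
proof -
  note a = assms[unfolded inverse_germs_def]
  obtain A where A: "open A" "0 \<in> A" "\<And>k. Ck_on k A \<phi>" using a smooth_germ_iff by blast
  obtain B where B: "open B" "0 \<in> B" "\<And>k. Ck_on k B \<psi>" using a smooth_germ_iff by blast
  obtain A' where A': "open A'" "0 \<in> A'" "\<forall>x\<in>A'. \<psi> (\<phi> x) = x" using a by (auto simp: eventually_nhds)
  obtain B' where B': "open B'" "0 \<in> B'" "\<forall>x\<in>B'. \<phi> (\<psi> x) = x" using a by (auto simp: eventually_nhds)
  define U where "U = \<phi> -` (B \<inter> B') \<inter> (A \<inter> A')"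
  define V where "V = \<psi> -` (A \<inter> A') \<inter> (B \<inter> B')"
  have cont: "continuous_on (A \<inter> A') \<phi>" "continuous_on (B \<inter> B') \<psi>"
    using Ck_on_continuous[OF A(3)] Ck_on_continuous[OF B(3)] continuous_on_subset by blast+
  have opU: "open U" unfolding U_def
    using continuous_on_open_vimage[of "A \<inter> A'" \<phi>] A A' B B' cont by blast
  have opV: "open V" unfolding V_def
    using continuous_on_open_vimage[of "B \<inter> B'" \<psi>] A A' B B' cont by blast
  have "homeomorphism U V \<phi> \<psi>"
  proof (rule homeomorphismI)
    show "continuous_on U \<phi>" "continuous_on V \<psi>"
      using cont by (auto simp: U_def V_def intro: continuous_on_subset)
    show "\<phi> ` U \<subseteq> V" "\<psi> ` V \<subseteq> U" using A' B' by (auto simp: U_def V_def)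
    show "\<psi> (\<phi> x) = x" if "x \<in> U" for x using that A' by (auto simp: U_def)
    show "\<phi> (\<psi> y) = y" if "y \<in> V" for y using that B' by (auto simp: V_def)
  qed
  moreover have "smooth_on U \<phi>"
    unfolding smooth_on_def using opU A(3) Ck_on_subset[of _ A \<phi> U] by (auto simp: U_def)
  moreover have "smooth_on V \<psi>"
    unfolding smooth_on_def using opV B(3) Ck_on_subset[of _ B \<psi> V] by (auto simp: V_def)
  moreover have "0 \<in> U" using A A' B B' a by (auto simp: U_def)
  ultimately show ?thesis using a diffeo_germ_def by blast
qed

lemma inverse_germs_frechet_derivative:
  fixes \<phi> :: "'a::real_normed_vector \<Rightarrow> 'b::real_normed_vector"
  assumes "inverse_germs \<phi> \<psi>"
  shows "frechet_derivative \<psi> (at 0) (frechet_derivative \<phi> (at 0) d) = d"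
proof -
  note a = assms[unfolded inverse_germs_def]
  have "frechet_derivative (\<lambda>x. x) (at 0) d = frechet_derivative (\<lambda>x. \<psi> (\<phi> x)) (at 0) d"
    by (rule fun_cong[OF frechet_derivative_cong_eventually[OF _ smooth_germ_id]])
      (use a in \<open>auto elim: eventually_mono\<close>)
  then show ?thesis using frechet_derivative_compose_0[of \<psi> \<phi> d] a by simp
qed

lemma inverse_germs_first_coordinate:
  fixes \<Theta> :: "real \<times> 'p::euclidean_space \<Rightarrow> real"
  assumes "smooth_germ \<Theta>" "\<Theta> 0 = 0" "frechet_derivative \<Theta> (at 0) (1, 0) \<noteq> 0"
  shows "\<exists>\<psi>. inverse_germs (\<lambda>z. (\<Theta> z, snd z)) \<psi>"
proof -
  obtain \<xi> where \<xi>: "smooth_germ \<xi>" "\<xi> 0 = 0" "\<forall>\<^sub>F z in nhds 0. \<xi> (\<Theta> z, snd z) = fst z"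
    "\<forall>\<^sub>F z in nhds 0. \<Theta> (\<xi> z, snd z) = fst z"
    using inverse_function_with_parameters[OF assms] by blast
  have "inverse_germs (\<lambda>z. (\<Theta> z, snd z)) (\<lambda>z. (\<xi> z, snd z))"
    unfolding inverse_germs_def using assms \<xi>
    by (auto intro!: smooth_intros simp: zero_prod_def elim: eventually_mono)
  then show ?thesis by blast
qed

lemma inverse_germs_swap: "inverse_germs (\<lambda>p :: real \<times> real. (snd p, fst p)) (\<lambda>p. (snd p, fst p))"
  unfolding inverse_germs_def by (auto intro!: smooth_intros simp: zero_prod_def)

text \<open>The second premise is a properness condition: points of \<open>Y\<close> near the origin need preimages near the
  origin, since the image of every small representative has to represent the germ of \<open>Y\<close>.\<close>

lemma germ_imageI:
  assumes "\<forall>\<^sub>F x in nhds 0. x \<in> X \<longrightarrow> G x \<in> Y"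
    and "\<And>e. e > 0 \<Longrightarrow> \<forall>\<^sub>F y in nhds 0. y \<in> Y \<longrightarrow> (\<exists>x\<in>X. norm x < e \<and> G x = y)"
  shows "germ_image G X Y"
proof -
  obtain \<delta> where \<delta>: "\<delta> > 0" "\<And>x. norm x < \<delta> \<Longrightarrow> x \<in> X \<Longrightarrow> G x \<in> Y"
    using assms(1) unfolding eventually_nhds_metric by (auto simp: dist_norm)
  have "germ_eq (G ` (X \<inter> ball 0 r)) Y" if "0 < r" "r < \<delta>" for r
    unfolding germ_eq_def using assms(2)[OF \<open>0 < r\<close>]
    by eventually_elim (use \<delta> that in \<open>auto simp: image_iff\<close>)
  then show ?thesis
    unfolding germ_image_def eventually_at_right_field using \<delta>(1) by blast
qed


section \<open>Restriction to lines\<close>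

text \<open>Directional derivatives at the origin of composite expressions are read off from a factorization
  on a line, where most terms vanish.\<close>

lemma frechet_derivative_along_line:
  fixes f :: "'a::euclidean_space \<Rightarrow> real"
  assumes "smooth_germ f" "smooth_germ c" "\<forall>\<^sub>F t in nhds 0. f (t *\<^sub>R d) = t * c t"
  shows "frechet_derivative f (at 0) d = c 0"
proof -
  have line: "smooth_germ (\<lambda>t :: real. t *\<^sub>R d)"
    by (rule smooth_germ_bounded_linear[OF bounded_linear_scaleR_left smooth_germ_id])
  have "frechet_derivative (\<lambda>t :: real. t *\<^sub>R d) (at 0) = (\<lambda>h. h *\<^sub>R d)"
    by (rule frechet_derivative_at[symmetric]) (auto intro!: derivative_eq_intros)
  then have "frechet_derivative f (at 0) d = frechet_derivative (\<lambda>t. f (t *\<^sub>R d)) (at 0) 1"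
    using frechet_derivative_compose_0[OF assms(1) line] by simp
  also have "\<dots> = frechet_derivative (\<lambda>t. t * c t) (at 0) 1"
    using frechet_derivative_cong_eventually[OF assms(3)] smooth_germ_compose[OF assms(1) line] by simp
  also have "\<dots> = c 0"
    using frechet_derivative_mult_0[OF smooth_germ_id assms(2), of 1] by simp
  finally show ?thesis .
qed

lemma hadamard_snd:
  fixes f :: "real \<times> real \<Rightarrow> real"
  assumes "smooth_germ f"
  shows "\<exists>q. smooth_germ q \<and> (\<forall>\<^sub>F z in nhds 0. f z = f (fst z, 0) + snd z * q z)"
proof -
  have sw: "smooth_germ (\<lambda>z :: real \<times> real. (snd z, fst z))" "(snd (0 :: real \<times> real), fst (0 :: real \<times> real)) = 0"
    by (auto intro!: smooth_intros simp: zero_prod_def)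
  obtain q where q: "smooth_germ q"
    "\<forall>\<^sub>F z :: real \<times> real in nhds 0. f (snd z, fst z) = f (snd z, 0) + fst z * q z"
    using hadamard[OF smooth_germ_compose[OF assms sw]] by auto
  have "\<forall>\<^sub>F z in nhds 0. f z = f (fst z, 0) + snd z * q (snd z, fst z)"
    using smooth_germ_eventually[OF sw q(2)] by simp
  then show ?thesis using smooth_germ_compose[OF q(1) sw] by blast
qed

lemma eventually_cancel_real:
  fixes f h :: "real \<Rightarrow> real"
  assumes "smooth_germ f" "smooth_germ h" "\<forall>\<^sub>F t in nhds 0. t * f t = t * h t"
  shows "\<forall>\<^sub>F t in nhds 0. f t = h t"
proof -
  have s: "smooth_germ (\<lambda>t. t * f t)" by (intro smooth_intros assms)
  have "frechet_derivative (\<lambda>t. t * f t) (at 0) 1 = f 0"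
    by (rule frechet_derivative_along_line[OF s assms(1)]) simp
  moreover have "frechet_derivative (\<lambda>t. t * f t) (at 0) 1 = h 0"
    by (rule frechet_derivative_along_line[OF s assms(2)]) (use assms(3) in simp)
  ultimately have "f 0 = h 0" by simp
  show ?thesis using assms(3) by eventually_elim (use \<open>f 0 = h 0\<close> in auto)
qed

lemma frechet_derivative_bounded_linear:
  "bounded_linear L \<Longrightarrow> frechet_derivative L (at x) = L"
  using frechet_derivative_at[OF bounded_linear_imp_has_derivative] by metis

lemma preparation_derivative:
  fixes F :: "real \<times> 'p::euclidean_space \<Rightarrow> real"
  assumes "smooth_germ U" "smooth_germ \<omega>" "smooth_germ F" "F 0 = 0"
    and eq: "\<forall>\<^sub>F z in nhds 0. fst z - U (snd z) = \<omega> z * F z"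
    and "frechet_derivative F (at 0) (0, d) = 0"
  shows "frechet_derivative U (at 0) d = 0"
proof -
  have "smooth_germ (\<lambda>z :: real \<times> 'p. fst z - U (snd z))"
    by (intro smooth_intros smooth_germ_compose[OF assms(1)]) simp
  from fun_cong[OF frechet_derivative_cong_eventually[OF eq this]]
  have "frechet_derivative (\<lambda>z. fst z - U (snd z)) (at 0) (0, d) = 0"
    unfolding frechet_derivative_mult_0[OF assms(2,3)] using assms(4,6) by simp
  moreover have "(U has_derivative frechet_derivative U (at 0)) (at (snd (0 :: real \<times> 'p)))"
    using smooth_germ_has_derivative[OF assms(1)] by simp
  from has_derivative_diff[OF bounded_linear_imp_has_derivative[OF bounded_linear_fst]
      has_derivative_compose[OF bounded_linear_imp_has_derivative[OF bounded_linear_snd] this]]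
  have "frechet_derivative (\<lambda>z. fst z - U (snd z)) (at 0) = (\<lambda>d. fst d - frechet_derivative U (at 0) (snd d))"
    using frechet_derivative_at by metis
  ultimately show ?thesis by simp
qed

lemma smooth_germ_restrict_fst:
  fixes f :: "real \<times> real \<Rightarrow> real"
  assumes "smooth_germ f"
  shows "smooth_germ (\<lambda>x. f (x, 0))" "smooth_germ (\<lambda>t. f (0, t))"
  by (rule smooth_germ_compose[OF assms]; auto intro!: smooth_intros simp: zero_prod_def)+

lemma eventually_axis:
  assumes "\<forall>\<^sub>F z :: real \<times> real in nhds 0. P z"
  shows "\<forall>\<^sub>F x in nhds 0. P (x, 0)" "\<forall>\<^sub>F t in nhds 0. P (0, t)"
  by (rule smooth_germ_eventually[OF _ _ assms]; auto intro!: smooth_intros simp: zero_prod_def)+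


section \<open>Cusps\<close>

text \<open>Writing \<open>W = W\<^sub>0(z) + x W\<^sub>1(x, z)\<close> and \<open>a = 1 - z W\<^sub>1\<^sup>2\<close>, completing the square gives the identity
  \<open>(a x - z W\<^sub>0 W\<^sub>1)\<^sup>2 - z W\<^sub>0\<^sup>2 = a (x\<^sup>2 - z W\<^sup>2)\<close>, whose right-hand side is the given
  equation times a unit and whose left-hand side involves the new coordinate and \<open>z\<close> alone.\<close>

lemma cusp_normal_form:
  fixes W :: "real \<times> real \<Rightarrow> real"
  assumes "smooth_germ W" "smooth_germ q" "q 0 \<noteq> 0" "\<forall>\<^sub>F t in nhds 0. W (0, t) = t ^ k * q t"
  shows "\<exists>\<Theta>. smooth_germ \<Theta> \<and> \<Theta> 0 = 0 \<and> frechet_derivative \<Theta> (at 0) (1, 0) \<noteq> 0 \<and>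
    (\<forall>\<^sub>F p in nhds 0. (fst p)\<^sup>2 = snd p * (W p)\<^sup>2 \<longleftrightarrow> (\<Theta> p)\<^sup>2 = snd p ^ (2 * k + 1))"
proof -
  obtain W1 where W1: "smooth_germ W1" "\<forall>\<^sub>F p in nhds 0. W p = W (0, snd p) + fst p * W1 p"
    using hadamard[OF assms(1)] by blast
  define a where "a = (\<lambda>p. 1 - snd p * (W1 p)\<^sup>2)"
  define \<Theta> where "\<Theta> = (\<lambda>p. (fst p * a p - snd p * W (0, snd p) * W1 p) / q (snd p))"
  have sa: "smooth_germ a" unfolding a_def by (intro smooth_intros W1)
  have sq: "smooth_germ (\<lambda>p :: real \<times> real. q (snd p))"
    by (rule smooth_germ_compose[OF assms(2)]) (auto intro!: smooth_intros)
  have sW0: "smooth_germ (\<lambda>p :: real \<times> real. W (0, snd p))"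
    by (rule smooth_germ_compose[OF assms(1)]) (auto intro!: smooth_intros simp: zero_prod_def)
  have s\<Theta>: "smooth_germ \<Theta>" unfolding \<Theta>_def
    by (intro smooth_germ_divide smooth_intros sa sq sW0 W1) (use assms(3) in auto)
  have \<Theta>0: "\<Theta> 0 = 0" by (simp add: \<Theta>_def)
  have "frechet_derivative \<Theta> (at 0) (1, 0) = 1 / q 0"
    by (rule frechet_derivative_along_line[OF s\<Theta> smooth_germ_const])
      (simp add: \<Theta>_def a_def)
  then have D: "frechet_derivative \<Theta> (at 0) (1, 0) \<noteq> 0" using assms(3) by simp
  have "\<forall>\<^sub>F p in nhds 0. a p \<noteq> 0"
    by (rule smooth_germ_eventually_nonzero[OF sa]) (simp add: a_def)
  moreover have "\<forall>\<^sub>F p :: real \<times> real in nhds 0. q (snd p) \<noteq> 0"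
    by (rule smooth_germ_eventually_nonzero[OF sq]) (use assms(3) in simp)
  moreover have "\<forall>\<^sub>F p :: real \<times> real in nhds 0. W (0, snd p) = snd p ^ k * q (snd p)"
    using smooth_germ_eventually[OF smooth_germ_snd[OF smooth_germ_id] _ assms(4)] by simp
  ultimately have "\<forall>\<^sub>F p in nhds 0. (fst p)\<^sup>2 = snd p * (W p)\<^sup>2 \<longleftrightarrow> (\<Theta> p)\<^sup>2 = snd p ^ (2 * k + 1)"
    using W1(2)
  proof eventually_elim
    case (elim p)
    define x z w0 w1 where d: "x = fst p" "z = snd p" "w0 = W (0, snd p)" "w1 = W1 p"
    have "(x * a p - z * w0 * w1)\<^sup>2 - z * w0\<^sup>2 = a p * (x\<^sup>2 - z * (w0 + x * w1)\<^sup>2)"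
      unfolding a_def d[symmetric] by algebra
    then have "x\<^sup>2 = z * (w0 + x * w1)\<^sup>2 \<longleftrightarrow> (x * a p - z * w0 * w1)\<^sup>2 = z * w0\<^sup>2"
      using elim(1) by (metis mult_eq_0_iff right_minus_eq)
    also have "z * w0\<^sup>2 = z ^ (2 * k + 1) * (q z)\<^sup>2"
      using elim(3) by (simp add: d power_mult_distrib power_mult[symmetric] mult.commute)
    also have "(x * a p - z * w0 * w1)\<^sup>2 = z ^ (2 * k + 1) * (q z)\<^sup>2 \<longleftrightarrow>
        ((x * a p - z * w0 * w1) / q z)\<^sup>2 = z ^ (2 * k + 1)"
      using elim(2) by (simp add: d power_divide field_simps)
    finally show ?case using elim(4) by (simp add: \<Theta>_def d)
  qed
  with s\<Theta> \<Theta>0 D show ?thesis by blast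
qed


section \<open>Sections of a Whitney umbrella\<close>

definition standard_umbrella :: "real \<times> real \<Rightarrow> real \<times> real \<times> real" where
  "standard_umbrella p = (fst p, fst p * snd p, (snd p)\<^sup>2)"

definition standard_umbrella_image :: "(real \<times> real \<times> real) set" where
  "standard_umbrella_image = {(x, y, z). y\<^sup>2 = x\<^sup>2 * z \<and> z \<ge> 0}"

lemma standard_umbrella_in_image: "standard_umbrella p \<in> standard_umbrella_image"
  by (simp add: standard_umbrella_def standard_umbrella_image_def power_mult_distrib)

lemma standard_umbrella_preimage:
  assumes "(x, y, z) \<in> standard_umbrella_image"
  obtains p where "standard_umbrella p = (x, y, z)" "norm p \<le> \<bar>x\<bar> + sqrt z"
proof -
  have a: "y\<^sup>2 = x\<^sup>2 * z" "z \<ge> 0" using assms by (auto simp: standard_umbrella_image_def)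
  then have "y\<^sup>2 = (x * sqrt z)\<^sup>2" by (simp add: power_mult_distrib)
  then have "y = x * sqrt z \<or> y = x * (- sqrt z)" by (simp add: power2_eq_iff)
  then obtain v where v: "y = x * v" "\<bar>v\<bar> = sqrt z"
    using a(2) that[of "sqrt z"] that[of "- sqrt z"] by auto
  have "v\<^sup>2 = z" using v(2) a(2) by (metis power2_abs real_sqrt_pow2)
  with v have "standard_umbrella (x, v) = (x, y, z)" by (simp add: standard_umbrella_def)
  moreover have "norm (x, v) \<le> \<bar>x\<bar> + sqrt z" using norm_Pair_le[of x v] v by simp
  ultimately show ?thesis using that by blast
qed

lemma smooth_standard_umbrella: "smooth_germ standard_umbrella"
  unfolding standard_umbrella_def[abs_def] by (intro smooth_intros)

lemma standard_umbrella_0: "standard_umbrella 0 = 0"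
  by (simp add: standard_umbrella_def zero_prod_def)

locale umbrella_chart =
  fixes g :: "real \<times> real \<Rightarrow> real \<times> real \<times> real"
    and \<phi> \<phi>' :: "real \<times> real \<Rightarrow> real \<times> real"
    and \<Psi> \<Psi>' :: "real \<times> real \<times> real \<Rightarrow> real \<times> real \<times> real"
    and w :: "real \<times> real \<times> real"
  assumes smooth_g: "smooth_germ g" and g_0: "g 0 = 0"
    and \<phi>: "inverse_germs \<phi> \<phi>'" and \<Psi>: "inverse_germs \<Psi> \<Psi>'"
    and g_\<phi>: "\<forall>\<^sub>F p in nhds 0. g (\<phi> p) = \<Psi> (standard_umbrella p)"
    and w: "w \<noteq> 0"
begin

lemmas \<phi>_facts = \<phi>[unfolded inverse_germs_def] and \<Psi>_facts = \<Psi>[unfolded inverse_germs_def]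

text \<open>The plane, pulled back to the target coordinates in which the umbrella is standard.\<close>

definition H :: "real \<times> real \<times> real \<Rightarrow> real" where
  "H x = inner (\<Psi> x) w"

definition section_curve :: "(real \<times> real \<times> real) set" where
  "section_curve = {y. \<Psi>' y \<in> standard_umbrella_image \<and> inner y w = 0}"

lemma smooth_H: "smooth_germ H"
  unfolding H_def[abs_def] using \<Psi>_facts by (intro smooth_intros) auto

lemma H_0: "H 0 = 0"
  using \<Psi>_facts by (simp add: H_def)

lemma g_eq: "\<forall>\<^sub>F p in nhds 0. g p = \<Psi> (standard_umbrella (\<phi>' p))"
proof -
  have "\<forall>\<^sub>F p in nhds 0. g (\<phi> (\<phi>' p)) = \<Psi> (standard_umbrella (\<phi>' p))"
    using smooth_germ_eventually[OF _ _ g_\<phi>, of \<phi>'] \<phi>_facts by auto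
  moreover have "\<forall>\<^sub>F p in nhds 0. \<phi> (\<phi>' p) = p" using \<phi>_facts by auto
  ultimately show ?thesis by eventually_elim simp
qed

lemma height_eq: "\<forall>\<^sub>F p in nhds 0. height g w p = H (standard_umbrella (\<phi>' p))"
  using g_eq by eventually_elim (simp add: height_def H_def)

lemma height_\<phi>: "\<forall>\<^sub>F p in nhds 0. height g w (\<phi> p) = H (standard_umbrella p)"
  using g_\<phi> by eventually_elim (simp add: height_def H_def)

lemma local_intersection_section_curve: "local_intersection g w section_curve"
  unfolding local_intersection_def
proof (rule germ_imageI)
  have "smooth_germ (\<lambda>p. standard_umbrella (\<phi>' p))"
    using \<phi>_facts smooth_germ_compose[OF smooth_standard_umbrella] by blast
  then have "\<forall>\<^sub>F p in nhds 0. \<Psi>' (\<Psi> (standard_umbrella (\<phi>' p))) = standard_umbrella (\<phi>' p)"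
    using smooth_germ_eventually[of "\<lambda>p. standard_umbrella (\<phi>' p)" "\<lambda>x. \<Psi>' (\<Psi> x) = x"]
      \<phi>_facts \<Psi>_facts standard_umbrella_0 by auto
  then show "\<forall>\<^sub>F p in nhds 0. p \<in> {p. height g w p = 0} \<longrightarrow> g p \<in> section_curve"
    using g_eq by eventually_elim (simp add: section_curve_def height_def standard_umbrella_in_image)
next
  fix e :: real assume "e > 0"
  then have "\<forall>\<^sub>F p in nhds 0. norm (\<phi> p) < e"
    using \<phi>_facts by (intro smooth_germ_eventually[of \<phi> "\<lambda>q. norm q < e"])
      (auto simp: eventually_nhds_metric dist_norm)
  from eventually_conj[OF this g_\<phi>] obtain \<delta> where \<delta>: "\<delta> > 0"
    "\<And>p. norm p < \<delta> \<Longrightarrow> norm (\<phi> p) < e \<and> g (\<phi> p) = \<Psi> (standard_umbrella p)"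
    unfolding eventually_nhds_metric by (auto simp: dist_norm)
  have "((\<lambda>y. \<bar>fst (\<Psi>' y)\<bar> + sqrt (snd (snd (\<Psi>' y)))) \<longlongrightarrow> \<bar>fst (\<Psi>' 0)\<bar> + sqrt (snd (snd (\<Psi>' 0)))) (nhds 0)"
    using \<Psi>_facts by (intro tendsto_intros smooth_germ_tendsto) auto
  then have "\<forall>\<^sub>F y in nhds 0. \<bar>fst (\<Psi>' y)\<bar> + sqrt (snd (snd (\<Psi>' y))) < \<delta>"
    using \<Psi>_facts \<delta>(1) by (auto simp: dest: order_tendstoD(2))
  moreover have "\<forall>\<^sub>F y in nhds 0. \<Psi> (\<Psi>' y) = y" using \<Psi>_facts by auto
  ultimately show "\<forall>\<^sub>F y in nhds 0. y \<in> section_curve \<longrightarrow>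
      (\<exists>p\<in>{p. height g w p = 0}. norm p < e \<and> g p = y)"
  proof eventually_elim
    case (elim y)
    show ?case
    proof
      assume y: "y \<in> section_curve"
      obtain a b c where abc: "\<Psi>' y = (a, b, c)" using prod_cases3 by blast
      then obtain p where p: "standard_umbrella p = \<Psi>' y" "norm p \<le> \<bar>a\<bar> + sqrt c"
        using y standard_umbrella_preimage[of a b c] by (auto simp: section_curve_def)
      then have "norm (\<phi> p) < e" "g (\<phi> p) = y"
        using \<delta>(2)[of p] elim abc by auto
      moreover have "inner y w = 0" using y by (simp add: section_curve_def)
      ultimately show "\<exists>p\<in>{p. height g w p = 0}. norm p < e \<and> g p = y"
        by (intro bexI[of _ "\<phi> p"]) (auto simp: height_def)
    qed
  qed
qed

lemma plane_coordinates:
  obtains \<iota> :: "real \<times> real \<Rightarrow> real \<times> real \<times> real" and \<pi> :: "real \<times> real \<times> real \<Rightarrow> real \<times> real"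
  where "linear \<iota>" "inj \<iota>" "range \<iota> = plane w" "linear \<pi>" "\<And>z. \<pi> (\<iota> z) = z" "\<And>y. inner y w = 0 \<Longrightarrow> \<iota> (\<pi> y) = y"
proof -
  have pl: "plane w = {x. w \<bullet> x = 0}" by (auto simp: plane_def inner_commute)
  have "subspace (plane w)" unfolding pl by (rule subspace_hyperplane)
  moreover have "dim (UNIV :: (real \<times> real) set) = dim (plane w)"
    unfolding pl dim_hyperplane[OF w] by simp
  ultimately obtain \<iota> :: "real \<times> real \<Rightarrow> real \<times> real \<times> real"
    where \<iota>: "linear \<iota>" "range \<iota> = plane w" "inj \<iota>"
    using subspace_isomorphism[of "UNIV :: (real \<times> real) set" "plane w"] subspace_UNIV by metis
  obtain \<pi> where \<pi>: "linear \<pi>" "\<pi> \<circ> \<iota> = id" using linear_injective_left_inverse[OF \<iota>(1,3)] by blast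
  have inv: "\<pi> (\<iota> z) = z" for z using \<pi>(2) by (metis comp_apply id_apply)
  moreover have "\<iota> (\<pi> y) = y" if "inner y w = 0" for y
  proof -
    have "y \<in> range \<iota>" using that \<iota>(2) by (simp add: plane_def)
    then show ?thesis using inv by auto
  qed
  ultimately show ?thesis using that \<iota> \<pi> by blast
qed

text \<open>A smooth graph \<open>\<sigma>\<close> over a coordinate plane that parameterizes \<open>H = 0\<close> turns the section into a
  plane set germ: the part of the graph lying on the standard umbrella. The map to the given plane is
  \<open>\<Psi> \<circ> \<sigma>\<close>, with inverse induced by \<open>\<Psi>'\<close> and the projection of the graph.\<close>

lemma diffeomorphic_in_plane_section_curve:
  fixes \<sigma> :: "real \<times> real \<Rightarrow> real \<times> real \<times> real" and pr :: "real \<times> real \<times> real \<Rightarrow> real \<times> real"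
  assumes \<sigma>: "smooth_germ \<sigma>" "\<sigma> 0 = 0" and pr: "smooth_germ pr" "pr 0 = 0"
    and pr_\<sigma>: "\<forall>\<^sub>F p in nhds 0. pr (\<sigma> p) = p" and H_\<sigma>: "\<forall>\<^sub>F p in nhds 0. H (\<sigma> p) = 0"
    and \<sigma>_pr: "\<forall>\<^sub>F x in nhds 0. H x = 0 \<longrightarrow> \<sigma> (pr x) = x"
    and \<alpha>: "inverse_germs \<alpha> \<alpha>'"
    and Z: "\<forall>\<^sub>F p in nhds 0. \<sigma> p \<in> standard_umbrella_image \<longleftrightarrow> \<alpha> p \<in> Z"
  shows "diffeomorphic_in_plane (plane w) Z section_curve"
proof -
  obtain \<iota> :: "real \<times> real \<Rightarrow> real \<times> real \<times> real" and \<pi> :: "real \<times> real \<times> real \<Rightarrow> real \<times> real"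
    where \<iota>: "linear \<iota>" "inj \<iota>" "range \<iota> = plane w" and \<pi>: "linear \<pi>"
      and \<pi>\<iota>: "\<And>z. \<pi> (\<iota> z) = z" and \<iota>\<pi>: "\<And>y. inner y w = 0 \<Longrightarrow> \<iota> (\<pi> y) = y"
    using plane_coordinates by metis
  note \<alpha>_facts = \<alpha>[unfolded inverse_germs_def]
  define F where "F = (\<lambda>z. \<Psi> (\<sigma> (\<alpha>' z)))"
  define \<eta> where "\<eta> = (\<lambda>z. \<pi> (F z))"
  define \<eta>' where "\<eta>' = (\<lambda>z. \<alpha> (pr (\<Psi>' (\<iota> z))))"
  define \<rho> where "\<rho> = (\<lambda>y. \<alpha> (pr (\<Psi>' y)))"
  have l\<iota>: "smooth_germ \<iota>" "\<iota> 0 = 0" and l\<pi>: "smooth_germ \<pi>" "\<pi> 0 = 0"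
    using smooth_germ_bounded_linear[OF _ smooth_germ_id] \<iota>(1) \<pi>
    by (simp_all add: linear_conv_bounded_linear linear_0)
  have s1: "smooth_germ (\<lambda>z. \<sigma> (\<alpha>' z))" "\<sigma> (\<alpha>' 0) = 0"
    using smooth_germ_compose[OF \<sigma>(1)] \<alpha>_facts \<sigma>(2) by auto
  have sF: "smooth_germ F" "F 0 = 0"
    using smooth_germ_compose[of \<Psi>, OF _ s1] \<Psi>_facts s1 by (auto simp: F_def)
  have s2: "smooth_germ (\<lambda>y. pr (\<Psi>' y))" "pr (\<Psi>' 0) = 0"
    using smooth_germ_compose[OF pr(1), of \<Psi>'] \<Psi>_facts pr(2) by auto
  have s\<rho>: "smooth_germ \<rho>" "\<rho> 0 = 0"
    using smooth_germ_compose[of \<alpha>, OF _ s2] \<alpha>_facts s2 by (auto simp: \<rho>_def)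
  have s\<eta>: "smooth_germ \<eta>" "\<eta> 0 = 0"
    using smooth_germ_compose[OF l\<pi>(1) sF] sF l\<pi> by (auto simp: \<eta>_def)
  have \<eta>'_eq: "\<eta>' z = \<rho> (\<iota> z)" for z by (simp add: \<eta>'_def \<rho>_def)
  have s\<eta>': "smooth_germ \<eta>'" "\<eta>' 0 = 0"
    using smooth_germ_compose[OF s\<rho>(1) l\<iota>] s\<rho> l\<iota> by (auto simp: \<eta>'_eq[abs_def])
  have F_plane: "\<forall>\<^sub>F z in nhds 0. inner (F z) w = 0"
    using smooth_germ_eventually[OF _ _ H_\<sigma>, of \<alpha>'] \<alpha>_facts by (auto simp: F_def H_def)
  have \<Psi>'F: "\<forall>\<^sub>F z in nhds 0. \<Psi>' (F z) = \<sigma> (\<alpha>' z)"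
    using smooth_germ_eventually[OF s1, of "\<lambda>x. \<Psi>' (\<Psi> x) = x"] \<Psi>_facts by (auto simp: F_def)
  have pr\<sigma>\<alpha>': "\<forall>\<^sub>F z in nhds 0. pr (\<sigma> (\<alpha>' z)) = \<alpha>' z"
    using smooth_germ_eventually[OF _ _ pr_\<sigma>, of \<alpha>'] \<alpha>_facts by auto
  have \<alpha>\<alpha>': "\<forall>\<^sub>F z in nhds 0. \<alpha> (\<alpha>' z) = z" using \<alpha>_facts by auto
  have \<alpha>'\<rho>: "\<forall>\<^sub>F y in nhds 0. \<alpha>' (\<rho> y) = pr (\<Psi>' y)"
    using smooth_germ_eventually[OF s2, of "\<lambda>x. \<alpha>' (\<alpha> x) = x"] \<alpha>_facts by (auto simp: \<rho>_def)
  have \<Psi>\<Psi>': "\<forall>\<^sub>F y in nhds 0. \<Psi> (\<Psi>' y) = y" using \<Psi>_facts by auto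
  have "\<forall>\<^sub>F y in nhds 0. H (\<Psi>' y) = 0 \<longrightarrow> \<sigma> (pr (\<Psi>' y)) = \<Psi>' y"
    using smooth_germ_eventually[OF _ _ \<sigma>_pr, of \<Psi>'] \<Psi>_facts by auto
  then have F\<rho>: "\<forall>\<^sub>F y in nhds 0. inner y w = 0 \<longrightarrow> F (\<rho> y) = y \<and> \<sigma> (\<alpha>' (\<rho> y)) = \<Psi>' y"
    using \<alpha>'\<rho> \<Psi>\<Psi>' by eventually_elim (auto simp: F_def H_def)
  have "inverse_germs \<eta> \<eta>'"
    unfolding inverse_germs_def
  proof (intro conjI s\<eta> s\<eta>')
    show "\<forall>\<^sub>F z in nhds 0. \<eta>' (\<eta> z) = z"
      using F_plane \<Psi>'F pr\<sigma>\<alpha>' \<alpha>\<alpha>'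
      by eventually_elim (simp add: \<eta>'_def \<eta>_def \<iota>\<pi>)
    have in_plane: "inner (\<iota> z) w = 0" for z using \<iota>(3) by (auto simp: plane_def)
    show "\<forall>\<^sub>F z in nhds 0. \<eta> (\<eta>' z) = z"
      using smooth_germ_eventually[OF l\<iota> F\<rho>]
      by eventually_elim (simp add: \<eta>'_eq \<eta>_def \<pi>\<iota> in_plane)
  qed
  then have "diffeo_germ \<eta>" by (rule inverse_germs_imp_diffeo_germ)
  have \<iota>\<eta>: "\<forall>\<^sub>F z in nhds 0. \<iota> (\<eta> z) = F z"
    using F_plane by eventually_elim (simp add: \<eta>_def \<iota>\<pi>)
  have Z': "\<forall>\<^sub>F z in nhds 0. \<sigma> (\<alpha>' z) \<in> standard_umbrella_image \<longleftrightarrow> z \<in> Z"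
    using smooth_germ_eventually[OF _ _ Z, of \<alpha>'] \<alpha>_facts by (auto elim: eventually_elim2)
  have "germ_image (\<iota> \<circ> \<eta>) Z section_curve"
  proof (rule germ_imageI)
    show "\<forall>\<^sub>F z in nhds 0. z \<in> Z \<longrightarrow> (\<iota> \<circ> \<eta>) z \<in> section_curve"
      using \<iota>\<eta> F_plane \<Psi>'F Z' by eventually_elim (simp add: section_curve_def)
    fix e :: real assume "e > 0"
    then have "\<forall>\<^sub>F y in nhds 0. norm (\<rho> y) < e"
      using smooth_germ_eventually[OF s\<rho>, of "\<lambda>q. norm q < e"]
      by (auto simp: eventually_nhds_metric dist_norm)
    then show "\<forall>\<^sub>F y in nhds 0. y \<in> section_curve \<longrightarrow> (\<exists>z\<in>Z. norm z < e \<and> (\<iota> \<circ> \<eta>) z = y)"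
      using F\<rho> smooth_germ_eventually[OF s\<rho> Z'] smooth_germ_eventually[OF s\<rho> \<iota>\<eta>]
      by eventually_elim (auto simp: section_curve_def)
  qed
  with \<open>diffeo_germ \<eta>\<close> \<iota> show ?thesis unfolding diffeomorphic_in_plane_def by blast
qed

subsection \<open>Sections that are cusps\<close>

text \<open>The surface is a graph \<open>x = U(y, z)\<close>, and \<open>U(0, z)\<close> is \<open>H(0, 0, z)\<close> times a unit, so both have
  order \<open>k\<close>. The normal form \<open>y\<^sup>2 = z\<^sup>2\<^sup>k\<^sup>+\<^sup>1\<close> of the cusp implies \<open>z \<ge> 0\<close>, because
  its exponent is odd.\<close>

lemma A_curve_if_nonsingular:
  assumes "frechet_derivative H (at 0) (1, 0, 0) \<noteq> 0"
    and q: "smooth_germ q" "q 0 \<noteq> 0" "\<forall>\<^sub>F t in nhds 0. H (0, 0, t) = t ^ k * q t"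
  shows "A_curve (plane w) (2 * k) section_curve"
proof -
  obtain U \<omega> where U: "smooth_germ U" "U 0 = 0" and \<omega>: "smooth_germ \<omega>" "\<omega> 0 \<noteq> 0"
    and eq: "\<forall>\<^sub>F x in nhds 0. fst x - U (snd x) = \<omega> x * H x"
    using preparation_degree_1[OF smooth_H H_0] assms(1) by (auto simp: zero_prod_def)
  define \<sigma> where "\<sigma> = (\<lambda>p. (U p, p))"
  have s\<sigma>: "smooth_germ \<sigma>" "\<sigma> 0 = 0"
    using U by (auto simp: \<sigma>_def zero_prod_def intro!: smooth_intros)
  have \<omega>_nz: "\<forall>\<^sub>F x in nhds 0. \<omega> x \<noteq> 0" using smooth_germ_eventually_nonzero[OF \<omega>] .
  have ax: "smooth_germ (\<lambda>t :: real. (0 :: real, 0 :: real, t))" "(0 :: real, 0 :: real, 0 :: real) = 0"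
    by (auto intro!: smooth_intros simp: zero_prod_def)
  define r where "r = (\<lambda>t. - (\<omega> (0, 0, t) * q t))"
  have sr: "smooth_germ r" unfolding r_def
    by (intro smooth_intros q smooth_germ_compose[OF \<omega>(1) ax])
  have r0: "r 0 \<noteq> 0" using \<omega>(2) q(2) by (simp add: r_def ax(2))
  have "\<forall>\<^sub>F t in nhds 0. U (0, t) = t ^ k * r t"
    using smooth_germ_eventually[OF ax eq] q(3)
    by eventually_elim (simp add: r_def algebra_simps)
  from cusp_normal_form[OF U(1) sr r0 this]
  obtain \<Theta> where \<Theta>: "smooth_germ \<Theta>" "\<Theta> 0 = 0" "frechet_derivative \<Theta> (at 0) (1, 0) \<noteq> 0"
    and cusp: "\<forall>\<^sub>F p in nhds 0. (fst p)\<^sup>2 = snd p * (U p)\<^sup>2 \<longleftrightarrow> (\<Theta> p)\<^sup>2 = snd p ^ (2 * k + 1)"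
    by blast
  obtain \<psi> where \<psi>: "inverse_germs (\<lambda>z. (\<Theta> z, snd z)) \<psi>"
    using inverse_germs_first_coordinate[OF \<Theta>] by blast
  have \<alpha>: "inverse_germs (\<lambda>z. (snd z, \<Theta> z)) (\<lambda>z. \<psi> (snd z, fst z))"
    using inverse_germs_compose[OF \<psi> inverse_germs_swap] by simp
  have Z: "\<forall>\<^sub>F p in nhds 0. \<sigma> p \<in> standard_umbrella_image \<longleftrightarrow>
      (snd p, \<Theta> p) \<in> {(x, y). y\<^sup>2 - x ^ (2 * k + 1) = 0}"
    using cusp
  proof eventually_elim
    case (elim p)
    have "snd p \<ge> 0" if "(\<Theta> p)\<^sup>2 = snd p ^ (2 * k + 1)"
    proof -
      have "0 \<le> snd p ^ (2 * k + 1)" using that by (metis zero_le_power2)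
      then show ?thesis using zero_le_odd_power[of "2 * k + 1" "snd p"] by simp
    qed
    then show ?case using elim
      by (auto simp: \<sigma>_def standard_umbrella_image_def split_beta mult.commute)
  qed
  have "diffeomorphic_in_plane (plane w) {(x, y). y\<^sup>2 - x ^ (2 * k + 1) = 0} section_curve"
  proof (rule diffeomorphic_in_plane_section_curve[OF s\<sigma> smooth_germ_snd[OF smooth_germ_id] _ _ _ _ \<alpha> Z])
    show "\<forall>\<^sub>F p in nhds 0. H (\<sigma> p) = 0"
      using smooth_germ_eventually[OF s\<sigma> eventually_conj[OF eq \<omega>_nz]]
      by eventually_elim (auto simp: \<sigma>_def)
    show "\<forall>\<^sub>F x in nhds 0. H x = 0 \<longrightarrow> \<sigma> (snd x) = x"
      using eq by eventually_elim (auto simp: \<sigma>_def prod_eq_iff)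
  qed (simp_all add: \<sigma>_def)
  then show ?thesis by (simp add: A_curve_def)
qed

end

section \<open>Two branches\<close>

text \<open>The curve \<open>u v = V(u, v\<^sup>2)\<close> has a branch \<open>v = u \<tau>(u)\<close>: substituting \<open>v = u \<tau>\<close> and dividing
  by \<open>u\<^sup>2\<close> leaves an equation for \<open>\<tau>\<close> to which the implicit function theorem applies. The
  branch maps to the curve \<open>z = (x \<tau>(x))\<^sup>2\<close>, and dividing \<open>V\<close> with remainder by the equation
  of this curve gives \<open>W\<close>.\<close>

lemma branch_division:
  fixes V :: "real \<times> real \<Rightarrow> real"
  assumes V: "smooth_germ V" "V 0 = 0" "frechet_derivative V (at 0) (1, 0) = 0"
    and q: "smooth_germ q" "\<forall>\<^sub>F t in nhds 0. V (0, t) = t ^ (k + 1) * q t" and "k \<ge> 1"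
  shows "\<exists>\<tau> W. smooth_germ \<tau> \<and> smooth_germ W \<and> (\<forall>\<^sub>F t in nhds 0. W (0, t) = t ^ k * q t) \<and>
    (\<forall>\<^sub>F p in nhds 0. V (fst p, snd p + (fst p * \<tau> (fst p))\<^sup>2) =
       (fst p)\<^sup>2 * \<tau> (fst p) + snd p * W p)"
proof -
  obtain V1 where V1: "smooth_germ V1" "\<forall>\<^sub>F p in nhds 0. V p = V (fst p, 0) + snd p * V1 p"
    using hadamard_snd[OF V(1)] by blast
  have V00: "V (0, 0) = 0" using V(2) by (simp add: zero_prod_def)
  obtain r where r: "smooth_germ r" "\<forall>\<^sub>F x in nhds 0. V (x, 0) = x * r x"
    using hadamard_real[OF smooth_germ_restrict_fst(1)[OF V(1)]] V00 by auto
  have "r 0 = 0"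
    using frechet_derivative_along_line[OF V(1) r(1), of "(1, 0)"] r(2) V(3) by simp
  then obtain s where s: "smooth_germ s" "\<forall>\<^sub>F x in nhds 0. r x = x * s x"
    using hadamard_real[OF r(1)] by auto
  have "\<forall>\<^sub>F t in nhds 0. V (t *\<^sub>R (0, 1)) = t * V1 (0, t)"
    using eventually_axis(2)[OF V1(2)] by eventually_elim (simp add: V00)
  from frechet_derivative_along_line[OF V(1) smooth_germ_restrict_fst(2)[OF V1(1)] this]
  have "frechet_derivative V (at 0) (0, 1) = V1 (0, 0)" .
  moreover have "\<forall>\<^sub>F t in nhds 0. V (t *\<^sub>R (0, 1)) = t * (t ^ k * q t)"
    using q(2) by eventually_elim simp
  from frechet_derivative_along_line[OF V(1) smooth_germ_mult[OF smooth_germ_power[OF smooth_germ_id] q(1)] this]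
  have "frechet_derivative V (at 0) (0, 1) = 0" using \<open>k \<ge> 1\<close> by simp
  ultimately have V10: "V1 (0, 0) = 0" by simp
  \<comment> \<open>The equation for \<open>\<tau>\<close> is \<open>\<tau> = s(u) + \<tau>\<^sup>2 V1(u, (u \<tau>)\<^sup>2)\<close>; it is solved near \<open>\<tau> = c\<close> at \<open>u = 0\<close>.\<close>
  define c where "c = s 0"
  define K where "K = (\<lambda>p :: real \<times> real. fst p + c - s (snd p) -
    (fst p + c)\<^sup>2 * V1 (snd p, (snd p * (fst p + c))\<^sup>2))"
  have sK: "smooth_germ K" unfolding K_def
    by (intro smooth_intros smooth_germ_compose[OF s(1)] smooth_germ_compose[OF V1(1)])
      (auto simp: zero_prod_def)
  have K0: "K 0 = 0" by (simp add: K_def c_def V10)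
  have "\<forall>\<^sub>F t in nhds 0. K (t *\<^sub>R (1, 0)) = t * 1" by (simp add: K_def c_def V10)
  from frechet_derivative_along_line[OF sK smooth_germ_const this]
  have DK: "frechet_derivative K (at 0) (1, 0) \<noteq> 0" by simp
  obtain \<xi> where \<xi>: "smooth_germ \<xi>" "\<xi> 0 = 0" "\<forall>\<^sub>F z in nhds 0. K (\<xi> z, snd z) = fst z"
    using inverse_function_with_parameters[OF sK K0 DK] by blast
  define \<tau> where "\<tau> = (\<lambda>u. \<xi> (0, u) + c)"
  have s\<tau>: "smooth_germ \<tau>" unfolding \<tau>_def
    by (intro smooth_intros smooth_germ_restrict_fst(2)[OF \<xi>(1)])
  have \<tau>: "\<forall>\<^sub>F u in nhds 0. \<tau> u = s u + (\<tau> u)\<^sup>2 * V1 (u, (u * \<tau> u)\<^sup>2)"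
    using eventually_axis(2)[OF \<xi>(3)] by eventually_elim (simp add: K_def \<tau>_def)
  have sm: "smooth_germ (\<lambda>u. (u, (u * \<tau> u)\<^sup>2))" "(0 :: real, (0 * \<tau> 0)\<^sup>2) = 0"
    by (auto intro!: smooth_intros s\<tau> simp: zero_prod_def)
  have branch: "\<forall>\<^sub>F u in nhds 0. V (u, (u * \<tau> u)\<^sup>2) = u\<^sup>2 * \<tau> u"
    using smooth_germ_eventually[OF sm V1(2)] r(2) s(2) \<tau>
  proof eventually_elim
    case (elim u)
    have "V (u, (u * \<tau> u)\<^sup>2) = u\<^sup>2 * (s u + (\<tau> u)\<^sup>2 * V1 (u, (u * \<tau> u)\<^sup>2))"
      using elim(1-3) by (simp add: power2_eq_square algebra_simps)
    then show ?case using elim(4) by simp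
  qed
  define V2 where "V2 = (\<lambda>p :: real \<times> real. V (fst p, snd p + (fst p * \<tau> (fst p))\<^sup>2))"
  have sV2: "smooth_germ V2" unfolding V2_def
    by (intro smooth_germ_compose[OF V(1)] smooth_intros smooth_germ_compose[OF s\<tau>]) (auto simp: zero_prod_def)
  obtain W where W: "smooth_germ W" "\<forall>\<^sub>F p in nhds 0. V2 p = V2 (fst p, 0) + snd p * W p"
    using hadamard_snd[OF sV2] by blast
  have "\<forall>\<^sub>F p :: real \<times> real in nhds 0. V (fst p, (fst p * \<tau> (fst p))\<^sup>2) = (fst p)\<^sup>2 * \<tau> (fst p)"
    using smooth_germ_eventually[OF smooth_germ_fst[OF smooth_germ_id] _ branch] by simp
  then have eq: "\<forall>\<^sub>F p in nhds 0. V2 p = (fst p)\<^sup>2 * \<tau> (fst p) + snd p * W p"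
    using W(2) by eventually_elim (simp add: V2_def)
  have "\<forall>\<^sub>F t in nhds 0. t * W (0, t) = t * (t ^ k * q t)"
    using eventually_axis(2)[OF eq] q(2) by eventually_elim (auto simp: V2_def)
  then have "\<forall>\<^sub>F t in nhds 0. W (0, t) = t ^ k * q t"
    by (rule eventually_cancel_real[OF smooth_germ_restrict_fst(2)[OF W(1)]
        smooth_germ_mult[OF smooth_germ_power[OF smooth_germ_id] q(1)]])
  with s\<tau> W(1) eq show ?thesis unfolding V2_def by blast
qed

context umbrella_chart
begin

lemma frechet_derivative_H: "frechet_derivative H (at 0) d = inner (frechet_derivative \<Psi> (at 0) d) w"
proof -
  have "(H has_derivative (\<lambda>d. inner (frechet_derivative \<Psi> (at 0) d) w)) (at 0)"
    unfolding H_def[abs_def] using \<Psi>_facts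
    by (intro bounded_linear.has_derivative[OF bounded_linear_inner_left] smooth_germ_has_derivative) auto
  then show ?thesis using frechet_derivative_at by metis
qed

lemma H_gradient_nonzero:
  "frechet_derivative H (at 0) (1, 0, 0) \<noteq> 0 \<or> frechet_derivative H (at 0) (0, 1, 0) \<noteq> 0 \<or>
   frechet_derivative H (at 0) (0, 0, 1) \<noteq> 0"
proof (rule ccontr)
  assume a: "\<not> ?thesis"
  interpret l: linear "frechet_derivative H (at 0)" by (rule linear_frechet_derivative[OF smooth_H])
  have "frechet_derivative H (at 0) d = 0" for d
  proof -
    obtain x y z where d: "d = (x, y, z)" using prod_cases3 by blast
    then have "d = x *\<^sub>R (1, 0, 0) + y *\<^sub>R (0, 1, 0) + z *\<^sub>R (0, 0, 1)" by simp
    then show ?thesis using a by (simp only: l.add l.scaleR) simp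
  qed
  moreover have "frechet_derivative \<Psi> (at 0) (frechet_derivative \<Psi>' (at 0) w) = w"
    using inverse_germs_frechet_derivative[OF inverse_germs_sym[OF \<Psi>]] .
  ultimately have "inner w w = 0" using frechet_derivative_H by metis
  then show False using w by simp
qed

subsection \<open>Sections with two branches\<close>

text \<open>The section consists of the smooth curve \<open>z' = 0\<close>, where \<open>z' = z - (x \<tau>)\<^sup>2\<close>, and a cusp. Since
  the normal form of the cusp is reached without changing \<open>z'\<close>, both are normalized at once. The second
  statement describes the two branches in the source.\<close>

lemma D_curve_if_singular:
  assumes HX: "frechet_derivative H (at 0) (1, 0, 0) = 0"
    and q: "smooth_germ q" "q 0 \<noteq> 0" "\<forall>\<^sub>F t in nhds 0. H (0, 0, t) = t ^ (k + 1) * q t" and k: "k \<ge> 1"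
  shows "D_curve (plane w) (2 * k + 3) section_curve"
    and "\<exists>\<tau> W r. smooth_germ \<tau> \<and> smooth_germ W \<and> smooth_germ r \<and> r 0 \<noteq> 0 \<and>
      (\<forall>\<^sub>F t in nhds 0. W (0, t) = t ^ k * r t) \<and>
      (\<forall>\<^sub>F p in nhds 0. H (standard_umbrella p) = 0 \<longleftrightarrow> snd p - fst p * \<tau> (fst p) = 0 \<or>
         fst p - (snd p + fst p * \<tau> (fst p)) * W (fst p, (snd p)\<^sup>2 - (fst p * \<tau> (fst p))\<^sup>2) = 0)"
proof -
  have ax: "smooth_germ (\<lambda>t :: real. (0 :: real, 0 :: real, t))" "(0 :: real, 0 :: real, 0 :: real) = 0"
    by (auto intro!: smooth_intros simp: zero_prod_def)
  have "\<forall>\<^sub>F t in nhds 0. H (t *\<^sub>R (0, 0, 1)) = t * (t ^ k * q t)"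
    using q(3) by eventually_elim simp
  from frechet_derivative_along_line[OF smooth_H smooth_germ_mult[OF smooth_germ_power[OF smooth_germ_id] q(1)] this]
  have HZ: "frechet_derivative H (at 0) (0, 0, 1) = 0" using k by simp
  define m where "m = (\<lambda>p :: real \<times> real \<times> real. (fst (snd p), fst p, snd (snd p)))"
  have blm: "bounded_linear m" unfolding m_def
    by (intro bounded_linear_Pair bounded_linear_fst bounded_linear_compose[OF bounded_linear_fst]
        bounded_linear_compose[OF bounded_linear_snd] bounded_linear_snd)
  have sm: "smooth_germ m" "m 0 = 0"
    unfolding m_def by (auto intro!: smooth_intros simp: zero_prod_def)
  define F where "F = (\<lambda>p. H (m p))"
  have DF: "frechet_derivative F (at 0) d = frechet_derivative H (at 0) (m d)" for d
    unfolding F_def frechet_derivative_compose_0[OF smooth_H sm] frechet_derivative_bounded_linear[OF blm] ..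
  have sF: "smooth_germ F" "F 0 = 0"
    unfolding F_def using smooth_germ_compose[OF smooth_H sm] sm H_0 by auto
  have "frechet_derivative F (at 0) (1, 0) \<noteq> 0"
    unfolding DF using H_gradient_nonzero HX HZ by (simp add: m_def)
  from preparation_degree_1[OF sF this]
  obtain V \<omega> where V: "smooth_germ V" "V 0 = 0" and \<omega>: "smooth_germ \<omega>" "\<omega> 0 \<noteq> 0"
    and eq: "\<forall>\<^sub>F p in nhds 0. fst p - V (snd p) = \<omega> p * F p" by blast
  have \<omega>_nz: "\<forall>\<^sub>F p in nhds 0. \<omega> p \<noteq> 0" using smooth_germ_eventually_nonzero[OF \<omega>] .
  have graph: "\<forall>\<^sub>F p in nhds 0. F p = 0 \<longleftrightarrow> fst p = V (snd p)"
    using eq \<omega>_nz by eventually_elim auto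
  have sm_snd: "smooth_germ (\<lambda>p :: real \<times> real \<times> real. snd p)" by (intro smooth_intros)
  have VX: "frechet_derivative V (at 0) (1, 0) = 0"
    by (rule preparation_derivative[OF V(1) \<omega>(1) sF eq]) (use HX in \<open>simp add: DF m_def\<close>)
  define r where "r = (\<lambda>t. - (\<omega> (0, 0, t) * q t))"
  have r: "smooth_germ r" "r 0 \<noteq> 0" unfolding r_def
    using \<omega>(2) q(2) by (auto intro!: smooth_intros q smooth_germ_compose[OF \<omega>(1) ax] simp: ax(2))
  have r_nz: "\<forall>\<^sub>F t in nhds 0. r t \<noteq> 0" using smooth_germ_eventually_nonzero[OF r] .
  have V0: "\<forall>\<^sub>F t in nhds 0. V (0, t) = t ^ (k + 1) * r t"
    using smooth_germ_eventually[OF ax eq] q(3)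
    by eventually_elim (simp add: r_def F_def m_def algebra_simps)
  obtain \<tau> W where \<tau>: "smooth_germ \<tau>" and W: "smooth_germ W" "\<forall>\<^sub>F t in nhds 0. W (0, t) = t ^ k * r t"
    and div: "\<forall>\<^sub>F p in nhds 0. V (fst p, snd p + (fst p * \<tau> (fst p))\<^sup>2) = (fst p)\<^sup>2 * \<tau> (fst p) + snd p * W p"
    using branch_division[OF V VX r(1) V0 k] by blast
  have W0: "W 0 = 0" using eventually_nhds_x_imp_x[OF W(2)] k by (simp add: zero_prod_def)
  define sh where "sh = (\<lambda>p :: real \<times> real. (fst p, snd p - (fst p * \<tau> (fst p))\<^sup>2))"
  have ssh: "smooth_germ sh" "sh 0 = 0" unfolding sh_def
    by (auto intro!: smooth_intros smooth_germ_compose[OF \<tau>] simp: zero_prod_def)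
  have sh: "inverse_germs sh (\<lambda>p. (fst p, snd p + (fst p * \<tau> (fst p))\<^sup>2))"
    unfolding inverse_germs_def using ssh
    by (auto intro!: smooth_intros smooth_germ_compose[OF \<tau>] simp: zero_prod_def sh_def)
  have V_sh: "\<forall>\<^sub>F p in nhds 0. V p = (fst p)\<^sup>2 * \<tau> (fst p) + snd (sh p) * W (sh p)"
    using smooth_germ_eventually[OF ssh div] by eventually_elim (simp add: sh_def)
  \<comment> \<open>In these coordinates \<open>x\<^sup>2 z - V\<^sup>2 = z' (\<mu> x\<^sup>2 - z' W\<^sup>2)\<close>, and dividing \<open>W\<close> by \<open>sqrt \<mu>\<close> gives a cusp.\<close>
  define \<mu> where "\<mu> = (\<lambda>p :: real \<times> real. 1 - 2 * \<tau> (fst p) * W p)"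
  have \<mu>: "smooth_germ \<mu>" "\<mu> 0 = 1" unfolding \<mu>_def
    by (auto intro!: smooth_intros smooth_germ_compose[OF \<tau>] W simp: W0)
  have \<mu>_pos: "\<forall>\<^sub>F p in nhds 0. \<mu> p > 0"
    by (rule smooth_germ_eventually_greater[OF \<mu>(1)]) (simp add: \<mu>)
  define W' where "W' = (\<lambda>p. W p / sqrt (\<mu> p))"
  have W': "smooth_germ W'" unfolding W'_def
    by (intro smooth_intros W \<mu>) (auto simp: \<mu>)
  define r' where "r' = (\<lambda>t. r t / sqrt (\<mu> (0, t)))"
  have s\<mu>0: "smooth_germ (\<lambda>t. \<mu> (0, t))" using smooth_germ_restrict_fst(2)[OF \<mu>(1)] .
  have \<mu>00: "\<mu> (0, 0) = 1" using \<mu>(2) by (simp add: zero_prod_def)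
  have r': "smooth_germ r'" "r' 0 \<noteq> 0" unfolding r'_def
    using r(2) by (auto intro!: smooth_intros r s\<mu>0 simp: \<mu>00)
  have "\<forall>\<^sub>F t in nhds 0. W' (0, t) = t ^ k * r' t"
    using W(2) by eventually_elim (simp add: W'_def r'_def)
  from cusp_normal_form[OF W' r' this]
  obtain \<Theta> where \<Theta>: "smooth_germ \<Theta>" "\<Theta> 0 = 0" "frechet_derivative \<Theta> (at 0) (1, 0) \<noteq> 0"
    and cusp: "\<forall>\<^sub>F p in nhds 0. (fst p)\<^sup>2 = snd p * (W' p)\<^sup>2 \<longleftrightarrow> (\<Theta> p)\<^sup>2 = snd p ^ (2 * k + 1)"
    by blast
  obtain \<psi> where \<psi>: "inverse_germs (\<lambda>z. (\<Theta> z, snd z)) \<psi>"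
    using inverse_germs_first_coordinate[OF \<Theta>] by blast
  have neg: "inverse_germs (\<lambda>p :: real \<times> real. (fst p, - snd p)) (\<lambda>p. (fst p, - snd p))"
    unfolding inverse_germs_def by (auto intro!: smooth_intros simp: zero_prod_def)
  have \<alpha>: "\<exists>\<alpha>'. inverse_germs (\<lambda>p. (\<Theta> (sh p), - snd (sh p))) \<alpha>'"
    using inverse_germs_compose[OF inverse_germs_compose[OF sh \<psi>] neg] by auto
  define \<sigma> where "\<sigma> = (\<lambda>p :: real \<times> real. m (V p, p))"
  have sVp: "smooth_germ (\<lambda>p. (V p, p))" "(V 0, 0 :: real \<times> real) = 0"
    using V by (auto intro!: smooth_intros simp: zero_prod_def)
  have s\<sigma>: "smooth_germ \<sigma>" "\<sigma> 0 = 0"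
    using smooth_germ_compose[OF sm(1) sVp] V by (auto simp: \<sigma>_def m_def zero_prod_def)
  define pr where "pr = (\<lambda>x :: real \<times> real \<times> real. (fst x, snd (snd x)))"
  have spr: "smooth_germ pr" "pr 0 = 0" by (auto simp: pr_def zero_prod_def intro!: smooth_intros)
  have s_snd: "smooth_germ (\<lambda>p :: real \<times> real. snd p)" "snd (0 :: real \<times> real) = 0"
    by (auto intro!: smooth_intros)
  have section_eq: "\<forall>\<^sub>F p in nhds 0. (V p)\<^sup>2 = (fst p)\<^sup>2 * snd p \<longleftrightarrow>
      snd (sh p) = 0 \<or> (\<Theta> (sh p))\<^sup>2 = snd (sh p) ^ (2 * k + 1)"
    using smooth_germ_eventually[OF ssh eventually_conj[OF \<mu>_pos cusp]] V_sh
  proof eventually_elim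
    case (elim p)
    define x z' t c where d: "x = fst p" "z' = snd (sh p)" "t = \<tau> (fst p)" "c = W (sh p)"
    have z: "snd p = z' + (x * t)\<^sup>2" and xsh: "fst (sh p) = x" by (simp_all add: d sh_def)
    have Vp: "V p = x\<^sup>2 * t + z' * c" using elim(2) by (simp add: d)
    have \<mu>p: "\<mu> (sh p) = 1 - 2 * t * c" by (simp add: \<mu>_def d sh_def)
    have c': "(W' (sh p))\<^sup>2 * \<mu> (sh p) = c\<^sup>2"
      using elim(1) by (simp add: W'_def d power_divide)
    have "(fst p)\<^sup>2 * snd p - (V p)\<^sup>2 = z' * (\<mu> (sh p) * x\<^sup>2 - z' * c\<^sup>2)"
      unfolding Vp z \<mu>p d(1)[symmetric] by algebra
    also have "\<dots> = z' * (\<mu> (sh p) * (x\<^sup>2 - z' * (W' (sh p))\<^sup>2))"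
      unfolding c'[symmetric] by algebra
    finally have "(V p)\<^sup>2 = (fst p)\<^sup>2 * snd p \<longleftrightarrow> z' = 0 \<or> x\<^sup>2 = z' * (W' (sh p))\<^sup>2"
      using elim(1) by (metis less_irrefl mult_eq_0_iff right_minus_eq)
    then show ?case using elim(1) by (simp add: xsh d)
  qed
  have Z: "\<forall>\<^sub>F p in nhds 0. \<sigma> p \<in> standard_umbrella_image \<longleftrightarrow>
      (\<Theta> (sh p), - snd (sh p)) \<in> {(x, y). x\<^sup>2 * y + y ^ (2 * k + 3 - 1) = 0}"
    using section_eq smooth_germ_eventually[OF s_snd eventually_conj[OF V0 r_nz]]
  proof eventually_elim
    case (elim p)
    have "snd p \<ge> 0" if *: "(V p)\<^sup>2 = (fst p)\<^sup>2 * snd p"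
    proof (cases "fst p = 0")
      case True
      then have "V (0, snd p) = 0" using * by (metis mult_zero_left power_zero_numeral prod.collapse zero_eq_power2)
      then show ?thesis using elim by auto
    next
      case False
      then show ?thesis using * zero_le_power2[of "V p"] by (simp add: zero_le_mult_iff)
    qed
    then have "\<sigma> p \<in> standard_umbrella_image \<longleftrightarrow> (V p)\<^sup>2 = (fst p)\<^sup>2 * snd p"
      by (auto simp: \<sigma>_def m_def standard_umbrella_image_def split_beta)
    moreover define z' \<theta> where d: "z' = snd (sh p)" "\<theta> = \<Theta> (sh p)"
    have "\<theta>\<^sup>2 * (- z') + (- z') ^ (2 * k + 2) = - z' * (\<theta>\<^sup>2 - z' ^ (2 * k + 1))"
      by (simp add: algebra_simps power2_eq_square)
    then have "\<theta>\<^sup>2 * (- z') + (- z') ^ (2 * k + 2) = 0 \<longleftrightarrow> z' = 0 \<or> \<theta>\<^sup>2 = z' ^ (2 * k + 1)"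
      by (metis mult_eq_0_iff neg_equal_0_iff_equal right_minus_eq)
    ultimately show ?case using elim(1) by (simp add: d)
  qed
  obtain \<alpha>' where \<alpha>': "inverse_germs (\<lambda>p. (\<Theta> (sh p), - snd (sh p))) \<alpha>'" using \<alpha> by blast
  have "diffeomorphic_in_plane (plane w) {(x, y). x\<^sup>2 * y + y ^ (2 * k + 3 - 1) = 0} section_curve"
  proof (rule diffeomorphic_in_plane_section_curve[OF s\<sigma> spr _ _ _ \<alpha>' Z])
    show "\<forall>\<^sub>F p in nhds 0. pr (\<sigma> p) = p" by (simp add: pr_def \<sigma>_def m_def)
    show "\<forall>\<^sub>F p in nhds 0. H (\<sigma> p) = 0"
      using smooth_germ_eventually[OF sVp graph] by eventually_elim (simp add: F_def \<sigma>_def)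
    have "smooth_germ (\<lambda>x. (fst (snd x), fst x, snd (snd x)))" by (intro smooth_intros)
    from smooth_germ_eventually[OF this _ graph]
    show "\<forall>\<^sub>F x in nhds 0. H x = 0 \<longrightarrow> \<sigma> (pr x) = x"
      by (auto simp: F_def \<sigma>_def m_def pr_def zero_prod_def elim!: eventually_mono)
  qed
  then show "D_curve (plane w) (2 * k + 3) section_curve" by (simp add: D_curve_def)
  have su: "smooth_germ (\<lambda>p :: real \<times> real. (fst p * snd p, fst p, (snd p)\<^sup>2))"
      "(fst (0 :: real \<times> real) * snd (0 :: real \<times> real), fst (0 :: real \<times> real), (snd (0 :: real \<times> real))\<^sup>2) = 0"
    and su': "smooth_germ (\<lambda>p :: real \<times> real. (fst p, (snd p)\<^sup>2))"
      "(fst (0 :: real \<times> real), (snd (0 :: real \<times> real))\<^sup>2) = 0"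
    by (auto intro!: smooth_intros simp: zero_prod_def)
  have "\<forall>\<^sub>F p in nhds 0. H (standard_umbrella p) = 0 \<longleftrightarrow> snd p - fst p * \<tau> (fst p) = 0 \<or>
         fst p - (snd p + fst p * \<tau> (fst p)) * W (fst p, (snd p)\<^sup>2 - (fst p * \<tau> (fst p))\<^sup>2) = 0"
    using smooth_germ_eventually[OF su graph] smooth_germ_eventually[OF su' V_sh]
  proof eventually_elim
    case (elim p)
    define u v y c where d: "u = fst p" "v = snd p" "y = fst p * \<tau> (fst p)" "c = W (u, v\<^sup>2 - y\<^sup>2)"
    have "V (u, v\<^sup>2) = u * y + (v\<^sup>2 - y\<^sup>2) * c"
      using elim(2) by (simp add: d sh_def power2_eq_square)
    then have "u * v - V (u, v\<^sup>2) = (v - y) * (u - (v + y) * c)"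
      by (simp add: power2_eq_square algebra_simps)
    moreover have "H (standard_umbrella p) = 0 \<longleftrightarrow> u * v = V (u, v\<^sup>2)"
      using elim(1) by (simp add: d F_def m_def standard_umbrella_def)
    ultimately show ?case
      by (metis d mult_eq_0_iff right_minus_eq)
  qed
  then show "\<exists>\<tau> W r. smooth_germ \<tau> \<and> smooth_germ W \<and> smooth_germ r \<and> r 0 \<noteq> 0 \<and>
      (\<forall>\<^sub>F t in nhds 0. W (0, t) = t ^ k * r t) \<and>
      (\<forall>\<^sub>F p in nhds 0. H (standard_umbrella p) = 0 \<longleftrightarrow> snd p - fst p * \<tau> (fst p) = 0 \<or>
         fst p - (snd p + fst p * \<tau> (fst p)) * W (fst p, (snd p)\<^sup>2 - (fst p * \<tau> (fst p))\<^sup>2) = 0)"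
    using \<tau> W r by blast
qed

end

section \<open>Completing the square on the umbrella\<close>

text \<open>For fixed \<open>u\<close> the function \<open>v\<^sup>2 - Q(u, u v)\<close> has a critical point \<open>v = u \<nu>(u)\<close>. Expanding
  \<open>Q\<close> to second order in its second variable at \<open>x\<^sup>2 \<nu>(x)\<close> puts both this function and
  \<open>y\<^sup>2 - x\<^sup>2 Q(x, y)\<close>, the equation of a section of the umbrella, in the form of a square times a unit
  minus a function of one variable: with \<open>v = u \<nu> + t\<close> and \<open>y = x\<^sup>2 \<nu> + y'\<close> they become
  \<open>t\<^sup>2 (1 - u\<^sup>2 R) - u\<^sup>2 e(u)\<close> and \<open>y'\<^sup>2 (1 - x\<^sup>2 R) - x\<^sup>4 e(x)\<close>.\<close>

lemma critical_expansion:
  fixes Q :: "real \<times> real \<Rightarrow> real"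
  assumes Q: "smooth_germ Q" "Q 0 = 0" "frechet_derivative Q (at 0) (1, 0) = 0"
  shows "\<exists>\<nu> e R. smooth_germ \<nu> \<and> smooth_germ e \<and> smooth_germ R \<and>
    (\<forall>\<^sub>F p in nhds 0. Q (fst p, (fst p)\<^sup>2 * \<nu> (fst p) + snd p) =
       (fst p)\<^sup>2 * (e (fst p) + (\<nu> (fst p))\<^sup>2) + 2 * \<nu> (fst p) * snd p + (snd p)\<^sup>2 * R p)"
proof -
  define G where "G = (\<lambda>z :: real \<times> real \<times> real. Q (fst (snd z), snd (snd z) + fst z))"
  have sG: "smooth_germ G" unfolding G_def
    by (intro smooth_germ_compose[OF Q(1)] smooth_intros) (simp add: zero_prod_def)
  obtain D where D: "smooth_germ D" "\<forall>\<^sub>F z in nhds 0. G z = G (0, snd z) + fst z * D z"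
    using hadamard[OF sG] by blast
  obtain D2 where D2: "smooth_germ D2" "\<forall>\<^sub>F z in nhds 0. D z = D (0, snd z) + fst z * D2 z"
    using hadamard[OF D(1)] by blast
  define q where "q = (\<lambda>p. D (0, p))"
  have q: "smooth_germ q" unfolding q_def
    by (intro smooth_germ_compose[OF D(1)] smooth_intros) (simp add: zero_prod_def)
  \<comment> \<open>Solve \<open>2 \<nu> = q(u, u\<^sup>2 \<nu>)\<close>, where \<open>q\<close> is the derivative of \<open>Q\<close> in its second variable, near the
    value \<open>c\<close> of \<open>\<nu>\<close> at the origin.\<close>
  define c where "c = q (0, 0) / 2"
  define K where "K = (\<lambda>p :: real \<times> real. 2 * (fst p + c) - q (snd p, (snd p)\<^sup>2 * (fst p + c)))"
  have sK: "smooth_germ K" unfolding K_def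
    by (intro smooth_intros smooth_germ_compose[OF q]) (simp add: zero_prod_def)
  have K0: "K 0 = 0" by (simp add: K_def c_def)
  have "\<forall>\<^sub>F t in nhds 0. K (t *\<^sub>R (1, 0)) = t * 2" by (simp add: K_def c_def)
  from frechet_derivative_along_line[OF sK smooth_germ_const this]
  have DK: "frechet_derivative K (at 0) (1, 0) \<noteq> 0" by simp
  obtain \<xi> where \<xi>: "smooth_germ \<xi>" "\<forall>\<^sub>F z in nhds 0. K (\<xi> z, snd z) = fst z"
    using inverse_function_with_parameters[OF sK K0 DK] by blast
  define \<nu> where "\<nu> = (\<lambda>u. \<xi> (0, u) + c)"
  have s\<nu>: "smooth_germ \<nu>" unfolding \<nu>_def
    by (intro smooth_intros smooth_germ_restrict_fst(2)[OF \<xi>(1)])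
  have \<nu>: "\<forall>\<^sub>F u in nhds 0. q (u, u\<^sup>2 * \<nu> u) = 2 * \<nu> u"
    using eventually_axis(2)[OF \<xi>(2)] by eventually_elim (simp add: K_def \<nu>_def)

  obtain Qb where Qb: "smooth_germ Qb" "\<forall>\<^sub>F p in nhds 0. Q p = Q (fst p, 0) + snd p * Qb p"
    using hadamard_snd[OF Q(1)] by blast
  have Q00: "Q (0, 0) = 0" using Q(2) by (simp add: zero_prod_def)
  obtain r where r: "smooth_germ r" "\<forall>\<^sub>F x in nhds 0. Q (x, 0) = x * r x"
    using hadamard_real[OF smooth_germ_restrict_fst(1)[OF Q(1)]] Q00 by auto
  have "r 0 = 0"
    using frechet_derivative_along_line[OF Q(1) r(1), of "(1, 0)"] r(2) Q(3) by simp
  then obtain s where s: "smooth_germ s" "\<forall>\<^sub>F x in nhds 0. r x = x * s x"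
    using hadamard_real[OF r(1)] by auto
  have sm: "smooth_germ (\<lambda>u. (u, u\<^sup>2 * \<nu> u))" "(0 :: real, 0\<^sup>2 * \<nu> 0) = 0"
    by (auto intro!: smooth_intros s\<nu> simp: zero_prod_def)
  define e where "e = (\<lambda>u. s u + \<nu> u * Qb (u, u\<^sup>2 * \<nu> u) - (\<nu> u)\<^sup>2)"
  have se: "smooth_germ e" unfolding e_def
    by (intro smooth_intros s s\<nu> smooth_germ_compose[OF Qb(1) sm])
  have crit: "\<forall>\<^sub>F u in nhds 0. Q (u, u\<^sup>2 * \<nu> u) = u\<^sup>2 * (e u + (\<nu> u)\<^sup>2)"
    using smooth_germ_eventually[OF sm Qb(2)] r(2) s(2)
    by eventually_elim (simp add: e_def power2_eq_square algebra_simps)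
  define R where "R = (\<lambda>p :: real \<times> real. D2 (snd p, fst p, (fst p)\<^sup>2 * \<nu> (fst p)))"
  have s\<nu>f: "smooth_germ (\<lambda>p :: real \<times> real. \<nu> (fst p))"
    by (intro smooth_germ_compose[OF s\<nu>] smooth_intros) simp
  have sm3: "smooth_germ (\<lambda>p :: real \<times> real. (snd p, fst p, (fst p)\<^sup>2 * \<nu> (fst p)))"
    "(snd (0 :: real \<times> real), fst (0 :: real \<times> real), (fst (0 :: real \<times> real))\<^sup>2 * \<nu> (fst (0 :: real \<times> real))) = 0"
    by (auto intro!: smooth_intros s\<nu>f simp: zero_prod_def)
  have sR: "smooth_germ R" unfolding R_def by (rule smooth_germ_compose[OF D2(1) sm3])
  have "\<forall>\<^sub>F p :: real \<times> real in nhds 0. Q (fst p, (fst p)\<^sup>2 * \<nu> (fst p)) = (fst p)\<^sup>2 * (e (fst p) + (\<nu> (fst p))\<^sup>2)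
      \<and> q (fst p, (fst p)\<^sup>2 * \<nu> (fst p)) = 2 * \<nu> (fst p)"
    using smooth_germ_eventually[OF smooth_germ_fst[OF smooth_germ_id] _ eventually_conj[OF crit \<nu>]] by simp
  then have "\<forall>\<^sub>F p in nhds 0. Q (fst p, (fst p)\<^sup>2 * \<nu> (fst p) + snd p) =
       (fst p)\<^sup>2 * (e (fst p) + (\<nu> (fst p))\<^sup>2) + 2 * \<nu> (fst p) * snd p + (snd p)\<^sup>2 * R p"
    using smooth_germ_eventually[OF sm3 D(2)] smooth_germ_eventually[OF sm3 D2(2)]
    by eventually_elim (simp add: G_def q_def R_def power2_eq_square algebra_simps)
  with s\<nu> se sR show ?thesis by blast
qed


section \<open>Orders of critical points\<close>

text \<open>Up to bounded factors, this quantity is invariant under multiplication by units and changes of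
  coordinates. For \<open>v\<^sup>2 \<plusminus> u\<^sup>k\<^sup>+\<^sup>1\<close> it is at least a multiple of the \<open>k\<close>-th power of the distance from
  the origin and up to a factor of this size on the axis \<open>v = 0\<close>, which recovers \<open>k\<close>.\<close>

definition jet_size :: "(real \<times> real \<Rightarrow> real) \<Rightarrow> real \<times> real \<Rightarrow> real" where
  "jet_size f p = \<bar>f p\<bar> + \<bar>frechet_derivative f (at p) (1, 0)\<bar> + \<bar>frechet_derivative f (at p) (0, 1)\<bar>"

lemma smooth_germ_bounded:
  fixes f :: "'a::real_normed_vector \<Rightarrow> real"
  assumes "smooth_germ f"
  obtains B where "B > 0" "\<forall>\<^sub>F p in nhds 0. \<bar>f p\<bar> \<le> B"
proof -
  have "((\<lambda>p. \<bar>f p\<bar>) \<longlongrightarrow> \<bar>f 0\<bar>) (nhds 0)" by (intro tendsto_intros smooth_germ_tendsto assms)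
  then have "\<forall>\<^sub>F p in nhds 0. \<bar>f p\<bar> < \<bar>f 0\<bar> + 1" by (rule order_tendstoD) simp
  then have "\<forall>\<^sub>F p in nhds 0. \<bar>f p\<bar> \<le> \<bar>f 0\<bar> + 1" by eventually_elim simp
  then show ?thesis using that[of "\<bar>f 0\<bar> + 1"] by simp
qed

lemma smooth_germ_norm_le:
  fixes \<alpha> :: "'a::real_normed_vector \<Rightarrow> 'b::real_normed_vector"
  assumes "smooth_germ \<alpha>" "\<alpha> 0 = 0"
  obtains C where "C > 0" "\<forall>\<^sub>F p in nhds 0. norm (\<alpha> p) \<le> C * norm p"
proof -
  have D: "(\<alpha> has_derivative frechet_derivative \<alpha> (at 0)) (at 0)"
    by (rule smooth_germ_has_derivative[OF assms(1)])
  then obtain B where B: "B > 0" "\<And>d. norm (frechet_derivative \<alpha> (at 0) d) \<le> norm d * B"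
    using has_derivative_bounded_linear bounded_linear.pos_bounded by metis
  have "\<exists>d>0. \<forall>y. norm (y - 0) < d \<longrightarrow>
      norm (\<alpha> y - \<alpha> 0 - frechet_derivative \<alpha> (at 0) (y - 0)) \<le> 1 * norm (y - 0)"
    using D unfolding has_derivative_at_alt by (metis zero_less_one)
  then obtain d where d: "d > 0" "\<And>y. norm y < d \<Longrightarrow> norm (\<alpha> y - frechet_derivative \<alpha> (at 0) y) \<le> norm y"
    using assms(2) by auto
  have "norm (\<alpha> y) \<le> (B + 1) * norm y" if "norm y < d" for y
    using d(2)[OF that] B(2)[of y] norm_triangle_sub[of "\<alpha> y" "frechet_derivative \<alpha> (at 0) y"]
    by (simp add: algebra_simps)
  then have "\<forall>\<^sub>F p in nhds 0. norm (\<alpha> p) \<le> (B + 1) * norm p"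
    using d(1) unfolding eventually_nhds_metric by (auto simp: dist_norm)
  then show ?thesis using that[of "B + 1"] B(1) by simp
qed

lemma jet_size_pullback:
  fixes f1 f2 \<omega> :: "real \<times> real \<Rightarrow> real" and \<alpha> :: "real \<times> real \<Rightarrow> real \<times> real"
  assumes "smooth_germ f2" "smooth_germ \<alpha>" "\<alpha> 0 = 0" "smooth_germ \<omega>"
    and eq: "\<forall>\<^sub>F p in nhds 0. f1 p = \<omega> p * f2 (\<alpha> p)"
  obtains C where "C > 0" "\<forall>\<^sub>F p in nhds 0. jet_size f1 p \<le> C * jet_size f2 (\<alpha> p)"
proof -
  have part: "\<exists>C>0. \<forall>\<^sub>F p in nhds 0. \<bar>frechet_derivative f1 (at p) d\<bar> \<le> C * jet_size f2 (\<alpha> p)" for d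
  proof -
    define a b c where "a = (\<lambda>p. \<omega> p * fst (frechet_derivative \<alpha> (at p) d))"
      and "b = (\<lambda>p. \<omega> p * snd (frechet_derivative \<alpha> (at p) d))"
      and "c = (\<lambda>p. frechet_derivative \<omega> (at p) d)"
    have s: "smooth_germ a" "smooth_germ b" "smooth_germ c" unfolding a_def b_def c_def
      by (intro smooth_intros smooth_germ_frechet_derivative assms)+
    obtain A where A: "A > 0" "\<forall>\<^sub>F p in nhds 0. \<bar>a p\<bar> \<le> A" using smooth_germ_bounded[OF s(1)] .
    obtain B where B: "B > 0" "\<forall>\<^sub>F p in nhds 0. \<bar>b p\<bar> \<le> B" using smooth_germ_bounded[OF s(2)] .
    obtain C where C: "C > 0" "\<forall>\<^sub>F p in nhds 0. \<bar>c p\<bar> \<le> C" using smooth_germ_bounded[OF s(3)] .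
    have "\<forall>\<^sub>F p in nhds 0. \<forall>\<^sub>F y in nhds p. \<omega> y * f2 (\<alpha> y) = f1 y"
      using eq by (simp only: eventually_eventually) (auto elim: eventually_mono)
    moreover have "\<forall>\<^sub>F p in nhds 0. (f2 has_derivative frechet_derivative f2 (at (\<alpha> p))) (at (\<alpha> p))"
      using smooth_germ_eventually[OF assms(2,3) smooth_germ_eventually_has_derivative[OF assms(1)]] .
    ultimately have "\<forall>\<^sub>F p in nhds 0. \<bar>frechet_derivative f1 (at p) d\<bar> \<le> (A + B + C) * jet_size f2 (\<alpha> p)"
      using smooth_germ_eventually_has_derivative[OF assms(2)] smooth_germ_eventually_has_derivative[OF assms(4)]
        A(2) B(2) C(2)
    proof eventually_elim
      case (elim p)
      define J where "J = jet_size f2 (\<alpha> p)"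
      define X Y where "X = frechet_derivative f2 (at (\<alpha> p)) (1, 0)" and "Y = frechet_derivative f2 (at (\<alpha> p)) (0, 1)"
      interpret l: linear "frechet_derivative f2 (at (\<alpha> p))" using elim(2) has_derivative_linear by blast
      have "frechet_derivative f2 (at (\<alpha> p)) e = fst e * X + snd e * Y" for e
      proof -
        have "e = fst e *\<^sub>R (1, 0) + snd e *\<^sub>R (0, 1)" by (simp add: prod_eq_iff)
        then have "frechet_derivative f2 (at (\<alpha> p)) e =
          frechet_derivative f2 (at (\<alpha> p)) (fst e *\<^sub>R (1, 0) + snd e *\<^sub>R (0, 1))" by simp
        then show ?thesis by (simp only: l.add l.scaleR) (simp add: X_def Y_def)
      qed
      note expand = this[of "frechet_derivative \<alpha> (at p) d"]
      have "(f1 has_derivative (\<lambda>d. \<omega> p * frechet_derivative f2 (at (\<alpha> p)) (frechet_derivative \<alpha> (at p) d) +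
          frechet_derivative \<omega> (at p) d * f2 (\<alpha> p))) (at p)"
        by (rule has_derivative_cong_eventually[OF has_derivative_mult[OF elim(4) has_derivative_compose[OF elim(3,2)]] elim(1)])
      from fun_cong[OF frechet_derivative_at[OF this], of d]
      have "frechet_derivative f1 (at p) d = a p * X + b p * Y + c p * f2 (\<alpha> p)"
        by (simp only: expand) (simp add: a_def b_def c_def algebra_simps)
      also have "\<bar>\<dots>\<bar> \<le> \<bar>a p\<bar> * \<bar>X\<bar> + \<bar>b p\<bar> * \<bar>Y\<bar> + \<bar>c p\<bar> * \<bar>f2 (\<alpha> p)\<bar>"
        by (simp add: abs_mult[symmetric] abs_triangle_ineq[THEN order_trans])
      also have "\<dots> \<le> A * J + B * J + C * J"
        using elim A(1) B(1) C(1)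
        by (intro add_mono mult_mono) (auto simp: J_def jet_size_def X_def Y_def)
      finally show ?case by (simp add: J_def algebra_simps)
    qed
    then show ?thesis using A(1) B(1) C(1) by (intro exI[of _ "A + B + C"]) simp
  qed
  obtain C1 where C1: "C1 > 0" "\<forall>\<^sub>F p in nhds 0. \<bar>frechet_derivative f1 (at p) (1, 0)\<bar> \<le> C1 * jet_size f2 (\<alpha> p)"
    using part by blast
  obtain C2 where C2: "C2 > 0" "\<forall>\<^sub>F p in nhds 0. \<bar>frechet_derivative f1 (at p) (0, 1)\<bar> \<le> C2 * jet_size f2 (\<alpha> p)"
    using part by blast
  obtain B where B: "B > 0" "\<forall>\<^sub>F p in nhds 0. \<bar>\<omega> p\<bar> \<le> B" using smooth_germ_bounded[OF assms(4)] .
  have "\<forall>\<^sub>F p in nhds 0. jet_size f1 p \<le> (B + C1 + C2) * jet_size f2 (\<alpha> p)"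
    using eq B(2) C1(2) C2(2)
  proof eventually_elim
    case (elim p)
    have "\<bar>f1 p\<bar> \<le> B * jet_size f2 (\<alpha> p)"
      unfolding elim(1) abs_mult using elim(2) B(1) by (intro mult_mono) (auto simp: jet_size_def)
    then show ?case using elim by (simp add: jet_size_def[of f1] algebra_simps)
  qed
  then show ?thesis using that[of "B + C1 + C2"] B(1) C1(1) C2(1) by simp
qed

text \<open>A lower bound for one of two contact equivalent functions and an upper bound for the other on an axis
  compare the exponents of the two bounds.\<close>

lemma jet_order_le:
  fixes f1 f2 \<omega> :: "real \<times> real \<Rightarrow> real" and \<alpha> \<alpha>' :: "real \<times> real \<Rightarrow> real \<times> real"
  assumes f1: "smooth_germ f1" and \<alpha>: "inverse_germs \<alpha> \<alpha>'" and \<omega>: "smooth_germ \<omega>"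
    and eq: "\<forall>\<^sub>F p in nhds 0. f2 p = \<omega> p * f1 (\<alpha> p)"
    and lower: "c > 0" "\<forall>\<^sub>F p in nhds 0. c * norm p ^ k \<le> jet_size f2 p"
    and upper: "\<forall>\<^sub>F u in nhds 0. jet_size f1 (u, 0) \<le> C * \<bar>u\<bar> ^ m"
  shows "m \<le> k"
proof (rule ccontr)
  assume "\<not> m \<le> k"
  then have mk: "k < m" by simp
  note \<alpha>_facts = \<alpha>[unfolded inverse_germs_def]
  obtain C1 where C1: "C1 > 0" "\<forall>\<^sub>F p in nhds 0. jet_size f2 p \<le> C1 * jet_size f1 (\<alpha> p)"
    using jet_size_pullback[OF f1 _ _ \<omega> eq] \<alpha>_facts by metis
  obtain C2 where C2: "C2 > 0" "\<forall>\<^sub>F p in nhds 0. norm (\<alpha> p) \<le> C2 * norm p"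
    using smooth_germ_norm_le[of \<alpha>] \<alpha>_facts by metis
  have ev: "\<forall>\<^sub>F q in nhds 0. c * norm (\<alpha>' q) ^ k \<le> jet_size f2 (\<alpha>' q) \<and>
      jet_size f2 (\<alpha>' q) \<le> C1 * jet_size f1 (\<alpha> (\<alpha>' q)) \<and> norm (\<alpha> (\<alpha>' q)) \<le> C2 * norm (\<alpha>' q)"
    using \<alpha>_facts
    by (intro smooth_germ_eventually[of \<alpha>', OF _ _ eventually_conj[OF lower(2) eventually_conj[OF C1(2) C2(2)]]]) auto
  have "\<forall>\<^sub>F q in nhds 0. \<alpha> (\<alpha>' q) = q" using \<alpha>_facts by simp
  from eventually_conj[OF ev this] have "\<forall>\<^sub>F q in nhds 0. c * norm q ^ k \<le> C2 ^ k * C1 * jet_size f1 q"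
  proof eventually_elim
    case (elim q)
    have "c * norm q ^ k \<le> c * (C2 * norm (\<alpha>' q)) ^ k"
      using elim lower(1) by (intro mult_left_mono power_mono) auto
    also have "\<dots> = C2 ^ k * (c * norm (\<alpha>' q) ^ k)" by (simp add: power_mult_distrib)
    also have "\<dots> \<le> C2 ^ k * (C1 * jet_size f1 q)"
      using elim C2(1) by (intro mult_left_mono) auto
    finally show ?case by simp
  qed
  from eventually_axis(1)[OF this] upper
  have "\<forall>\<^sub>F u in nhds 0. c * \<bar>u\<bar> ^ k \<le> C2 ^ k * C1 * C * \<bar>u\<bar> ^ m"
  proof eventually_elim
    case (elim u)
    have "c * \<bar>u\<bar> ^ k \<le> C2 ^ k * C1 * jet_size f1 (u, 0)" using elim(1) by simp
    also have "\<dots> \<le> C2 ^ k * C1 * (C * \<bar>u\<bar> ^ m)" using elim(2) C1(1) C2(1) by (intro mult_left_mono) auto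
    finally show ?case by (simp add: mult.assoc)
  qed
  then obtain d where d: "d > 0" "\<And>u. \<bar>u\<bar> < d \<Longrightarrow> c * \<bar>u\<bar> ^ k \<le> C2 ^ k * C1 * C * \<bar>u\<bar> ^ m"
    unfolding eventually_nhds_metric by (auto simp: dist_norm)
  \<comment> \<open>A point so close to the origin that the bound of order \<open>m > k\<close> is at most half of the lower bound.\<close>
  define E where "E = \<bar>C2 ^ k * C1 * C\<bar> + 1"
  define u where "u = min (d / 2) (min 1 (c / (2 * E)))"
  have E: "E > 0" "C2 ^ k * C1 * C \<le> E" by (simp_all add: E_def)
  have u: "0 < u" "u < d" "u \<le> 1" "u \<le> c / (2 * E)"
    using d(1) lower(1) E(1) by (simp_all add: u_def min_less_iff_disj)
  have "c * u ^ k \<le> C2 ^ k * C1 * C * u ^ m" using d(2)[of u] u by simp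
  also have "\<dots> \<le> E * u ^ m" using E(2) u(1) by (intro mult_right_mono) auto
  also have "\<dots> \<le> E * u ^ Suc k" using u mk E(1) by (intro mult_left_mono power_decreasing) auto
  also have "\<dots> = (E * u) * u ^ k" by simp
  also have "\<dots> \<le> (c / 2) * u ^ k"
    using u(1,4) E(1) by (intro mult_right_mono) (auto simp: field_simps)
  finally show False using u(1) lower(1) by (simp add: mult_le_cancel_right)
qed

lemma jet_square_minus:
  assumes "smooth_germ \<epsilon>" "\<forall>\<^sub>F u in nhds 0. e u = u ^ Suc j * \<epsilon> u"
  shows "\<forall>\<^sub>F p in nhds 0. jet_size (\<lambda>p. (snd p)\<^sup>2 - e (fst p)) p =
    \<bar>(snd p)\<^sup>2 - e (fst p)\<bar> + \<bar>fst p ^ j * (real (Suc j) * \<epsilon> (fst p) + fst p * deriv \<epsilon> (fst p))\<bar> + 2 * \<bar>snd p\<bar>"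
proof -
  have "\<forall>\<^sub>F u in nhds 0. \<forall>\<^sub>F y in nhds u. y ^ Suc j * \<epsilon> y = e y"
    using assms(2) by (simp only: eventually_eventually) (auto elim: eventually_mono)
  then have "\<forall>\<^sub>F u in nhds 0. (e has_derivative (\<lambda>h. h * (u ^ j * (real (Suc j) * \<epsilon> u + u * deriv \<epsilon> u)))) (at u)"
    using smooth_germ_eventually_DERIV[OF assms(1)]
  proof eventually_elim
    case (elim u)
    have "((\<lambda>u. u ^ Suc j * \<epsilon> u) has_real_derivative u ^ j * (real (Suc j) * \<epsilon> u + u * deriv \<epsilon> u)) (at u)"
      by (rule derivative_eq_intros elim refl)+ (simp add: algebra_simps)
    then show ?case
      by (intro has_derivative_cong_eventually[OF _ elim(1)])
        (simp add: has_field_derivative_def mult.commute[of _ "u ^ j * _"] mult_commute_abs)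
  qed
  from smooth_germ_eventually[OF smooth_germ_fst[OF smooth_germ_id] _ this]
  have "\<forall>\<^sub>F p :: real \<times> real in nhds 0. (e has_derivative (\<lambda>h. h * (fst p ^ j * (real (Suc j) * \<epsilon> (fst p) + fst p * deriv \<epsilon> (fst p))))) (at (fst p))"
    by simp
  then show ?thesis
  proof eventually_elim
    case (elim p)
    have "((\<lambda>p. e (fst p)) has_derivative
        (\<lambda>d. fst d * (fst p ^ j * (real (Suc j) * \<epsilon> (fst p) + fst p * deriv \<epsilon> (fst p))))) (at p)"
      by (rule has_derivative_compose[where f = fst and g = e,
          OF bounded_linear_imp_has_derivative[OF bounded_linear_fst]]) (rule elim)
    moreover have "((\<lambda>p. (snd p)\<^sup>2) has_derivative (\<lambda>d. 2 * snd p * snd d)) (at p)"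
      by (auto intro!: derivative_eq_intros)
    ultimately have "((\<lambda>p. (snd p)\<^sup>2 - e (fst p)) has_derivative
        (\<lambda>d. 2 * snd p * snd d - fst d * (fst p ^ j * (real (Suc j) * \<epsilon> (fst p) + fst p * deriv \<epsilon> (fst p))))) (at p)"
      by (intro has_derivative_diff)
    note D = fun_cong[OF frechet_derivative_at[OF this], symmetric]
    show ?case by (simp add: jet_size_def D abs_mult)
  qed
qed

lemma jet_square_minus_upper:
  assumes "smooth_germ \<epsilon>" "\<forall>\<^sub>F u in nhds 0. e u = u ^ Suc j * \<epsilon> u"
  shows "\<exists>C. \<forall>\<^sub>F u in nhds 0. jet_size (\<lambda>p. (snd p)\<^sup>2 - e (fst p)) (u, 0) \<le> C * \<bar>u\<bar> ^ j"
proof -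
  define a where "a = (\<lambda>u. real (Suc j) * \<epsilon> u + u * deriv \<epsilon> u)"
  have sa: "smooth_germ a" unfolding a_def by (intro smooth_intros smooth_germ_deriv assms)
  have sb: "smooth_germ (\<lambda>u. u * \<epsilon> u)" by (intro smooth_intros assms)
  obtain A where A: "A > 0" "\<forall>\<^sub>F p in nhds 0. \<bar>a p\<bar> \<le> A" using smooth_germ_bounded[OF sa] .
  obtain B where B: "B > 0" "\<forall>\<^sub>F u in nhds 0. \<bar>u * \<epsilon> u\<bar> \<le> B" using smooth_germ_bounded[OF sb] .
  have "\<forall>\<^sub>F u in nhds 0. jet_size (\<lambda>p. (snd p)\<^sup>2 - e (fst p)) (u, 0) \<le> (A + B) * \<bar>u\<bar> ^ j"
    using eventually_axis(1)[OF jet_square_minus[OF assms]] A(2) B(2) assms(2)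
  proof eventually_elim
    case (elim u)
    have "jet_size (\<lambda>p. (snd p)\<^sup>2 - e (fst p)) (u, 0) = \<bar>u\<bar> ^ j * \<bar>u * \<epsilon> u\<bar> + \<bar>u\<bar> ^ j * \<bar>a u\<bar>"
      using elim(1,4) by (simp add: a_def abs_mult power_abs)
    also have "\<dots> \<le> \<bar>u\<bar> ^ j * B + \<bar>u\<bar> ^ j * A"
      using elim by (intro add_mono mult_left_mono) auto
    finally show ?case by (simp add: algebra_simps)
  qed
  then show ?thesis by blast
qed

lemma jet_square_minus_lower:
  assumes "smooth_germ \<epsilon>" "\<epsilon> 0 \<noteq> 0" "\<forall>\<^sub>F u in nhds 0. e u = u ^ Suc j * \<epsilon> u" "j \<ge> 1"
  shows "\<exists>c>0. \<forall>\<^sub>F p in nhds 0. c * norm p ^ j \<le> jet_size (\<lambda>p. (snd p)\<^sup>2 - e (fst p)) p"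
proof -
  define a where "a = (\<lambda>u. \<bar>real (Suc j) * \<epsilon> u + u * deriv \<epsilon> u\<bar>)"
  define b where "b = a 0 / 2"
  define c where "c = min b 1 / 2 ^ j"
  have "b > 0" using assms(2) by (simp add: b_def a_def)
  then have c: "c > 0" by (simp add: c_def)
  have "(a \<longlongrightarrow> a 0) (nhds 0)" unfolding a_def
    by (intro tendsto_intros smooth_germ_tendsto smooth_intros smooth_germ_deriv assms)
  then have "\<forall>\<^sub>F u in nhds 0. a u > b"
    by (rule order_tendstoD) (use \<open>b > 0\<close> in \<open>simp add: b_def\<close>)
  from smooth_germ_eventually[OF smooth_germ_fst[OF smooth_germ_id] _ this]
  have ev: "\<forall>\<^sub>F p :: real \<times> real in nhds 0. a (fst p) > b" by simp
  have ev1: "\<forall>\<^sub>F p :: real \<times> real in nhds 0. \<bar>snd p\<bar> < 1"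
  proof -
    have "\<forall>\<^sub>F p :: real \<times> real in nhds 0. norm p < 1"
      unfolding eventually_nhds_metric by (auto intro!: exI[of _ 1] simp: dist_norm)
    then show ?thesis by eventually_elim (metis norm_snd_le order_le_less_trans prod.collapse real_norm_def)
  qed
  have "\<forall>\<^sub>F p in nhds 0. c * norm p ^ j \<le> jet_size (\<lambda>p. (snd p)\<^sup>2 - e (fst p)) p"
    using jet_square_minus[OF assms(1,3)] ev ev1
  proof eventually_elim
    case (elim p)
    define u t where "u = \<bar>fst p\<bar>" and "t = \<bar>snd p\<bar>"
    have ut: "u \<ge> 0" "t \<ge> 0" "t < 1" using elim by (simp_all add: u_def t_def)
    have "norm p \<le> u + t" using norm_Pair_le[of "fst p" "snd p"] by (simp add: u_def t_def)
    also have "\<dots> \<le> 2 * max u t" by simp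
    finally have "norm p ^ j \<le> (2 * max u t) ^ j" by (intro power_mono) auto
    also have "\<dots> = 2 ^ j * max u t ^ j" by (simp add: power_mult_distrib)
    also have "max u t ^ j \<le> u ^ j + t ^ j" using ut by (simp add: max_def)
    finally have "norm p ^ j \<le> 2 ^ j * (u ^ j + t ^ j)" by simp
    then have "c * norm p ^ j \<le> c * (2 ^ j * (u ^ j + t ^ j))" using c by (intro mult_left_mono) auto
    also have "\<dots> = min b 1 * u ^ j + min b 1 * t ^ j" by (simp add: c_def algebra_simps)
    also have "\<dots> \<le> a (fst p) * u ^ j + 1 * t ^ j"
      using elim(2) ut by (intro add_mono mult_right_mono) auto
    also have "t ^ j \<le> t ^ 1" using ut assms(4) by (intro power_decreasing) auto
    finally have "c * norm p ^ j \<le> a (fst p) * u ^ j + t" by simp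
    also have "\<dots> \<le> jet_size (\<lambda>p. (snd p)\<^sup>2 - e (fst p)) p"
      unfolding elim(1) by (simp add: a_def u_def t_def abs_mult power_abs mult.commute)
    finally show ?case .
  qed
  with c show ?thesis by blast
qed

text \<open>Contact equivalence of \<open>t\<^sup>2 - u\<^sup>2 e(u)\<close> with \<open>v\<^sup>2 - \<delta> u\<^sup>k\<^sup>+\<^sup>1\<close> forces \<open>u\<^sup>2 e(u)\<close> to have order
  \<open>k + 1\<close>: a higher order, possibly infinite, contradicts the lower bound for the jet of the second
  function, and a lower order contradicts its upper bound.\<close>

lemma A_singularity_order:
  fixes e :: "real \<Rightarrow> real"
  assumes e: "smooth_germ e" and \<alpha>: "inverse_germs \<alpha> \<alpha>'"
    and \<omega>: "smooth_germ \<omega>" "smooth_germ \<omega>'" and \<delta>: "\<delta> \<noteq> 0" and k: "k \<ge> 1"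
    and 1: "\<forall>\<^sub>F p in nhds 0. (snd p)\<^sup>2 - (fst p)\<^sup>2 * e (fst p) = \<omega> p * ((snd (\<alpha> p))\<^sup>2 - \<delta> * fst (\<alpha> p) ^ (k + 1))"
    and 2: "\<forall>\<^sub>F p in nhds 0. (snd p)\<^sup>2 - \<delta> * fst p ^ (k + 1) = \<omega>' p * ((snd (\<alpha>' p))\<^sup>2 - (fst (\<alpha>' p))\<^sup>2 * e (fst (\<alpha>' p)))"
  shows "\<exists>\<epsilon>. smooth_germ \<epsilon> \<and> \<epsilon> 0 \<noteq> 0 \<and> (\<forall>\<^sub>F u in nhds 0. e u = u ^ (k - 1) * \<epsilon> u)"
proof -
  define f1 where "f1 = (\<lambda>p :: real \<times> real. (snd p)\<^sup>2 - (\<lambda>u. u\<^sup>2 * e u) (fst p))"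
  define f2 where "f2 = (\<lambda>p :: real \<times> real. (snd p)\<^sup>2 - (\<lambda>u. \<delta> * u ^ (k + 1)) (fst p))"
  have sef: "smooth_germ (\<lambda>p :: real \<times> real. e (fst p))"
    by (rule smooth_germ_compose[OF e]) (auto intro!: smooth_intros)
  have sf: "smooth_germ f1" "smooth_germ f2" unfolding f1_def f2_def
    by (intro smooth_intros sef)+
  have std: "\<forall>\<^sub>F u in nhds 0. \<delta> * u ^ (k + 1) = u ^ Suc k * \<delta>" by simp
  obtain c where c: "c > 0" "\<forall>\<^sub>F p in nhds 0. c * norm p ^ k \<le> jet_size f2 p"
    using jet_square_minus_lower[OF smooth_germ_const \<delta> std k] unfolding f2_def by blast
  obtain C where C: "\<forall>\<^sub>F u in nhds 0. jet_size f2 (u, 0) \<le> C * \<bar>u\<bar> ^ k"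
    using jet_square_minus_upper[OF smooth_germ_const std] unfolding f2_def by blast
  have 1: "\<forall>\<^sub>F p in nhds 0. f1 p = \<omega> p * f2 (\<alpha> p)" and 2: "\<forall>\<^sub>F p in nhds 0. f2 p = \<omega>' p * f1 (\<alpha>' p)"
    using 1 2 by (simp_all add: f1_def f2_def)
  from order_dichotomy[OF e, of k] show ?thesis
  proof
    assume "\<exists>q. smooth_germ q \<and> (\<forall>\<^sub>F x in nhds 0. e x = x ^ k * q x)"
    then obtain q where q: "smooth_germ q" "\<forall>\<^sub>F x in nhds 0. e x = x ^ k * q x" by blast
    have "\<forall>\<^sub>F u in nhds 0. u\<^sup>2 * e u = u ^ Suc (Suc k) * q u"
      using q(2) by eventually_elim (simp add: power2_eq_square)
    from jet_square_minus_upper[OF q(1) this]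
    obtain C' where "\<forall>\<^sub>F u in nhds 0. jet_size f1 (u, 0) \<le> C' * \<bar>u\<bar> ^ Suc k"
      unfolding f1_def by blast
    from jet_order_le[OF sf(1) inverse_germs_sym[OF \<alpha>] \<omega>(2) 2 c this] show ?thesis by simp
  next
    assume "\<exists>i<k. \<exists>q. smooth_germ q \<and> q 0 \<noteq> 0 \<and> (\<forall>\<^sub>F x in nhds 0. e x = x ^ i * q x)"
    then obtain i q where i: "i < k" and q: "smooth_germ q" "q 0 \<noteq> 0" "\<forall>\<^sub>F x in nhds 0. e x = x ^ i * q x"
      by blast
    have "\<forall>\<^sub>F u in nhds 0. u\<^sup>2 * e u = u ^ Suc (Suc i) * q u"
      using q(3) by eventually_elim (simp add: power2_eq_square)
    from jet_square_minus_lower[OF q(1,2) this]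
    obtain c' where c': "c' > 0" "\<forall>\<^sub>F p in nhds 0. c' * norm p ^ Suc i \<le> jet_size f1 p"
      unfolding f1_def by auto
    from jet_order_le[OF sf(2) \<alpha> \<omega>(1) 1 c' C] i have "i = k - 1" by simp
    with q show ?thesis by blast
  qed
qed


section \<open>Height functions\<close>

context umbrella_chart
begin

lemma smooth_height: "smooth_germ (height g w)"
  unfolding height_def[abs_def] by (intro smooth_intros smooth_g)

lemma height_0: "height g w 0 = 0"
  by (simp add: height_def g_0)

lemma nonsingular_height_iff:
  "nonsingular (height g w) \<longleftrightarrow> frechet_derivative H (at 0) (1, 0, 0) \<noteq> 0"
proof -
  interpret l: linear "frechet_derivative H (at 0)" by (rule linear_frechet_derivative[OF smooth_H])
  define su where "su = (\<lambda>p. standard_umbrella (\<phi>' p))"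
  have su: "smooth_germ su" "su 0 = 0" unfolding su_def
    using \<phi>_facts smooth_germ_compose[OF smooth_standard_umbrella] standard_umbrella_0 by auto
  have "(standard_umbrella has_derivative (\<lambda>d. (fst d, 0, 0))) (at 0)"
    unfolding standard_umbrella_def[abs_def] by (auto intro!: derivative_eq_intros)
  then have D: "frechet_derivative standard_umbrella (at 0) = (\<lambda>d. (fst d, 0, 0))"
    using frechet_derivative_at by metis
  have h: "frechet_derivative (height g w) (at 0) d =
    fst (frechet_derivative \<phi>' (at 0) d) * frechet_derivative H (at 0) (1, 0, 0)" for d
  proof -
    have "frechet_derivative (height g w) (at 0) d = frechet_derivative (\<lambda>p. H (su p)) (at 0) d"
      using frechet_derivative_cong_eventually[OF height_eq smooth_height] by (simp add: su_def)
    also have "\<dots> = frechet_derivative H (at 0) (frechet_derivative su (at 0) d)"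
      by (rule frechet_derivative_compose_0[OF smooth_H su])
    also have "frechet_derivative su (at 0) d = (fst (frechet_derivative \<phi>' (at 0) d), 0, 0)"
      unfolding su_def
      by (subst frechet_derivative_compose_0) (use \<phi>_facts smooth_standard_umbrella in \<open>auto simp: D\<close>)
    also have "\<dots> = fst (frechet_derivative \<phi>' (at 0) d) *\<^sub>R (1, 0, 0)" by simp
    finally show ?thesis by (simp only: l.scaleR) simp
  qed
  show ?thesis
  proof
    assume "nonsingular (height g w)"
    then show "frechet_derivative H (at 0) (1, 0, 0) \<noteq> 0" unfolding nonsingular_def h by auto
  next
    assume "frechet_derivative H (at 0) (1, 0, 0) \<noteq> 0"
    moreover have "fst (frechet_derivative \<phi>' (at 0) (frechet_derivative \<phi> (at 0) (1, 0))) = 1"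
      using inverse_germs_frechet_derivative[OF \<phi>] by simp
    ultimately show "nonsingular (height g w)"
      unfolding nonsingular_def h by (intro exI[of _ "frechet_derivative \<phi> (at 0) (1, 0)"]) simp
  qed
qed

subsection \<open>Sections along singular height functions\<close>

text \<open>In suitable coordinates the height function is a unit times \<open>t\<^sup>2 - u\<^sup>2 e(u)\<close> and the section is
  \<open>y\<^sup>2 = x\<^sup>4 e(x)\<close> with the same \<open>e\<close>. The singularity of the height function fixes the order of \<open>e\<close>, and
  a rescaling of \<open>y\<close> alone absorbs the remaining unit.\<close>

lemma A_curve_if_singular_height:
  assumes HZ: "frechet_derivative H (at 0) (0, 0, 1) \<noteq> 0" and k: "k \<ge> 1"
    and A: "A_singularity k (height g w)"
  shows "A_curve (plane w) (k + 2) section_curve"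
proof -
  obtain \<phi>\<^sub>A s e\<^sub>0 where dA: "diffeo_germ \<phi>\<^sub>A" and s: "s \<in> {1, -1 :: real}" and e0: "e\<^sub>0 \<in> {1, -1 :: real}"
    and hA: "\<forall>\<^sub>F p in nhds 0. height g w (\<phi>\<^sub>A p) = s * ((snd p)\<^sup>2 + e\<^sub>0 * fst p ^ (k + 1))"
  proof -
    have "k = 0 \<longleftrightarrow> False" using k by simp
    with A obtain \<phi>\<^sub>A s e\<^sub>0 where "diffeo_germ \<phi>\<^sub>A" "s \<in> {1, -1 :: real}" "e\<^sub>0 \<in> {1, -1 :: real}"
      and h: "\<forall>\<^sub>F (u, v) in nhds 0. height g w (\<phi>\<^sub>A (u, v)) = s * (v\<^sup>2 + e\<^sub>0 * u ^ (k + 1))"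
      unfolding A_singularity_def by (simp only: if_False) blast
    moreover from h have "\<forall>\<^sub>F p in nhds 0. height g w (\<phi>\<^sub>A p) = s * ((snd p)\<^sup>2 + e\<^sub>0 * fst p ^ (k + 1))"
      by (rule eventually_mono) (simp add: split_beta)
    ultimately show ?thesis using that by blast
  qed
  obtain \<psi>\<^sub>A where A: "inverse_germs \<phi>\<^sub>A \<psi>\<^sub>A" using diffeo_germ_imp_inverse_germs[OF dA] .
  note A_facts = A[unfolded inverse_germs_def]
  have s_nz: "s \<noteq> 0" "s * s = 1" using s by auto
  have "\<forall>\<^sub>F p in nhds 0. height g w (\<phi>\<^sub>A (\<psi>\<^sub>A p)) = s * ((snd (\<psi>\<^sub>A p))\<^sup>2 + e\<^sub>0 * fst (\<psi>\<^sub>A p) ^ (k + 1))"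
    using smooth_germ_eventually[of \<psi>\<^sub>A, OF _ _ hA] A_facts by auto
  moreover have "\<forall>\<^sub>F p in nhds 0. \<phi>\<^sub>A (\<psi>\<^sub>A p) = p" using A_facts by auto
  ultimately have h: "\<forall>\<^sub>F p in nhds 0. height g w p = s * ((snd (\<psi>\<^sub>A p))\<^sup>2 + e\<^sub>0 * fst (\<psi>\<^sub>A p) ^ (k + 1))"
    by eventually_elim simp

  \<comment> \<open>As \<open>k \<ge> 1\<close>, the height function is singular, which means \<open>H\<^sub>x(0) = 0\<close>.\<close>
  define f where "f = (\<lambda>p :: real \<times> real. (snd p)\<^sup>2 + e\<^sub>0 * fst p ^ (k + 1))"
  have sf: "smooth_germ f" unfolding f_def by (intro smooth_intros)
  have "frechet_derivative f (at 0) d = 0" for d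
  proof -
    have "(f has_derivative (\<lambda>d. 0)) (at 0)"
      unfolding f_def using k by (auto intro!: derivative_eq_intros)
    then show ?thesis using frechet_derivative_at by metis
  qed
  then have Df: "frechet_derivative (\<lambda>p. f (\<psi>\<^sub>A p)) (at 0) d = 0" for d
    using frechet_derivative_compose_0[OF sf, of \<psi>\<^sub>A] A_facts by simp
  have sf\<psi>: "smooth_germ (\<lambda>p. f (\<psi>\<^sub>A p))" "f (\<psi>\<^sub>A 0) = 0"
    using smooth_germ_compose[OF sf, of \<psi>\<^sub>A] A_facts by (auto simp: f_def)
  have "frechet_derivative (height g w) (at 0) d = 0" for d
  proof -
    have "frechet_derivative (height g w) (at 0) d = frechet_derivative (\<lambda>p. s * f (\<psi>\<^sub>A p)) (at 0) d"
      using frechet_derivative_cong_eventually[OF h smooth_height] by (simp add: f_def)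
    then show ?thesis using frechet_derivative_mult_0[OF smooth_germ_const sf\<psi>(1)] Df by simp
  qed
  then have HX: "frechet_derivative H (at 0) (1, 0, 0) = 0"
    using nonsingular_height_iff by (simp add: nonsingular_def)

  define m where "m = (\<lambda>p :: real \<times> real \<times> real. (fst (snd p), snd (snd p), fst p))"
  have blm: "bounded_linear m" unfolding m_def
    by (intro bounded_linear_Pair bounded_linear_fst bounded_linear_compose[OF bounded_linear_fst]
        bounded_linear_compose[OF bounded_linear_snd] bounded_linear_snd)
  have sm: "smooth_germ m" "m 0 = 0"
    unfolding m_def by (auto intro!: smooth_intros simp: zero_prod_def)
  define F where "F = (\<lambda>p. H (m p))"
  have DF: "frechet_derivative F (at 0) d = frechet_derivative H (at 0) (m d)" for d
    unfolding F_def frechet_derivative_compose_0[OF smooth_H sm] frechet_derivative_bounded_linear[OF blm] ..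
  have sF: "smooth_germ F" "F 0 = 0"
    unfolding F_def using smooth_germ_compose[OF smooth_H sm] sm H_0 by auto
  have "frechet_derivative F (at 0) (1, 0) \<noteq> 0"
    unfolding DF using HZ by (simp add: m_def zero_prod_def)
  from preparation_degree_1[OF sF this]
  obtain Q \<omega> where Q: "smooth_germ Q" "Q 0 = 0" and \<omega>: "smooth_germ \<omega>" "\<omega> 0 \<noteq> 0"
    and eq: "\<forall>\<^sub>F p in nhds 0. fst p - Q (snd p) = \<omega> p * F p" by blast
  have \<omega>_nz: "\<forall>\<^sub>F p in nhds 0. \<omega> p \<noteq> 0" using smooth_germ_eventually_nonzero[OF \<omega>] .
  have graph: "\<forall>\<^sub>F p in nhds 0. F p = 0 \<longleftrightarrow> fst p = Q (snd p)"
    using eq \<omega>_nz by eventually_elim auto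
  have QX: "frechet_derivative Q (at 0) (1, 0) = 0"
    by (rule preparation_derivative[OF Q(1) \<omega>(1) sF eq]) (use HX in \<open>simp add: DF m_def\<close>)
  obtain \<nu> e R where \<nu>: "smooth_germ \<nu>" and e: "smooth_germ e" and R: "smooth_germ R"
    and expand: "\<forall>\<^sub>F p in nhds 0. Q (fst p, (fst p)\<^sup>2 * \<nu> (fst p) + snd p) =
       (fst p)\<^sup>2 * (e (fst p) + (\<nu> (fst p))\<^sup>2) + 2 * \<nu> (fst p) * snd p + (snd p)\<^sup>2 * R p"
    using critical_expansion[OF Q QX] by blast
  define M where "M = (\<lambda>p :: real \<times> real. 1 - (fst p)\<^sup>2 * R p)"
  have M: "smooth_germ M" "M 0 = 1" unfolding M_def by (auto intro!: smooth_intros R)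
  have M_pos: "\<forall>\<^sub>F p in nhds 0. M p > 0"
    by (rule smooth_germ_eventually_greater[OF M(1)]) (simp add: M)
  have s\<nu>f: "smooth_germ (\<lambda>p :: real \<times> real. \<nu> (fst p))"
    by (intro smooth_germ_compose[OF \<nu>] smooth_intros) simp
  have s\<nu>s: "smooth_germ (\<lambda>p :: real \<times> real. \<nu> (snd p))"
    by (intro smooth_germ_compose[OF \<nu>] smooth_intros) simp

  \<comment> \<open>Source coordinates in which the function \<open>v\<^sup>2 - Q(u, u v)\<close> becomes \<open>t\<^sup>2 - u\<^sup>2 e(u)\<close>.\<close>
  define a where "a = (\<lambda>p :: real \<times> real. (snd p, snd p * (fst p - snd p * \<nu> (snd p))))"
  have sa: "smooth_germ a" "a 0 = 0" unfolding a_def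
    by (auto intro!: smooth_intros s\<nu>s simp: zero_prod_def)
  define \<theta> where "\<theta> = (\<lambda>p :: real \<times> real. (fst p - snd p * \<nu> (snd p)) * sqrt (M (a p)))"
  have s\<theta>: "smooth_germ \<theta>" "\<theta> 0 = 0" unfolding \<theta>_def
    using smooth_germ_compose[OF M(1) sa] sa(2) M(2) by (auto intro!: smooth_intros s\<nu>s)
  have "\<forall>\<^sub>F t in nhds 0. \<theta> (t *\<^sub>R (1, 0)) = t * 1" by (simp add: \<theta>_def a_def M_def)
  from frechet_derivative_along_line[OF s\<theta>(1) smooth_germ_const this]
  have D\<theta>: "frechet_derivative \<theta> (at 0) (1, 0) \<noteq> 0" by simp
  obtain \<psi> where "inverse_germs (\<lambda>z. (\<theta> z, snd z)) \<psi>"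
    using inverse_germs_first_coordinate[OF s\<theta> D\<theta>] by blast
  from inverse_germs_compose[OF inverse_germs_compose[OF inverse_germs_swap this] inverse_germs_swap]
  obtain \<beta>' where \<beta>: "inverse_germs (\<lambda>p. (fst p, \<theta> (snd p, fst p))) \<beta>'" by auto
  define \<beta> where "\<beta> = (\<lambda>p :: real \<times> real. (fst p, \<theta> (snd p, fst p)))"
  have \<beta>: "inverse_germs \<beta> \<beta>'" using \<beta> by (simp add: \<beta>_def)
  note \<beta>_facts = \<beta>[unfolded inverse_germs_def]
  define f0 where "f0 = (\<lambda>p :: real \<times> real. (snd p)\<^sup>2 - (fst p)\<^sup>2 * e (fst p))"
  define su where "su = (\<lambda>p :: real \<times> real. ((snd p)\<^sup>2, fst p, fst p * snd p))"
  have ssu: "smooth_germ su" "su 0 = 0" unfolding su_def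
    by (auto intro!: smooth_intros simp: zero_prod_def)
  have sas: "smooth_germ (\<lambda>p :: real \<times> real. a (snd p, fst p))"
    by (rule smooth_germ_compose[OF sa(1)]) (auto intro!: smooth_intros simp: zero_prod_def)
  have sas0: "a (snd (0 :: real \<times> real), fst (0 :: real \<times> real)) = 0"
    using sa(2) by (simp add: zero_prod_def)
  have h\<phi>: "\<forall>\<^sub>F p in nhds 0. height g w (\<phi> p) = s * ((snd (\<psi>\<^sub>A (\<phi> p)))\<^sup>2 + e\<^sub>0 * fst (\<psi>\<^sub>A (\<phi> p)) ^ (k + 1))"
    using smooth_germ_eventually[of \<phi>, OF _ _ h] \<phi>_facts by auto
  have f0_\<beta>: "\<forall>\<^sub>F p in nhds 0. f0 (\<beta> p) = \<omega> (su p) * (s * f (\<psi>\<^sub>A (\<phi> p)))"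
    using smooth_germ_eventually[OF sas sas0 eventually_conj[OF expand M_pos]]
      smooth_germ_eventually[OF ssu eq] height_\<phi> h\<phi>
  proof eventually_elim
    case (elim p)
    define u v n where d: "u = fst p" "v = snd p" "n = \<nu> u"
    define t where "t = v - u * n"
    have a: "a (snd p, fst p) = (u, u * t)" by (simp add: a_def d t_def)
    have "f0 (\<beta> p) = t\<^sup>2 * M (u, u * t) - u\<^sup>2 * e u"
      using elim(1) a by (simp add: f0_def \<beta>_def \<theta>_def d(1)[symmetric] power_mult_distrib)
        (simp add: d t_def)
    moreover have "Q (u, u * v) = u\<^sup>2 * (e u + n\<^sup>2) + 2 * n * (u * t) + (u * t)\<^sup>2 * R (u, u * t)"
    proof -
      have "u * v = u\<^sup>2 * n + u * t" by (simp add: t_def power2_eq_square algebra_simps)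
      with elim(1) a show ?thesis by (simp add: d(3))
    qed
    moreover have "v = u * n + t" by (simp add: t_def)
    ultimately have "f0 (\<beta> p) = v\<^sup>2 - Q (u, u * v)"
      by (simp add: M_def power2_eq_square algebra_simps)
    also have "\<dots> = \<omega> (su p) * H (standard_umbrella p)"
      using elim(2) by (simp add: su_def F_def m_def standard_umbrella_def d)
    also have "H (standard_umbrella p) = s * f (\<psi>\<^sub>A (\<phi> p))"
      using elim(3,4) by (simp add: f_def)
    finally show ?case .
  qed
  define \<alpha> where "\<alpha> = (\<lambda>q. \<psi>\<^sub>A (\<phi> (\<beta>' q)))"
  define \<alpha>' where "\<alpha>' = (\<lambda>p. \<beta> (\<phi>' (\<phi>\<^sub>A p)))"
  have \<alpha>: "inverse_germs \<alpha> \<alpha>'" unfolding \<alpha>_def \<alpha>'_def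
    using inverse_germs_compose[OF inverse_germs_sym[OF \<beta>] inverse_germs_compose[OF \<phi> inverse_germs_sym[OF A]]] .
  note \<alpha>_facts = \<alpha>[unfolded inverse_germs_def]
  define \<omega>\<^sub>1 where "\<omega>\<^sub>1 = (\<lambda>q. \<omega> (su (\<beta>' q)) * s)"
  have s\<omega>1: "smooth_germ \<omega>\<^sub>1" "\<omega>\<^sub>1 0 \<noteq> 0" unfolding \<omega>\<^sub>1_def
    using \<omega> \<beta>_facts ssu s_nz
    by (auto intro!: smooth_intros smooth_germ_compose[OF \<omega>(1)] smooth_germ_compose[OF ssu(1)])
  have 1: "\<forall>\<^sub>F q in nhds 0. f0 q = \<omega>\<^sub>1 q * f (\<alpha> q)"
  proof -
    have "\<forall>\<^sub>F q in nhds 0. f0 (\<beta> (\<beta>' q)) = \<omega> (su (\<beta>' q)) * (s * f (\<psi>\<^sub>A (\<phi> (\<beta>' q))))"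
      using smooth_germ_eventually[of \<beta>', OF _ _ f0_\<beta>] \<beta>_facts by auto
    moreover have "\<forall>\<^sub>F q in nhds 0. \<beta> (\<beta>' q) = q" using \<beta>_facts by auto
    ultimately show ?thesis by eventually_elim (simp add: \<omega>\<^sub>1_def \<alpha>_def)
  qed
  have 2: "\<forall>\<^sub>F p in nhds 0. f p = 1 / \<omega>\<^sub>1 (\<alpha>' p) * f0 (\<alpha>' p)"
  proof -
    have "\<forall>\<^sub>F p in nhds 0. f0 (\<alpha>' p) = \<omega>\<^sub>1 (\<alpha>' p) * f (\<alpha> (\<alpha>' p)) \<and> \<omega>\<^sub>1 (\<alpha>' p) \<noteq> 0"
      using smooth_germ_eventually[of \<alpha>', OF _ _ eventually_conj[OF 1 smooth_germ_eventually_nonzero[OF s\<omega>1]]] \<alpha>_facts by auto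
    moreover have "\<forall>\<^sub>F p in nhds 0. \<alpha> (\<alpha>' p) = p" using \<alpha>_facts by auto
    ultimately show ?thesis by eventually_elim simp
  qed
  have s\<omega>2: "smooth_germ (\<lambda>p. 1 / \<omega>\<^sub>1 (\<alpha>' p))"
    using \<alpha>_facts s\<omega>1 by (intro smooth_intros smooth_germ_compose[OF s\<omega>1(1)]) auto
  have "- e\<^sub>0 \<noteq> 0" using e0 by auto
  from A_singularity_order[OF e \<alpha> s\<omega>1(1) s\<omega>2 this k] 1 2
  obtain \<epsilon> where \<epsilon>: "smooth_germ \<epsilon>" "\<epsilon> 0 \<noteq> 0" "\<forall>\<^sub>F u in nhds 0. e u = u ^ (k - 1) * \<epsilon> u"
    by (auto simp: f0_def f_def)

  \<comment> \<open>The section is \<open>y\<^sup>2 M = x\<^sup>k\<^sup>+\<^sup>3 \<epsilon>(x)\<close>; the sign \<open>s\<^sub>1\<close> of \<open>\<epsilon>\<close> survives the rescaling of \<open>y\<close>.\<close>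
  define s\<^sub>1 where "s\<^sub>1 = sgn (\<epsilon> 0)"
  have s1: "s\<^sub>1 = 1 \<or> s\<^sub>1 = - 1" using \<epsilon>(2) by (auto simp: s\<^sub>1_def sgn_if)
  define \<epsilon>' where "\<epsilon>' = (\<lambda>u. s\<^sub>1 * \<epsilon> u)"
  have \<epsilon>': "smooth_germ \<epsilon>'" "\<epsilon>' 0 > 0" unfolding \<epsilon>'_def s\<^sub>1_def
    using \<epsilon> by (auto intro!: smooth_intros simp: sgn_if)
  have \<epsilon>'_pos: "\<forall>\<^sub>F u in nhds 0. \<epsilon>' u > 0" by (rule smooth_germ_eventually_greater[OF \<epsilon>'])
  define \<Theta> where "\<Theta> = (\<lambda>p :: real \<times> real. fst p * sqrt (M (snd p, fst p) / \<epsilon>' (snd p)))"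
  have sMs: "smooth_germ (\<lambda>p :: real \<times> real. M (snd p, fst p))"
    by (intro smooth_germ_compose[OF M(1)] smooth_intros) (simp add: zero_prod_def)
  have s\<epsilon>'s: "smooth_germ (\<lambda>p :: real \<times> real. \<epsilon>' (snd p))"
    by (intro smooth_germ_compose[OF \<epsilon>'(1)] smooth_intros) simp
  have M00: "M (0, y) = 1" for y by (simp add: M_def)
  have s\<Theta>: "smooth_germ \<Theta>" "\<Theta> 0 = 0" unfolding \<Theta>_def
    using \<epsilon>'(2) by (auto intro!: smooth_germ_mult smooth_germ_sqrt smooth_germ_divide smooth_germ_fst smooth_germ_id sMs s\<epsilon>'s simp: M00)
  have "\<forall>\<^sub>F t in nhds 0. \<Theta> (t *\<^sub>R (1, 0)) = t * sqrt (1 / \<epsilon>' 0)" by (simp add: \<Theta>_def M00)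
  from frechet_derivative_along_line[OF s\<Theta>(1) smooth_germ_const this]
  have D\<Theta>: "frechet_derivative \<Theta> (at 0) (1, 0) \<noteq> 0" using \<epsilon>'(2) by simp
  obtain \<psi>\<^sub>2 where "inverse_germs (\<lambda>z. (\<Theta> z, snd z)) \<psi>\<^sub>2"
    using inverse_germs_first_coordinate[OF s\<Theta> D\<Theta>] by blast
  note \<Theta>_inv = inverse_germs_compose[OF inverse_germs_compose[OF inverse_germs_swap this] inverse_germs_swap]
  define sh where "sh = (\<lambda>p :: real \<times> real. (fst p, snd p - (fst p)\<^sup>2 * \<nu> (fst p)))"
  have ssh: "smooth_germ sh" "sh 0 = 0" unfolding sh_def
    by (auto intro!: smooth_intros s\<nu>f simp: zero_prod_def)
  have sh: "inverse_germs sh (\<lambda>p. (fst p, snd p + (fst p)\<^sup>2 * \<nu> (fst p)))"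
    unfolding inverse_germs_def using ssh
    by (auto intro!: smooth_intros s\<nu>f simp: zero_prod_def sh_def)
  obtain \<kappa>' where \<kappa>: "inverse_germs (\<lambda>p. (fst (sh p), \<Theta> (snd (sh p), fst (sh p)))) \<kappa>'"
    using inverse_germs_compose[OF sh \<Theta>_inv] by auto
  define \<sigma> where "\<sigma> = (\<lambda>p :: real \<times> real. m (Q p, p))"
  have sQp: "smooth_germ (\<lambda>p. (Q p, p))" "(Q 0, 0 :: real \<times> real) = 0"
    using Q by (auto intro!: smooth_intros simp: zero_prod_def)
  have s\<sigma>: "smooth_germ \<sigma>" "\<sigma> 0 = 0"
    using smooth_germ_compose[OF sm(1) sQp] Q by (auto simp: \<sigma>_def m_def zero_prod_def)
  define pr where "pr = (\<lambda>x :: real \<times> real \<times> real. (fst x, fst (snd x)))"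
  have spr: "smooth_germ pr" "pr 0 = 0" by (auto simp: pr_def zero_prod_def intro!: smooth_intros)
  have s_fst: "smooth_germ (\<lambda>p :: real \<times> real. fst p)" "fst (0 :: real \<times> real) = 0"
    by (auto intro!: smooth_intros)
  have Z: "\<forall>\<^sub>F p in nhds 0. \<sigma> p \<in> standard_umbrella_image \<longleftrightarrow>
      (fst (sh p), \<Theta> (snd (sh p), fst (sh p))) \<in> {(x, y). y\<^sup>2 - s\<^sub>1 * x ^ (k + 2 + 1) = 0}"
    using smooth_germ_eventually[OF ssh eventually_conj[OF expand M_pos]]
      smooth_germ_eventually[OF s_fst eventually_conj[OF \<epsilon>(3) \<epsilon>'_pos]]
  proof eventually_elim
    case (elim p)
    define x Y y n E where d: "x = fst p" "Y = snd p" "y = snd (sh p)" "n = \<nu> (fst p)" "E = \<epsilon>' x"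
    define \<rho> where "\<rho> = \<Theta> (y, x)"
    have p: "p = (x, Y)" "sh p = (x, y)" by (simp_all add: d sh_def)
    have Y: "Y = x\<^sup>2 * n + y" by (simp add: d sh_def)
    have E: "E > 0" using elim(2) by (simp add: d)
    have Mp: "M (x, y) > 0" using elim(1) p by simp
    have "Q p = x\<^sup>2 * (e x + n\<^sup>2) + 2 * n * y + y\<^sup>2 * R (x, y)"
    proof -
      have "n = \<nu> x" by (simp add: d)
      moreover have "Q p = Q (x, x\<^sup>2 * n + y)" using p(1) Y by simp
      ultimately show ?thesis using elim(1) unfolding p(2) by simp
    qed
    then have "Y\<^sup>2 - x\<^sup>2 * Q p = y\<^sup>2 * M (x, y) - x ^ 4 * e x"
      unfolding Y M_def by (simp add: power2_eq_square power4_eq_xxxx algebra_simps)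
    also have "y\<^sup>2 * M (x, y) = E * \<rho>\<^sup>2"
      using E Mp by (simp add: \<rho>_def \<Theta>_def d(5) power_mult_distrib)
    also have "x ^ 4 * e x = E * (s\<^sub>1 * x ^ (k + 2 + 1))"
    proof -
      have "k + 2 + 1 = 4 + (k - 1)" using k by simp
      then have "x ^ (k + 2 + 1) = x ^ 4 * x ^ (k - 1)" by (metis power_add)
      then show ?thesis using elim(2) s1 by (auto simp: d \<epsilon>'_def)
    qed
    finally have "Y\<^sup>2 - x\<^sup>2 * Q p = E * (\<rho>\<^sup>2 - s\<^sub>1 * x ^ (k + 2 + 1))" by (simp add: algebra_simps)
    then have "Y\<^sup>2 = x\<^sup>2 * Q p \<longleftrightarrow> \<rho>\<^sup>2 - s\<^sub>1 * x ^ (k + 2 + 1) = 0"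
      using E by (metis less_irrefl mult_eq_0_iff right_minus_eq)
    moreover have "Q p \<ge> 0" if *: "Y\<^sup>2 = x\<^sup>2 * Q p"
    proof (cases "x = 0")
      case True
      then have "p = 0" using * p by (simp add: zero_prod_def)
      then show ?thesis using Q by simp
    next
      case False
      then show ?thesis using * zero_le_power2[of Y] by (simp add: zero_le_mult_iff)
    qed
    ultimately show ?case
      by (auto simp: \<sigma>_def m_def standard_umbrella_image_def split_beta \<rho>_def d sh_def)
  qed
  have main: "diffeomorphic_in_plane (plane w) {(x, y). y\<^sup>2 - s\<^sub>1 * x ^ (k + 2 + 1) = 0} section_curve"
  proof (rule diffeomorphic_in_plane_section_curve[OF s\<sigma> spr _ _ _ \<kappa> Z])
    show "\<forall>\<^sub>F p in nhds 0. pr (\<sigma> p) = p" by (simp add: pr_def \<sigma>_def m_def)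
    show "\<forall>\<^sub>F p in nhds 0. H (\<sigma> p) = 0"
      using smooth_germ_eventually[OF sQp graph] by eventually_elim (simp add: F_def \<sigma>_def)
    have "smooth_germ (\<lambda>x. (snd (snd x), fst x, fst (snd x)))" by (intro smooth_intros)
    from smooth_germ_eventually[OF this _ graph]
    show "\<forall>\<^sub>F x in nhds 0. H x = 0 \<longrightarrow> \<sigma> (pr x) = x"
      by (auto simp: F_def \<sigma>_def m_def pr_def zero_prod_def elim!: eventually_mono)
  qed
  from s1 show ?thesis
  proof
    assume "s\<^sub>1 = 1"
    then have "y\<^sup>2 - s\<^sub>1 * x ^ (k + 2 + 1) = y\<^sup>2 - x ^ (k + 2 + 1)" for x y by simp
    with main show ?thesis unfolding A_curve_def by (simp only: simp_thms)
  next
    assume "s\<^sub>1 = - 1"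
    then have "y\<^sup>2 - s\<^sub>1 * x ^ (k + 2 + 1) = y\<^sup>2 + x ^ (k + 2 + 1)" for x y by simp
    with main show ?thesis unfolding A_curve_def by (simp only: simp_thms)
  qed
qed

end

section \<open>The double point locus\<close>

lemma parameterizes_locus_germ:
  assumes "parameterizes_locus b \<gamma> D"
  shows "smooth_germ \<gamma>" "\<gamma> 0 = 0" "frechet_derivative \<gamma> (at 0) 1 = (0, 1)"
    "\<forall>\<^sub>F v in nhds 0. snd (\<gamma> v) = v" "\<exists>B. \<forall>\<^sub>F v in nhds 0. \<bar>fst (\<gamma> v)\<bar> \<le> B * \<bar>v\<bar>\<^sup>2"
    "\<forall>\<^sub>F v in nhds 0. \<gamma> v \<in> D"
proof -
  note p = assms[unfolded parameterizes_locus_def]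
  show s: "smooth_germ \<gamma>" using p by blast
  show snd: "\<forall>\<^sub>F v in nhds 0. snd (\<gamma> v) = v" using p by blast
  obtain C where C: "C > 0" "\<forall>\<^sub>F v in nhds 0. \<bar>fst (\<gamma> v) - (- b / 6 * v\<^sup>2)\<bar> \<le> C * \<bar>v ^ 3\<bar>"
    using p by (auto simp: bigo_def)
  have fst0: "fst (\<gamma> 0) = 0" using eventually_nhds_x_imp_x[OF C(2)] by simp
  show \<gamma>0: "\<gamma> 0 = 0" using fst0 eventually_nhds_x_imp_x[OF snd] by (simp add: prod_eq_iff)
  have "\<forall>\<^sub>F v :: real in nhds 0. \<bar>v\<bar> < 1"
    unfolding eventually_nhds_metric by (auto intro!: exI[of _ 1] simp: dist_norm)
  with C(2) have B: "\<forall>\<^sub>F v in nhds 0. \<bar>fst (\<gamma> v)\<bar> \<le> (\<bar>b\<bar> / 6 + C) * \<bar>v\<bar>\<^sup>2"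
  proof eventually_elim
    case (elim v)
    have "\<bar>v ^ 3\<bar> \<le> \<bar>v\<bar>\<^sup>2" unfolding power_abs using elim(2) by (intro power_decreasing) auto
    then have "C * \<bar>v ^ 3\<bar> \<le> C * \<bar>v\<bar>\<^sup>2" using C(1) by (intro mult_left_mono) auto
    moreover have "\<bar>fst (\<gamma> v)\<bar> \<le> \<bar>fst (\<gamma> v) - (- b / 6 * v\<^sup>2)\<bar> + \<bar>- b / 6 * v\<^sup>2\<bar>" by linarith
    moreover have "\<bar>- b / 6 * v\<^sup>2\<bar> = \<bar>b\<bar> / 6 * \<bar>v\<bar>\<^sup>2" by (simp add: abs_mult)
    ultimately show ?case using elim(1) by (simp add: algebra_simps)
  qed
  then show "\<exists>B. \<forall>\<^sub>F v in nhds 0. \<bar>fst (\<gamma> v)\<bar> \<le> B * \<bar>v\<bar>\<^sup>2" by blast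
  have sf: "smooth_germ (\<lambda>v. fst (\<gamma> v))" "smooth_germ (\<lambda>v. snd (\<gamma> v))" by (intro smooth_intros s)+
  obtain c where c: "smooth_germ c" "\<forall>\<^sub>F v in nhds 0. fst (\<gamma> v) = v * c v"
    using hadamard_real[OF sf(1)] fst0 by auto
  have "\<forall>\<^sub>F v in nhds 0. \<bar>v ^ 1 * c v\<bar> \<le> (\<bar>b\<bar> / 6 + C) * \<bar>v\<bar> ^ Suc 1"
    using B c(2) by eventually_elim (simp add: power2_eq_square)
  from leading_coefficient_zero[OF c(1) this] have "c 0 = 0" .
  have "frechet_derivative (\<lambda>v. fst (\<gamma> v)) (at 0) 1 = 0"
    using frechet_derivative_along_line[OF sf(1) c(1), of 1] c(2) \<open>c 0 = 0\<close> by simp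
  moreover have "frechet_derivative (\<lambda>v. snd (\<gamma> v)) (at 0) 1 = 1"
    using frechet_derivative_along_line[OF sf(2) smooth_germ_const, of 1 1] snd by simp
  moreover have "frechet_derivative (\<lambda>v. fst (\<gamma> v)) (at 0) 1 = fst (frechet_derivative \<gamma> (at 0) 1)"
    "frechet_derivative (\<lambda>v. snd (\<gamma> v)) (at 0) 1 = snd (frechet_derivative \<gamma> (at 0) 1)"
    using frechet_derivative_compose_0[OF smooth_germ_fst[OF smooth_germ_id] s \<gamma>0, of 1]
      frechet_derivative_compose_0[OF smooth_germ_snd[OF smooth_germ_id] s \<gamma>0, of 1]
    by (simp_all add: frechet_derivative_bounded_linear bounded_linear_fst bounded_linear_snd)
  ultimately show "frechet_derivative \<gamma> (at 0) 1 = (0, 1)" by (simp add: prod_eq_iff)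
  have "\<forall>\<^sub>F r in at_right (0 :: real). 0 < r \<and> germ_eq (\<gamma> ` (UNIV \<inter> ball 0 r)) D"
    using p eventually_at_right_less[of "0 :: real"] by (auto simp: germ_image_def eventually_conj_iff)
  then obtain r where r: "r > 0" "germ_eq (\<gamma> ` (UNIV \<inter> ball 0 r)) D"
    using eventually_happens' trivial_limit_at_right_real by blast
  have "\<forall>\<^sub>F v in nhds 0. \<gamma> v \<in> \<gamma> ` (UNIV \<inter> ball 0 r) \<longleftrightarrow> \<gamma> v \<in> D"
    using smooth_germ_eventually[OF s \<gamma>0 r(2)[unfolded germ_eq_def]] .
  moreover have "\<forall>\<^sub>F v :: real in nhds 0. v \<in> ball 0 r" using r(1) by (intro eventually_nhds_in_open) auto
  ultimately show "\<forall>\<^sub>F v in nhds 0. \<gamma> v \<in> D" by eventually_elim auto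
qed

context umbrella_chart
begin

text \<open>Two points of the standard umbrella coincide only on the axis \<open>u = 0\<close>, so in the source coordinates
  of the chart the double point locus lies on this axis.\<close>

lemma double_point_locus_on_axis:
  assumes "double_point_locus g D"
  shows "\<forall>\<^sub>F p in nhds 0. p \<in> D \<longrightarrow> fst (\<phi>' p) = 0"
proof -
  have su: "smooth_germ (\<lambda>p. standard_umbrella (\<phi>' p))" "standard_umbrella (\<phi>' 0) = 0"
    using \<phi>_facts smooth_germ_compose[OF smooth_standard_umbrella] standard_umbrella_0 by auto
  have "\<forall>\<^sub>F p in nhds 0. \<Psi>' (\<Psi> (standard_umbrella (\<phi>' p))) = standard_umbrella (\<phi>' p)"
    using smooth_germ_eventually[OF su, of "\<lambda>x. \<Psi>' (\<Psi> x) = x"] \<Psi>_facts by auto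
  moreover have "\<forall>\<^sub>F p in nhds 0. \<phi> (\<phi>' p) = p" using \<phi>_facts by auto
  ultimately have "\<forall>\<^sub>F p in nhds 0. \<Psi>' (g p) = standard_umbrella (\<phi>' p) \<and> \<phi> (\<phi>' p) = p"
    using g_eq by eventually_elim simp
  then obtain \<delta> where \<delta>: "\<delta> > 0"
    "\<And>p. norm p < \<delta> \<Longrightarrow> \<Psi>' (g p) = standard_umbrella (\<phi>' p) \<and> \<phi> (\<phi>' p) = p"
    unfolding eventually_nhds_metric by (auto simp: dist_norm)
  have "smooth_germ \<phi>'" using \<phi>_facts by auto
  then obtain S where S: "open S" "0 \<in> S" "\<And>k. Ck_on k S \<phi>'" unfolding smooth_germ_iff by blast
  have dp: "fst (\<phi>' p) = 0" if "p \<in> double_points g (ball 0 r)" "r < \<delta>" for p r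
  proof -
    have "p \<in> ball 0 r \<and> (\<exists>q\<in>ball 0 r. q \<noteq> p \<and> g p = g q)"
      using that(1) unfolding double_points_def by blast
    then obtain q where "q \<in> ball 0 r" "p \<in> ball 0 r" and q: "q \<noteq> p" "g p = g q" by blast
    then have q: "q \<noteq> p" "g p = g q" "norm p < \<delta>" "norm q < \<delta>" using that(2) by auto
    have eq: "standard_umbrella (\<phi>' p) = standard_umbrella (\<phi>' q)" and ne: "\<phi>' p \<noteq> \<phi>' q"
      using \<delta>(2)[OF q(3)] \<delta>(2)[OF q(4)] q by metis+
    show ?thesis
    proof (rule ccontr)
      assume "fst (\<phi>' p) \<noteq> 0"
      then have "\<phi>' p = \<phi>' q" using eq by (auto simp: standard_umbrella_def prod_eq_iff)
      with ne show False by simp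
    qed
  qed
  have "\<forall>\<^sub>F r in at_right 0. r < \<delta>" using \<delta>(1) eventually_at_right_field by blast
  then have "\<forall>\<^sub>F r in at_right 0. r < \<delta> \<and> germ_eq D (closure (double_points g (ball 0 r)))"
    using assms unfolding double_point_locus_def by eventually_elim simp
  then obtain r where r: "r < \<delta>" "germ_eq D (closure (double_points g (ball 0 r)))"
    using eventually_happens' trivial_limit_at_right_real by blast
  define T where "T = (\<lambda>p. fst (\<phi>' p)) -` (- {0}) \<inter> S"
  have "continuous_on S (\<lambda>p. fst (\<phi>' p))" using Ck_on_continuous[OF S(3)] by (intro continuous_intros)
  then have "open T" unfolding T_def using continuous_on_open_vimage[OF S(1)] by blast
  moreover have "T \<inter> double_points g (ball 0 r) = {}" using dp r(1) by (auto simp: T_def)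
  ultimately have "T \<inter> closure (double_points g (ball 0 r)) = {}" by (simp add: open_Int_closure_eq_empty)
  then have cl: "fst (\<phi>' p) = 0" if "p \<in> S" "p \<in> closure (double_points g (ball 0 r))" for p
    using that by (auto simp: T_def)
  show ?thesis
    using r(2)[unfolded germ_eq_def] eventually_nhds_in_open[OF S(1,2)]
    by eventually_elim (use cl in blast)
qed

lemma order_ge_2:
  assumes q: "smooth_germ q" "q 0 \<noteq> 0" "\<forall>\<^sub>F t in nhds 0. H (0, 0, t) = t ^ k * q t" "k \<ge> 1"
    and HZ: "frechet_derivative H (at 0) (0, 0, 1) = 0"
  shows "k \<ge> 2"
proof (rule ccontr)
  assume "\<not> k \<ge> 2"
  then have "k = 1" using q(4) by simp
  then have "\<forall>\<^sub>F t in nhds 0. H (t *\<^sub>R (0, 0, 1)) = t * q t" using q(3) by simp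
  from frechet_derivative_along_line[OF smooth_H q(1) this] show False using HZ q(2) by simp
qed

context
  fixes D :: "(real \<times> real) set" and \<gamma> :: "real \<Rightarrow> real \<times> real" and b :: real
  assumes D: "double_point_locus g D" and \<gamma>: "parameterizes_locus b \<gamma> D"
begin

lemmas \<gamma>_germ = parameterizes_locus_germ[OF \<gamma>]

text \<open>As \<open>\<gamma>\<close> has velocity \<open>(0, 1)\<close> at the origin and \<open>\<phi>'\<close> is a diffeomorphism, the pulled back parameter
  \<open>v \<theta>(v)\<close> on the axis is again a regular one. All orders along \<open>\<gamma>\<close> therefore equal orders in the
  coordinate of the axis.\<close>

lemma locus_in_chart:
  "\<exists>\<theta>. smooth_germ \<theta> \<and> \<theta> 0 \<noteq> 0 \<and> (\<forall>\<^sub>F v in nhds 0. \<phi>' (\<gamma> v) = (0, v * \<theta> v)) \<and>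
     frechet_derivative \<phi>' (at 0) (0, 1) = (0, \<theta> 0)"
proof -
  define \<kappa> where "\<kappa> = (\<lambda>v. \<phi>' (\<gamma> v))"
  have \<kappa>: "smooth_germ \<kappa>" "\<kappa> 0 = 0"
    unfolding \<kappa>_def using \<phi>_facts \<gamma>_germ smooth_germ_compose[of \<phi>' \<gamma>] by auto
  have sf: "smooth_germ (\<lambda>v. fst (\<kappa> v))" "smooth_germ (\<lambda>v. snd (\<kappa> v))" by (intro smooth_intros \<kappa>)+
  have fst: "\<forall>\<^sub>F v in nhds 0. fst (\<kappa> v) = 0"
    using smooth_germ_eventually[OF \<gamma>_germ(1,2) double_point_locus_on_axis[OF D]] \<gamma>_germ(6)
    by eventually_elim (simp add: \<kappa>_def)
  obtain \<theta> where \<theta>: "smooth_germ \<theta>" "\<forall>\<^sub>F v in nhds 0. snd (\<kappa> v) = v * \<theta> v"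
    using hadamard_real[OF sf(2)] \<kappa>(2) by auto
  have "frechet_derivative (\<lambda>v. fst (\<kappa> v)) (at 0) 1 = 0"
    using frechet_derivative_along_line[OF sf(1) smooth_germ_const, of 1 0] fst by simp
  moreover have "frechet_derivative (\<lambda>v. snd (\<kappa> v)) (at 0) 1 = \<theta> 0"
    using frechet_derivative_along_line[OF sf(2) \<theta>(1), of 1] \<theta>(2) by simp
  moreover have "frechet_derivative (\<lambda>v. fst (\<kappa> v)) (at 0) 1 = fst (frechet_derivative \<kappa> (at 0) 1)"
    "frechet_derivative (\<lambda>v. snd (\<kappa> v)) (at 0) 1 = snd (frechet_derivative \<kappa> (at 0) 1)"
    using frechet_derivative_compose_0[OF smooth_germ_fst[OF smooth_germ_id] \<kappa>, of 1]
      frechet_derivative_compose_0[OF smooth_germ_snd[OF smooth_germ_id] \<kappa>, of 1]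
    by (simp_all add: frechet_derivative_bounded_linear bounded_linear_fst bounded_linear_snd)
  moreover have "frechet_derivative \<kappa> (at 0) 1 = frechet_derivative \<phi>' (at 0) (0, 1)"
    unfolding \<kappa>_def using frechet_derivative_compose_0[of \<phi>' \<gamma> 1] \<phi>_facts \<gamma>_germ by simp
  ultimately have D': "frechet_derivative \<phi>' (at 0) (0, 1) = (0, \<theta> 0)" by (simp add: prod_eq_iff)
  have "\<theta> 0 \<noteq> 0"
  proof
    assume "\<theta> 0 = 0"
    then have "frechet_derivative \<phi> (at 0) 0 = (0, 1)"
      using inverse_germs_frechet_derivative[OF inverse_germs_sym[OF \<phi>], of "(0, 1)"] D'
      by (simp add: zero_prod_def)
    moreover have "frechet_derivative \<phi> (at 0) 0 = 0"
      using linear_0[OF linear_frechet_derivative] \<phi>_facts by blast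
    ultimately show False by (simp add: zero_prod_def)
  qed
  moreover have "\<forall>\<^sub>F v in nhds 0. \<phi>' (\<gamma> v) = (0, v * \<theta> v)"
    using fst \<theta>(2) by eventually_elim (simp add: \<kappa>_def prod_eq_iff)
  ultimately show ?thesis using \<theta>(1) D' by blast
qed

lemma height_on_locus:
  assumes "\<forall>\<^sub>F v in nhds 0. \<phi>' (\<gamma> v) = (0, v * \<theta> v)"
  shows "\<forall>\<^sub>F v in nhds 0. height g w (\<gamma> v) = H (0, 0, (v * \<theta> v)\<^sup>2)"
  using smooth_germ_eventually[OF \<gamma>_germ(1,2) height_eq] assms
  by eventually_elim (simp add: standard_umbrella_def)

lemma height_on_locus_factor:
  assumes q: "smooth_germ q" "\<forall>\<^sub>F t in nhds 0. H (0, 0, t) = t ^ k * q t"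
  shows "\<exists>r. smooth_germ r \<and> (q 0 \<noteq> 0 \<longrightarrow> r 0 \<noteq> 0) \<and>
    (\<forall>\<^sub>F v in nhds 0. (height g w \<circ> \<gamma>) v = v ^ (2 * k) * r v)"
proof -
  obtain \<theta> where \<theta>: "smooth_germ \<theta>" "\<theta> 0 \<noteq> 0" "\<forall>\<^sub>F v in nhds 0. \<phi>' (\<gamma> v) = (0, v * \<theta> v)"
    using locus_in_chart by blast
  define r where "r = (\<lambda>v. \<theta> v ^ (2 * k) * q ((v * \<theta> v)\<^sup>2))"
  have s: "smooth_germ (\<lambda>v. (v * \<theta> v)\<^sup>2)" "(0 * \<theta> 0)\<^sup>2 = 0" by (auto intro!: smooth_intros \<theta>)
  have "smooth_germ r" unfolding r_def
    by (intro smooth_germ_mult smooth_germ_power \<theta> smooth_germ_compose[OF q(1) s])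
  moreover have "q 0 \<noteq> 0 \<longrightarrow> r 0 \<noteq> 0" using \<theta>(2) by (simp add: r_def)
  moreover have "\<forall>\<^sub>F v in nhds 0. (height g w \<circ> \<gamma>) v = v ^ (2 * k) * r v"
    using height_on_locus[OF \<theta>(3)] smooth_germ_eventually[OF s q(2)]
    by eventually_elim (simp add: r_def power_mult_distrib power_mult[symmetric])
  ultimately show ?thesis by blast
qed

text \<open>If \<open>H(0, 0, t)\<close> were divisible by an arbitrarily high power of \<open>t\<close>, the derivatives of the height
  function along the locus would all vanish.\<close>

lemma finite_order_if_not_flat:
  assumes "\<not> flat_at_0 (height g w \<circ> \<gamma>)"
  obtains k q where "k \<ge> 1" "smooth_germ q" "q 0 \<noteq> 0" "\<forall>\<^sub>F t in nhds 0. H (0, 0, t) = t ^ k * q t"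
proof -
  obtain n where n: "(deriv ^^ n) (height g w \<circ> \<gamma>) 0 \<noteq> 0" using assms by (auto simp: flat_at_0_def)
  have sE: "smooth_germ (\<lambda>t. H (0, 0, t))"
    by (rule smooth_germ_compose[OF smooth_H]) (auto intro!: smooth_intros simp: zero_prod_def)
  have E0: "H (0, 0, 0) = 0" using H_0 by (simp add: zero_prod_def)
  from order_dichotomy[OF sE, of "n + 1"] show ?thesis
  proof
    assume "\<exists>q. smooth_germ q \<and> (\<forall>\<^sub>F x in nhds 0. H (0, 0, x) = x ^ (n + 1) * q x)"
    then obtain r where "smooth_germ r" "\<forall>\<^sub>F v in nhds 0. (height g w \<circ> \<gamma>) v = v ^ (2 * (n + 1)) * r v"
      using height_on_locus_factor by blast
    from iterated_deriv_factor[OF this] have "(deriv ^^ n) (height g w \<circ> \<gamma>) 0 = 0"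
      by (metis less_add_one mult_2 trans_less_add1)
    with n show ?thesis by blast
  next
    assume "\<exists>i<n + 1. \<exists>q. smooth_germ q \<and> q 0 \<noteq> 0 \<and> (\<forall>\<^sub>F x in nhds 0. H (0, 0, x) = x ^ i * q x)"
    then obtain i q where q: "smooth_germ q" "q 0 \<noteq> 0" "\<forall>\<^sub>F x in nhds 0. H (0, 0, x) = x ^ i * q x" by blast
    have "i \<ge> 1" using eventually_nhds_x_imp_x[OF q(3)] q(2) E0 by (cases i) auto
    with q that show ?thesis by blast
  qed
qed

text \<open>The image of the locus is \<open>\<Psi>\<close> of a half-axis, so its tangent line is spanned by the derivative of
  \<open>\<Psi>\<close> along this axis.\<close>

lemma tangent_line_in_plane_iff:
  assumes "image_tangent_line g D L"
  shows "L \<subseteq> plane w \<longleftrightarrow> frechet_derivative H (at 0) (0, 0, 1) = 0"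
proof -
  obtain Y d where Y: "germ_image g D Y" and d: "d \<noteq> 0" "L = range (\<lambda>t. t *\<^sub>R d)"
    and lim: "((\<lambda>p. infdist p L / norm p) \<longlongrightarrow> 0) (at 0 within Y)"
    using assms unfolding image_tangent_line_def tangent_line_def by blast
  define e where "e = frechet_derivative \<Psi> (at 0) (0, 0, 1)"
  have L_span: "L = span {d}" using d(2) by (simp add: span_singleton)
  have e_nz: "e \<noteq> 0"
  proof
    assume "e = 0"
    then have "(0, 0, 1) = frechet_derivative \<Psi>' (at 0) 0"
      using inverse_germs_frechet_derivative[OF \<Psi>, of "(0, 0, 1)"] by (simp add: e_def)
    also have "\<dots> = 0" using linear_0[OF linear_frechet_derivative] \<Psi>_facts by blast
    finally show False by (simp add: zero_prod_def)
  qed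
  obtain \<theta> where \<theta>: "smooth_germ \<theta>" "\<theta> 0 \<noteq> 0" "\<forall>\<^sub>F v in nhds 0. \<phi>' (\<gamma> v) = (0, v * \<theta> v)"
    using locus_in_chart by blast
  define s where "s = (\<lambda>v. (v * \<theta> v)\<^sup>2)"
  define P where "P = (\<lambda>v. g (\<gamma> v))"
  have sg: "smooth_germ P" "P 0 = 0" unfolding P_def
    using smooth_germ_compose[OF smooth_g \<gamma>_germ(1,2)] \<gamma>_germ(2) g_0 by auto
  have ss: "smooth_germ s" "s 0 = 0" unfolding s_def by (auto intro!: smooth_intros \<theta>)
  have PY: "\<forall>\<^sub>F v in nhds 0. P v \<in> Y"
  proof -
    have "\<forall>\<^sub>F r in at_right (0 :: real). 0 < r \<and> germ_eq (g ` (D \<inter> ball 0 r)) Y"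
      using Y eventually_at_right_less[of "0 :: real"] by (auto simp: germ_image_def eventually_conj_iff)
    then obtain r where r: "r > 0" "germ_eq (g ` (D \<inter> ball 0 r)) Y"
      using eventually_happens' trivial_limit_at_right_real by blast
    have "\<forall>\<^sub>F p :: real \<times> real in nhds 0. p \<in> ball 0 r" using r(1) by (intro eventually_nhds_in_open) auto
    from smooth_germ_eventually[OF \<gamma>_germ(1,2) this] \<gamma>_germ(6)
      smooth_germ_eventually[OF sg r(2)[unfolded germ_eq_def]]
    show ?thesis by eventually_elim (auto simp: P_def)
  qed
  have P_eq: "\<forall>\<^sub>F v in nhds 0. P v = \<Psi> (0, 0, s v)"
    using smooth_germ_eventually[OF \<gamma>_germ(1,2) g_eq] \<theta>(3)
    by eventually_elim (simp add: P_def s_def standard_umbrella_def)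
  have ax: "smooth_germ (\<lambda>v. (0 :: real, 0 :: real, s v))" "(0 :: real, 0 :: real, s 0) = 0"
    using ss by (auto intro!: smooth_intros simp: zero_prod_def)
  have s_pos: "\<forall>\<^sub>F v in at 0. s v > 0"
  proof -
    have "\<forall>\<^sub>F v in at 0. \<theta> v \<noteq> 0"
      using smooth_germ_eventually_nonzero[OF \<theta>(1,2)] unfolding eventually_nhds_conv_at by blast
    moreover have "\<forall>\<^sub>F v :: real in at 0. v \<noteq> 0" by (rule eventually_neq_at_within)
    ultimately show ?thesis by eventually_elim (simp add: s_def)
  qed
  have "\<forall>\<^sub>F v in nhds 0. \<Psi>' (\<Psi> (0, 0, s v)) = (0, 0, s v)"
    using smooth_germ_eventually[OF ax, of "\<lambda>x. \<Psi>' (\<Psi> x) = x"] \<Psi>_facts by auto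
  then have "\<forall>\<^sub>F v in at 0. \<Psi>' (\<Psi> (0, 0, s v)) = (0, 0, s v)"
    unfolding eventually_nhds_conv_at by blast
  moreover have P_eq': "\<forall>\<^sub>F v in at 0. P v = \<Psi> (0, 0, s v)"
    using P_eq unfolding eventually_nhds_conv_at by blast
  ultimately have P_nz: "\<forall>\<^sub>F v in at 0. P v \<noteq> 0"
    using s_pos
  proof eventually_elim
    case (elim v)
    have "\<Psi>' 0 = 0" using \<Psi>_facts by blast
    then show ?case using elim by (auto simp: zero_prod_def)
  qed
  have "filterlim P (at 0 within Y) (at 0)"
    unfolding filterlim_at
  proof
    show "\<forall>\<^sub>F v in at 0. P v \<in> Y \<and> P v \<noteq> 0"
      using PY P_nz unfolding eventually_nhds_conv_at by (auto elim: eventually_elim2)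
    show "(P \<longlongrightarrow> 0) (at 0)" using smooth_germ_continuous[OF sg(1)] sg(2) by (simp add: isCont_def)
  qed
  from filterlim_compose[OF lim this]
  have limP: "((\<lambda>v. infdist (P v) L / norm (P v)) \<longlongrightarrow> 0) (at 0)" .
  have D\<Psi>: "(\<Psi> has_derivative frechet_derivative \<Psi> (at 0)) (at 0)"
    using \<Psi>_facts smooth_germ_has_derivative by blast
  have near: "\<exists>a\<in>L. dist a e < \<epsilon>" if "\<epsilon> > 0" for \<epsilon>
  proof -
    \<comment> \<open>The secant direction \<open>P(v) / s(v)\<close> is within \<open>\<eta>\<close> of \<open>e\<close>, and within \<open>\<eta> (|e| + 1)\<close> of \<open>L\<close>.\<close>
    define \<eta> where "\<eta> = min 1 (\<epsilon> / (norm e + 3))"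
    have \<eta>: "\<eta> > 0" "\<eta> \<le> 1" "\<eta> * (norm e + 3) \<le> \<epsilon>"
    proof -
      have n: "norm e + 3 > 0" by (simp add: add_nonneg_pos)
      show "\<eta> > 0" "\<eta> \<le> 1" using that n by (simp_all add: \<eta>_def)
      have "\<eta> \<le> \<epsilon> / (norm e + 3)" by (simp add: \<eta>_def)
      then show "\<eta> * (norm e + 3) \<le> \<epsilon>" using n by (simp add: pos_le_divide_eq)
    qed
    have "\<exists>d>0. \<forall>y. norm (y - 0) < d \<longrightarrow>
        norm (\<Psi> y - \<Psi> 0 - frechet_derivative \<Psi> (at 0) (y - 0)) \<le> \<eta> * norm (y - 0)"
      using D\<Psi> \<eta>(1) unfolding has_derivative_at_alt by blast
    then have "\<forall>\<^sub>F y in nhds 0. norm (\<Psi> y - frechet_derivative \<Psi> (at 0) y) \<le> \<eta> * norm y"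
      unfolding eventually_nhds_metric using \<Psi>_facts by (auto simp: dist_norm)
    from smooth_germ_eventually[OF ax this]
    have "\<forall>\<^sub>F v in at 0. norm (\<Psi> (0, 0, s v) - frechet_derivative \<Psi> (at 0) (0, 0, s v)) \<le> \<eta> * norm (0 :: real, 0 :: real, s v)"
      unfolding eventually_nhds_conv_at by blast
    moreover have "\<forall>\<^sub>F v in at 0. infdist (P v) L / norm (P v) < \<eta>"
      using order_tendstoD(2)[OF limP \<eta>(1)] .
    ultimately have "\<forall>\<^sub>F v in at 0.
        norm (\<Psi> (0, 0, s v) - frechet_derivative \<Psi> (at 0) (0, 0, s v)) \<le> \<eta> * norm (0 :: real, 0 :: real, s v) \<and>
        infdist (P v) L / norm (P v) < \<eta> \<and> P v = \<Psi> (0, 0, s v) \<and> s v > 0 \<and> P v \<noteq> 0"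
      using P_eq' s_pos P_nz by eventually_elim blast
    then obtain v where elim:
      "norm (\<Psi> (0, 0, s v) - frechet_derivative \<Psi> (at 0) (0, 0, s v)) \<le> \<eta> * norm (0 :: real, 0 :: real, s v)"
      "infdist (P v) L / norm (P v) < \<eta>" "P v = \<Psi> (0, 0, s v)" "s v > 0" "P v \<noteq> 0"
      using eventually_happens'[OF at_neq_bot] by blast
    define \<sigma> where "\<sigma> = s v"
    interpret l: linear "frechet_derivative \<Psi> (at 0)" using D\<Psi> has_derivative_linear by blast
    have "frechet_derivative \<Psi> (at 0) (\<sigma> *\<^sub>R (0, 0, 1)) = \<sigma> *\<^sub>R e" by (simp only: l.scaleR e_def)
    then have 1: "norm (P v - \<sigma> *\<^sub>R e) \<le> \<eta> * \<sigma>"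
      using elim(1,3,4) by (simp add: \<sigma>_def)
    have "closed L" "L \<noteq> {}" unfolding L_span using closed_subspace subspace_span span_0 by blast+
    then obtain a where a: "a \<in> L" "infdist (P v) L = dist (P v) a" using infdist_attains_inf by blast
    have "dist (P v) a < \<eta> * norm (P v)"
      using elim(2,5) a(2) by (simp add: pos_divide_less_eq)
    also have "norm (P v) \<le> norm (\<sigma> *\<^sub>R e) + \<eta> * \<sigma>"
      using 1 norm_triangle_sub[of "P v" "\<sigma> *\<^sub>R e"] by linarith
    also have "norm (\<sigma> *\<^sub>R e) + \<eta> * \<sigma> \<le> \<sigma> * (norm e + 1)"
      using elim(4) \<eta>(2) by (simp add: \<sigma>_def algebra_simps mult_left_le)
    finally have 2: "dist (P v) a < \<eta> * (\<sigma> * (norm e + 1))" using \<eta>(1) by simp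
    have "norm (a - \<sigma> *\<^sub>R e) \<le> dist (P v) a + norm (P v - \<sigma> *\<^sub>R e)"
      using norm_triangle_ineq[of "a - P v" "P v - \<sigma> *\<^sub>R e"] by (simp add: dist_norm norm_minus_commute)
    also have "\<dots> < \<eta> * (\<sigma> * (norm e + 1)) + \<eta> * \<sigma>" using 1 2 by linarith
    also have "\<dots> = \<sigma> * (\<eta> * (norm e + 2))" by (simp add: algebra_simps)
    finally have 3: "norm (a - \<sigma> *\<^sub>R e) < \<sigma> * (\<eta> * (norm e + 2))" .
    have \<sigma>: "\<sigma> > 0" using elim(4) by (simp add: \<sigma>_def)
    have "a - \<sigma> *\<^sub>R e = \<sigma> *\<^sub>R ((1 / \<sigma>) *\<^sub>R a - e)" using \<sigma> by (simp add: scaleR_diff_right)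
    then have "\<sigma> * norm ((1 / \<sigma>) *\<^sub>R a - e) < \<sigma> * (\<eta> * (norm e + 2))" using 3 \<sigma> by simp
    then have "dist ((1 / \<sigma>) *\<^sub>R a) e < \<eta> * (norm e + 2)" using \<sigma> by (simp add: dist_norm)
    also have "\<dots> \<le> \<eta> * (norm e + 3)" using \<eta>(1) by simp
    also have "\<dots> \<le> \<epsilon>" by (rule \<eta>(3))
    finally have "dist ((1 / \<sigma>) *\<^sub>R a) e < \<epsilon>" .
    moreover have "(1 / \<sigma>) *\<^sub>R a \<in> L" using a(1) unfolding L_span by (rule span_scale)
    ultimately show ?thesis by blast
  qed
  then have "e \<in> closure L" unfolding closure_approachable by blast
  moreover have "closed L" unfolding L_span using closed_subspace subspace_span by blast
  ultimately have "e \<in> L" by simp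
  then obtain t where t: "e = t *\<^sub>R d" using d(2) by blast
  then have "t \<noteq> 0" using e_nz by auto
  have "L \<subseteq> plane w \<longleftrightarrow> inner d w = 0"
  proof
    assume "L \<subseteq> plane w"
    moreover have "d \<in> L" unfolding L_span by (simp add: span_base)
    ultimately show "inner d w = 0" by (auto simp: plane_def)
  qed (auto simp: d(2) plane_def)
  also have "\<dots> \<longleftrightarrow> inner e w = 0" using t \<open>t \<noteq> 0\<close> by simp
  also have "\<dots> \<longleftrightarrow> frechet_derivative H (at 0) (0, 0, 1) = 0" by (simp add: frechet_derivative_H e_def)
  finally show ?thesis .
qed

end

end

section \<open>Normal form\<close>

text \<open>The quadratic parts determine the components up to \<open>O(3)\<close>: so small are all higher monomials and,
  since \<open>N \<ge> 3\<close>, the remainders.\<close>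

lemma normal_form_estimates:
  assumes "normal_form g N b a"
  shows "\<exists>C. \<forall>\<^sub>F p in nhds 0. fst (g p) = fst p \<and>
     \<bar>fst (snd (g p)) - fst p * snd p\<bar> \<le> C * norm p ^ 3 \<and>
     \<bar>snd (snd (g p)) - (a 2 0 / 2 * (fst p)\<^sup>2 + a 1 1 * fst p * snd p + a 0 2 / 2 * (snd p)\<^sup>2)\<bar> \<le> C * norm p ^ 3"
proof -
  obtain r2 r3 where N: "N \<ge> 3"
    and r2: "r2 \<in> O[nhds 0](\<lambda>p. norm p ^ (N + 1))" and r3: "r3 \<in> O[nhds 0](\<lambda>p. norm p ^ (N + 1))"
    and g: "\<forall>\<^sub>F (u, v) in nhds 0. g (u, v) =
           (u,
            u * v + (\<Sum>i=3..N. b i / fact i * v ^ i) + r2 (u, v),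
            (\<Sum>m=2..N. \<Sum>(i, j)\<in>{(i, j). i + j = m}. a i j / (fact i * fact j) * u ^ i * v ^ j)
              + r3 (u, v))"
    using assms unfolding normal_form_def by blast
  have g: "\<forall>\<^sub>F p in nhds 0. g p =
           (fst p,
            fst p * snd p + (\<Sum>i=3..N. b i / fact i * snd p ^ i) + r2 p,
            (\<Sum>m=2..N. \<Sum>(i, j)\<in>{(i, j). i + j = m}. a i j / (fact i * fact j) * fst p ^ i * snd p ^ j)
              + r3 p)"
    using g by (rule eventually_mono) (simp add: split_beta)
  obtain C2 where C2: "C2 > 0" "\<forall>\<^sub>F p in nhds 0. \<bar>r2 p\<bar> \<le> C2 * norm p ^ (N + 1)"
    using r2 by (auto simp: bigo_def)
  obtain C3 where C3: "C3 > 0" "\<forall>\<^sub>F p in nhds 0. \<bar>r3 p\<bar> \<le> C3 * norm p ^ (N + 1)"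
    using r3 by (auto simp: bigo_def)
  define S where "S = (\<lambda>m :: nat. {(i, j). i + j = m})"
  define B where "B = (\<Sum>i=3..N. \<bar>b i / fact i\<bar>)"
  define A where "A = (\<Sum>m=3..N. \<Sum>(i, j)\<in>S m. \<bar>a i j / (fact i * fact j)\<bar>)"
  define C where "C = B + A + C2 + C3"
  have B: "B \<ge> 0" unfolding B_def by (intro sum_nonneg) auto
  have A: "A \<ge> 0" unfolding A_def by (intro sum_nonneg) auto
  have small: "\<forall>\<^sub>F p :: real \<times> real in nhds 0. norm p < 1"
    unfolding eventually_nhds_metric by (auto intro!: exI[of _ 1] simp: dist_norm)
  have S2: "S 2 = {(0, 2), (1, 1), (2, 0)}"
    unfolding S_def by (auto; presburger)
  have "\<forall>\<^sub>F p in nhds 0. fst (g p) = fst p \<and>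
     \<bar>fst (snd (g p)) - fst p * snd p\<bar> \<le> C * norm p ^ 3 \<and>
     \<bar>snd (snd (g p)) - (a 2 0 / 2 * (fst p)\<^sup>2 + a 1 1 * fst p * snd p + a 0 2 / 2 * (snd p)\<^sup>2)\<bar> \<le> C * norm p ^ 3"
    using g C2(2) C3(2) small
  proof eventually_elim
    case (elim p)
    define u v n where d: "u = fst p" "v = snd p" "n = norm p"
    have n: "0 \<le> n" "n \<le> 1" using elim by (simp_all add: d)
    have u: "\<bar>u\<bar> \<le> n" and v: "\<bar>v\<bar> \<le> n"
      unfolding d using norm_fst_le[of "fst p" "snd p"] norm_snd_le[of "snd p" "fst p"] by simp_all
    have monom: "\<bar>u ^ i * v ^ j\<bar> \<le> n ^ 3" if "i + j \<ge> 3" for i j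
    proof -
      have "\<bar>u ^ i * v ^ j\<bar> \<le> n ^ i * n ^ j"
        unfolding abs_mult power_abs using u v n by (intro mult_mono power_mono) auto
      also have "\<dots> \<le> n ^ 3" unfolding power_add[symmetric] using n that by (intro power_decreasing) auto
      finally show ?thesis .
    qed
    have N3: "n ^ (N + 1) \<le> n ^ 3" using n N by (intro power_decreasing) auto
    have r2: "\<bar>r2 p\<bar> \<le> C2 * n ^ 3" and r3: "\<bar>r3 p\<bar> \<le> C3 * n ^ 3"
      using elim(2,3) C2(1) C3(1) N3 by (auto simp: d intro: order_trans mult_left_mono)
    have "\<bar>\<Sum>i=3..N. b i / fact i * v ^ i\<bar> \<le> (\<Sum>i=3..N. \<bar>b i / fact i\<bar> * n ^ 3)"
    proof (rule order_trans[OF sum_abs sum_mono])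
      fix i assume "i \<in> {3..N}"
      then show "\<bar>b i / fact i * v ^ i\<bar> \<le> \<bar>b i / fact i\<bar> * n ^ 3"
        unfolding abs_mult using monom[of 0 i] by (intro mult_left_mono) auto
    qed
    then have 2: "\<bar>\<Sum>i=3..N. b i / fact i * v ^ i\<bar> \<le> B * n ^ 3" by (simp add: B_def sum_distrib_right)
    define Am where "Am = (\<lambda>m. \<Sum>(i, j)\<in>S m. a i j / (fact i * fact j) * u ^ i * v ^ j)"
    have "\<bar>\<Sum>m=3..N. Am m\<bar> \<le> (\<Sum>m=3..N. (\<Sum>(i, j)\<in>S m. \<bar>a i j / (fact i * fact j)\<bar>) * n ^ 3)"
    proof (rule order_trans[OF sum_abs sum_mono])
      fix m assume m: "m \<in> {3..N}"
      have "\<bar>Am m\<bar> \<le> (\<Sum>(i, j)\<in>S m. \<bar>a i j / (fact i * fact j)\<bar> * n ^ 3)"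
        unfolding Am_def
      proof (rule order_trans[OF sum_abs sum_mono])
        fix ij assume "ij \<in> S m"
        then obtain i j where ij: "ij = (i, j)" "i + j \<ge> 3" using m by (auto simp: S_def)
        have "\<bar>a i j / (fact i * fact j) * u ^ i * v ^ j\<bar> = \<bar>a i j / (fact i * fact j)\<bar> * \<bar>u ^ i * v ^ j\<bar>"
          by (simp add: abs_mult)
        also have "\<dots> \<le> \<bar>a i j / (fact i * fact j)\<bar> * n ^ 3" using monom[OF ij(2)] by (intro mult_left_mono) auto
        finally show "\<bar>case ij of (i, j) \<Rightarrow> a i j / (fact i * fact j) * u ^ i * v ^ j\<bar>
            \<le> (case ij of (i, j) \<Rightarrow> \<bar>a i j / (fact i * fact j)\<bar> * n ^ 3)" by (simp add: ij(1))
      qed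
      then show "\<bar>Am m\<bar> \<le> (\<Sum>(i, j)\<in>S m. \<bar>a i j / (fact i * fact j)\<bar>) * n ^ 3"
        by (simp add: sum_distrib_right split_beta)
    qed
    then have 3: "\<bar>\<Sum>m=3..N. Am m\<bar> \<le> A * n ^ 3" by (simp add: A_def sum_distrib_right)
    have "(\<Sum>m=2..N. Am m) = Am 2 + (\<Sum>m=3..N. Am m)"
      using N by (subst sum.atLeast_Suc_atMost) (auto simp: numeral_3_eq_3 numeral_2_eq_2)
    moreover have "Am 2 = a 2 0 / 2 * u\<^sup>2 + a 1 1 * u * v + a 0 2 / 2 * v\<^sup>2"
      unfolding Am_def S2 by simp
    moreover have "snd (snd (g p)) = (\<Sum>m=2..N. Am m) + r3 p"
      using elim(1) by (simp add: Am_def S_def d)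
    ultimately have "\<bar>snd (snd (g p)) - (a 2 0 / 2 * u\<^sup>2 + a 1 1 * u * v + a 0 2 / 2 * v\<^sup>2)\<bar> \<le> A * n ^ 3 + C3 * n ^ 3"
      using 3 r3 by linarith
    also have "\<dots> \<le> C * n ^ 3"
      using B C2(1) n by (simp add: C_def algebra_simps)
    finally have g3: "\<bar>snd (snd (g p)) - (a 2 0 / 2 * u\<^sup>2 + a 1 1 * u * v + a 0 2 / 2 * v\<^sup>2)\<bar> \<le> C * n ^ 3" .
    have "fst (snd (g p)) = u * v + (\<Sum>i=3..N. b i / fact i * v ^ i) + r2 p"
      using elim(1) by (simp add: d)
    then have "\<bar>fst (snd (g p)) - u * v\<bar> \<le> B * n ^ 3 + C2 * n ^ 3" using 2 r2 by linarith
    also have "\<dots> \<le> C * n ^ 3"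
      using A C3(1) n by (simp add: C_def algebra_simps)
    finally have "\<bar>fst (snd (g p)) - u * v\<bar> \<le> C * n ^ 3" .
    with g3 show ?case using elim(1) by (simp add: d)
  qed
  then show ?thesis by blast
qed

lemma bound_along_curve:
  fixes c :: "real \<Rightarrow> 'a::real_normed_vector"
  assumes "smooth_germ c" "c 0 = 0" "\<forall>\<^sub>F p in nhds 0. \<bar>f p\<bar> \<le> C * norm p ^ 3"
  shows "\<exists>B. \<forall>\<^sub>F t in nhds 0. \<bar>f (c t)\<bar> \<le> B * \<bar>t\<bar> ^ 3"
proof -
  obtain K where K: "K > 0" "\<forall>\<^sub>F t in nhds 0. norm (c t) \<le> K * norm t"
    using smooth_germ_norm_le[OF assms(1,2)] .
  have "\<forall>\<^sub>F t in nhds 0. \<bar>f (c t)\<bar> \<le> (\<bar>C\<bar> * K ^ 3) * \<bar>t\<bar> ^ 3"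
    using smooth_germ_eventually[OF assms] K(2)
  proof eventually_elim
    case (elim t)
    have "\<bar>f (c t)\<bar> \<le> \<bar>C\<bar> * norm (c t) ^ 3"
      using elim(1) by (rule order_trans) (intro mult_right_mono, auto)
    also have "\<dots> \<le> \<bar>C\<bar> * (K * norm t) ^ 3" using elim(2) by (intro mult_left_mono power_mono) auto
    finally show ?case by (simp add: power_mult_distrib mult.assoc)
  qed
  then show ?thesis by blast
qed

context umbrella_chart
begin

text \<open>If \<open>w\<close> is a multiple of \<open>(0, 1, 0)\<close>, the height function is \<open>u v + O(3)\<close> up to a factor, so a curve on its zero set that is not
  tangent to the \<open>v\<close>-axis is tangent to the \<open>u\<close>-axis.\<close>

lemma tangent_to_u_axis:
  fixes c :: "real \<Rightarrow> real \<times> real"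
  assumes nf: "normal_form g N b a" and w': "fst w = 0" "snd (snd w) = 0" "fst (snd w) \<noteq> 0"
    and c: "smooth_germ c" "c 0 = 0" "\<forall>\<^sub>F t in nhds 0. height g w (c t) = 0"
  shows "fst (frechet_derivative c (at 0) 1) = 0 \<or> snd (frechet_derivative c (at 0) 1) = 0"
proof -
  obtain C where C: "\<forall>\<^sub>F p in nhds 0. fst (g p) = fst p \<and>
     \<bar>fst (snd (g p)) - fst p * snd p\<bar> \<le> C * norm p ^ 3 \<and>
     \<bar>snd (snd (g p)) - (a 2 0 / 2 * (fst p)\<^sup>2 + a 1 1 * fst p * snd p + a 0 2 / 2 * (snd p)\<^sup>2)\<bar> \<le> C * norm p ^ 3"
    using normal_form_estimates[OF nf] by blast
  have "\<forall>\<^sub>F p in nhds 0. \<bar>fst (snd (g p)) - fst p * snd p\<bar> \<le> C * norm p ^ 3"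
    using C by eventually_elim blast
  from bound_along_curve[OF c(1,2) this]
  obtain B where B: "\<forall>\<^sub>F t in nhds 0. \<bar>fst (snd (g (c t))) - fst (c t) * snd (c t)\<bar> \<le> B * \<bar>t\<bar> ^ 3" by blast
  have sf: "smooth_germ (\<lambda>t. fst (c t))" "smooth_germ (\<lambda>t. snd (c t))" by (intro smooth_intros c)+
  obtain x where x: "smooth_germ x" "\<forall>\<^sub>F t in nhds 0. fst (c t) = t * x t"
    using hadamard_real[OF sf(1)] c(2) by auto
  obtain y where y: "smooth_germ y" "\<forall>\<^sub>F t in nhds 0. snd (c t) = t * y t"
    using hadamard_real[OF sf(2)] c(2) by auto
  have "\<forall>\<^sub>F t in nhds 0. \<bar>t\<^sup>2 * (x t * y t)\<bar> \<le> B * \<bar>t\<bar> ^ Suc 2"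
    using c(3) B x(2) y(2)
  proof eventually_elim
    case (elim t)
    have "fst (snd (g (c t))) = 0" using elim(1) w' by (simp add: height_def inner_prod_def)
    then show ?case using elim(2-4) by (simp add: power2_eq_square algebra_simps numeral_3_eq_3)
  qed
  from leading_coefficient_zero[OF smooth_germ_mult[OF x(1) y(1)] this]
  have "x 0 * y 0 = 0" .
  moreover have "fst (frechet_derivative c (at 0) 1) = x 0"
    using frechet_derivative_along_line[OF sf(1) x(1), of 1] x(2)
      frechet_derivative_compose_0[OF smooth_germ_fst[OF smooth_germ_id] c(1,2), of 1]
    by (simp add: frechet_derivative_bounded_linear bounded_linear_fst)
  moreover have "snd (frechet_derivative c (at 0) 1) = y 0"
    using frechet_derivative_along_line[OF sf(2) y(1), of 1] y(2)
      frechet_derivative_compose_0[OF smooth_germ_snd[OF smooth_germ_id] c(1,2), of 1]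
    by (simp add: frechet_derivative_bounded_linear bounded_linear_snd)
  ultimately show ?thesis by auto
qed

context
  fixes D :: "(real \<times> real) set" and \<gamma> :: "real \<Rightarrow> real \<times> real" and a b N
  assumes D: "double_point_locus g D" and \<gamma>: "parameterizes_locus (b 3) \<gamma> D"
    and nf: "normal_form g N b a"
begin

lemmas \<gamma>_germ' = parameterizes_locus_germ[OF \<gamma>]

text \<open>A singular height function whose plane contains the tangent line of the image of the locus is a multiple
  of the second component of the normal form: the first coefficient is the linear part of the
  height function, and the third one is read off along the locus.\<close>

lemma normal_vector_if_singular:
  assumes HX: "frechet_derivative H (at 0) (1, 0, 0) = 0"
    and q: "smooth_germ q" "\<forall>\<^sub>F t in nhds 0. H (0, 0, t) = t ^ k * q t" and k: "k \<ge> 2"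
  shows "fst w = 0" "snd (snd w) = 0" "fst (snd w) \<noteq> 0"
proof -
  obtain w1 w2 w3 where w123: "w = (w1, w2, w3)" using prod_cases3 by blast
  obtain C where C: "\<forall>\<^sub>F p in nhds 0. fst (g p) = fst p \<and>
     \<bar>fst (snd (g p)) - fst p * snd p\<bar> \<le> C * norm p ^ 3 \<and>
     \<bar>snd (snd (g p)) - (a 2 0 / 2 * (fst p)\<^sup>2 + a 1 1 * fst p * snd p + a 0 2 / 2 * (snd p)\<^sup>2)\<bar> \<le> C * norm p ^ 3"
    using normal_form_estimates[OF nf] by blast
  have C1: "\<forall>\<^sub>F p in nhds 0. fst (g p) = fst p" using C by eventually_elim blast
  define f2 where "f2 = (\<lambda>p. fst (snd (g p)) - fst p * snd p)"
  define f3 where "f3 = (\<lambda>p. snd (snd (g p)) - (a 2 0 / 2 * (fst p)\<^sup>2 + a 1 1 * fst p * snd p + a 0 2 / 2 * (snd p)\<^sup>2))"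
  have C2: "\<forall>\<^sub>F p in nhds 0. \<bar>f2 p\<bar> \<le> C * norm p ^ 3"
    unfolding f2_def using C by eventually_elim blast
  have C3: "\<forall>\<^sub>F p in nhds 0. \<bar>f3 p\<bar> \<le> C * norm p ^ 3"
    unfolding f3_def using C by eventually_elim blast
  have h: "height g w p = w1 * fst (g p) + w2 * (f2 p + fst p * snd p) +
     w3 * (f3 p + (a 2 0 / 2 * (fst p)\<^sup>2 + a 1 1 * fst p * snd p + a 0 2 / 2 * (snd p)\<^sup>2))" for p
    by (simp add: height_def w123 f2_def f3_def inner_prod_def algebra_simps)
  have small: "\<forall>\<^sub>F t :: real in nhds 0. \<bar>t\<bar> < 1"
    unfolding eventually_nhds_metric by (auto intro!: exI[of _ 1] simp: dist_norm)

  \<comment> \<open>Along the \<open>u\<close>-axis the height function is \<open>w\<^sub>1 t + O(t\<^sup>2)\<close>.\<close>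
  have ax: "smooth_germ (\<lambda>t :: real. (t, 0 :: real))" "(0 :: real, 0 :: real) = 0"
    by (auto intro!: smooth_intros simp: zero_prod_def)
  obtain B2 where B2: "\<forall>\<^sub>F t in nhds 0. \<bar>f2 (t, 0)\<bar> \<le> B2 * \<bar>t\<bar> ^ 3" using bound_along_curve[OF ax C2] by blast
  obtain B3 where B3: "\<forall>\<^sub>F t in nhds 0. \<bar>f3 (t, 0)\<bar> \<le> B3 * \<bar>t\<bar> ^ 3" using bound_along_curve[OF ax C3] by blast
  have sh: "smooth_germ (\<lambda>t. height g w (t, 0))" by (rule smooth_germ_restrict_fst(1)[OF smooth_height])
  have h00: "height g w (0, 0) = 0" using height_0 by (simp add: zero_prod_def)
  obtain c where c: "smooth_germ c" "\<forall>\<^sub>F t in nhds 0. height g w (t, 0) = t * c t"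
    using hadamard_real[OF sh] h00 by auto
  have "frechet_derivative (height g w) (at 0) (1, 0) = 0"
    using nonsingular_height_iff HX by (simp add: nonsingular_def)
  moreover have "frechet_derivative (height g w) (at 0) (1, 0) = c 0"
    using c by (intro frechet_derivative_along_line[OF smooth_height]) auto
  ultimately have c0: "c 0 = 0" by simp
  have "\<forall>\<^sub>F t in nhds 0. \<bar>t ^ 1 * (c t - w1)\<bar> \<le> (\<bar>w2\<bar> * \<bar>B2\<bar> + \<bar>w3\<bar> * (\<bar>B3\<bar> + \<bar>a 2 0\<bar>)) * \<bar>t\<bar> ^ Suc 1"
    using c(2) smooth_germ_eventually[OF ax C1] B2 B3 small
  proof eventually_elim
    case (elim t)
    have t3: "\<bar>t\<bar> ^ 3 \<le> \<bar>t\<bar>\<^sup>2" using elim(5) by (intro power_decreasing) auto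
    have "\<bar>f2 (t, 0)\<bar> \<le> \<bar>B2\<bar> * \<bar>t\<bar>\<^sup>2" using elim(3) t3 by (meson abs_ge_self abs_ge_zero mult_mono order_trans zero_le_power)
    moreover have "\<bar>f3 (t, 0)\<bar> \<le> \<bar>B3\<bar> * \<bar>t\<bar>\<^sup>2" using elim(4) t3 by (meson abs_ge_self abs_ge_zero mult_mono order_trans zero_le_power)
    moreover have "\<bar>a 2 0 / 2 * t\<^sup>2\<bar> \<le> \<bar>a 2 0\<bar> * \<bar>t\<bar>\<^sup>2"
      unfolding abs_mult power_abs by (intro mult_right_mono) auto
    moreover have "\<bar>f3 (t, 0) + a 2 0 / 2 * t\<^sup>2\<bar> \<le> \<bar>f3 (t, 0)\<bar> + \<bar>a 2 0 / 2 * t\<^sup>2\<bar>" by (rule abs_triangle_ineq)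
    ultimately have 1: "\<bar>f3 (t, 0) + a 2 0 / 2 * t\<^sup>2\<bar> \<le> (\<bar>B3\<bar> + \<bar>a 2 0\<bar>) * \<bar>t\<bar>\<^sup>2"
      and 2: "\<bar>f2 (t, 0)\<bar> \<le> \<bar>B2\<bar> * \<bar>t\<bar>\<^sup>2" by (simp_all add: algebra_simps)
    have "t * c t - w1 * t = w2 * f2 (t, 0) + w3 * (f3 (t, 0) + a 2 0 / 2 * t\<^sup>2)"
      using elim(1,2) h[of "(t, 0)"] by simp
    then have "\<bar>t ^ 1 * (c t - w1)\<bar> = \<bar>w2 * f2 (t, 0) + w3 * (f3 (t, 0) + a 2 0 / 2 * t\<^sup>2)\<bar>"
      by (simp add: algebra_simps)
    also have "\<dots> \<le> \<bar>w2\<bar> * \<bar>f2 (t, 0)\<bar> + \<bar>w3\<bar> * \<bar>f3 (t, 0) + a 2 0 / 2 * t\<^sup>2\<bar>"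
      unfolding abs_mult[symmetric] by (rule abs_triangle_ineq)
    also have "\<dots> \<le> \<bar>w2\<bar> * (\<bar>B2\<bar> * \<bar>t\<bar>\<^sup>2) + \<bar>w3\<bar> * ((\<bar>B3\<bar> + \<bar>a 2 0\<bar>) * \<bar>t\<bar>\<^sup>2)"
      using 1 2 by (intro add_mono mult_left_mono) auto
    finally show ?case by (simp add: algebra_simps power2_eq_square)
  qed
  from leading_coefficient_zero[OF smooth_germ_diff[OF c(1) smooth_germ_const] this] c0
  have w1: "w1 = 0" by simp

  \<comment> \<open>Along the double point locus it is \<open>w\<^sub>3 a\<^sub>0\<^sub>2 v\<^sup>2 / 2 + O(v\<^sup>3)\<close>, but of order at least four.\<close>
  obtain E2 where E2: "\<forall>\<^sub>F t in nhds 0. \<bar>f2 (\<gamma> t)\<bar> \<le> E2 * \<bar>t\<bar> ^ 3"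
    using bound_along_curve[OF \<gamma>_germ'(1,2) C2] by blast
  obtain E3 where E3: "\<forall>\<^sub>F t in nhds 0. \<bar>f3 (\<gamma> t)\<bar> \<le> E3 * \<bar>t\<bar> ^ 3"
    using bound_along_curve[OF \<gamma>_germ'(1,2) C3] by blast
  obtain G where G: "\<forall>\<^sub>F v in nhds 0. \<bar>fst (\<gamma> v)\<bar> \<le> G * \<bar>v\<bar>\<^sup>2" using \<gamma>_germ'(5) by blast
  obtain r where r: "smooth_germ r" "\<forall>\<^sub>F v in nhds 0. (height g w \<circ> \<gamma>) v = v ^ (2 * k) * r v"
    using height_on_locus_factor[OF D \<gamma> q] by blast
  obtain R where R: "R > 0" "\<forall>\<^sub>F v in nhds 0. \<bar>r v\<bar> \<le> R" using smooth_germ_bounded[OF r(1)] .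
  define K where "K = R + \<bar>w2\<bar> * (\<bar>E2\<bar> + \<bar>G\<bar>) + \<bar>w3\<bar> * (\<bar>E3\<bar> + \<bar>a 2 0\<bar> * \<bar>G\<bar> * \<bar>G\<bar> + \<bar>a 1 1\<bar> * \<bar>G\<bar>)"
  have "\<forall>\<^sub>F v in nhds 0. \<bar>v\<^sup>2 * (w3 * (a 0 2 / 2))\<bar> \<le> K * \<bar>v\<bar> ^ Suc 2"
    using r(2) R(2) E2 E3 G \<gamma>_germ'(4) small
  proof eventually_elim
    case (elim v)
    define u m where "u = fst (\<gamma> v)" and "m = \<bar>v\<bar> ^ 3"
    have m: "m \<ge> 0" by (simp add: m_def)
    have \<gamma>v: "\<gamma> v = (u, v)" using elim(6) by (simp add: u_def prod_eq_iff)
    have v1: "\<bar>v\<bar> < 1" by (rule elim(7))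
    have p: "\<bar>v\<bar> ^ n \<le> m" if "n \<ge> 3" for n unfolding m_def using v1 that by (intro power_decreasing) auto
    have uG: "\<bar>u\<bar> \<le> \<bar>G\<bar> * \<bar>v\<bar>\<^sup>2" unfolding u_def using elim(5) by (rule order_trans) (intro mult_right_mono, auto)
    have "\<bar>v\<bar> ^ (2 * k) * \<bar>r v\<bar> \<le> m * R" using elim(2) m k by (intro mult_mono p) auto
    then have 1: "\<bar>height g w (\<gamma> v)\<bar> \<le> R * m"
      using elim(1) by (simp add: abs_mult power_abs mult.commute)
    have F: "\<bar>f2 (\<gamma> v)\<bar> \<le> \<bar>E2\<bar> * m" "\<bar>f3 (\<gamma> v)\<bar> \<le> \<bar>E3\<bar> * m"
      unfolding m_def using elim(3,4) by (auto intro: order_trans[OF _ mult_right_mono])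
    have 4: "\<bar>u * v\<bar> \<le> \<bar>G\<bar> * m"
    proof -
      have "\<bar>u * v\<bar> \<le> (\<bar>G\<bar> * \<bar>v\<bar>\<^sup>2) * \<bar>v\<bar>" unfolding abs_mult using uG by (intro mult_right_mono) auto
      then show ?thesis by (simp add: m_def power2_eq_square power3_eq_cube mult.assoc)
    qed
    have 5: "\<bar>a 2 0 / 2 * u\<^sup>2\<bar> \<le> \<bar>a 2 0\<bar> * \<bar>G\<bar> * \<bar>G\<bar> * m"
    proof -
      have "\<bar>a 2 0 / 2 * u\<^sup>2\<bar> \<le> \<bar>a 2 0\<bar> * \<bar>u\<bar>\<^sup>2" unfolding abs_mult power_abs by (intro mult_right_mono) auto
      also have "\<dots> \<le> \<bar>a 2 0\<bar> * (\<bar>G\<bar> * \<bar>v\<bar>\<^sup>2)\<^sup>2" using uG by (intro mult_left_mono power_mono) auto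
      also have "\<dots> = \<bar>a 2 0\<bar> * \<bar>G\<bar> * \<bar>G\<bar> * \<bar>v\<bar> ^ 4" by (simp add: power2_eq_square power4_eq_xxxx)
      also have "\<dots> \<le> \<bar>a 2 0\<bar> * \<bar>G\<bar> * \<bar>G\<bar> * m" using p[of 4] by (intro mult_left_mono) auto
      finally show ?thesis .
    qed
    have 6: "\<bar>a 1 1 * u * v\<bar> \<le> \<bar>a 1 1\<bar> * \<bar>G\<bar> * m"
      using mult_left_mono[OF 4, of "\<bar>a 1 1\<bar>"] by (simp add: abs_mult mult.assoc)
    have 2: "\<bar>f2 (\<gamma> v) + u * v\<bar> \<le> (\<bar>E2\<bar> + \<bar>G\<bar>) * m"
      unfolding distrib_right by (intro order_trans[OF abs_triangle_ineq] add_mono F 4)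
    have 3: "\<bar>f3 (\<gamma> v) + a 2 0 / 2 * u\<^sup>2 + a 1 1 * u * v\<bar> \<le> (\<bar>E3\<bar> + \<bar>a 2 0\<bar> * \<bar>G\<bar> * \<bar>G\<bar> + \<bar>a 1 1\<bar> * \<bar>G\<bar>) * m"
      unfolding distrib_right
      by (rule order_trans[OF abs_triangle_ineq add_mono[OF order_trans[OF abs_triangle_ineq add_mono[OF F(2) 5]] 6]])
    define X Y where "X = f2 (\<gamma> v) + u * v" and "Y = f3 (\<gamma> v) + a 2 0 / 2 * u\<^sup>2 + a 1 1 * u * v"
    have "height g w (\<gamma> v) = w2 * X + w3 * (Y + a 0 2 / 2 * v\<^sup>2)"
      unfolding h[of "\<gamma> v"] w1 X_def Y_def by (simp add: \<gamma>v algebra_simps)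
    then have eq: "v\<^sup>2 * (w3 * (a 0 2 / 2)) = height g w (\<gamma> v) - w2 * X - w3 * Y" by (simp add: algebra_simps)
    have X: "\<bar>w2 * X\<bar> \<le> \<bar>w2\<bar> * ((\<bar>E2\<bar> + \<bar>G\<bar>) * m)"
      unfolding abs_mult X_def using 2 by (rule mult_left_mono) simp
    have Y: "\<bar>w3 * Y\<bar> \<le> \<bar>w3\<bar> * ((\<bar>E3\<bar> + \<bar>a 2 0\<bar> * \<bar>G\<bar> * \<bar>G\<bar> + \<bar>a 1 1\<bar> * \<bar>G\<bar>) * m)"
      unfolding abs_mult[of w3] Y_def using 3 by (rule mult_left_mono) simp
    have "\<bar>v\<^sup>2 * (w3 * (a 0 2 / 2))\<bar> \<le> \<bar>height g w (\<gamma> v)\<bar> + \<bar>w2 * X\<bar> + \<bar>w3 * Y\<bar>"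
      unfolding eq by linarith
    also have "\<dots> \<le> R * m + \<bar>w2\<bar> * ((\<bar>E2\<bar> + \<bar>G\<bar>) * m)
        + \<bar>w3\<bar> * ((\<bar>E3\<bar> + \<bar>a 2 0\<bar> * \<bar>G\<bar> * \<bar>G\<bar> + \<bar>a 1 1\<bar> * \<bar>G\<bar>) * m)"
      by (intro add_mono 1 X Y)
    also have "\<dots> = K * m" by (simp only: K_def distrib_right mult.assoc)
    finally show ?case by (simp add: m_def numeral_3_eq_3)
  qed
  from leading_coefficient_zero[OF smooth_germ_const this]
  have "w3 * (a 0 2 / 2) = 0" .
  moreover have "a 0 2 > 0" using nf by (simp add: normal_form_def)
  ultimately have w3: "w3 = 0" by simp
  show "fst w = 0" "snd (snd w) = 0" "fst (snd w) \<noteq> 0"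
    using w w1 w3 by (auto simp: w123 zero_prod_def)
qed

text \<open>In the source the second branch is \<open>u = (v + u \<tau>) W\<close>; on the axis \<open>u = 0\<close> its equation reduces to
  \<open>v W(0, v\<^sup>2)\<close>, which has the odd order \<open>2 k + 1\<close>. The contact makes it tangent to the locus and hence
  to the \<open>v\<close>-axis. The first branch is transverse to the locus, so it is tangent to the \<open>u\<close>-axis.\<close>

lemma singular_contact:
  assumes HX: "frechet_derivative H (at 0) (1, 0, 0) = 0"
    and q: "smooth_germ q" "q 0 \<noteq> 0" "\<forall>\<^sub>F t in nhds 0. H (0, 0, t) = t ^ (k + 1) * q t" and k: "k \<ge> 1"
  shows "\<exists>C. non_u_axis_component (height g w) C \<and> point_contact (2 * k + 1) C \<gamma>"
proof -
  obtain \<tau> W r where \<tau>: "smooth_germ \<tau>" and W: "smooth_germ W" and r: "smooth_germ r" "r 0 \<noteq> 0"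
    and W0: "\<forall>\<^sub>F t in nhds 0. W (0, t) = t ^ k * r t"
    and zero: "\<forall>\<^sub>F p in nhds 0. H (standard_umbrella p) = 0 \<longleftrightarrow> snd p - fst p * \<tau> (fst p) = 0 \<or>
         fst p - (snd p + fst p * \<tau> (fst p)) * W (fst p, (snd p)\<^sup>2 - (fst p * \<tau> (fst p))\<^sup>2) = 0"
    using D_curve_if_singular(2)[OF HX q k] by blast
  obtain \<theta> where \<theta>: "smooth_germ \<theta>" "\<theta> 0 \<noteq> 0" and \<gamma>_chart: "\<forall>\<^sub>F v in nhds 0. \<phi>' (\<gamma> v) = (0, v * \<theta> v)"
    and D\<phi>': "frechet_derivative \<phi>' (at 0) (0, 1) = (0, \<theta> 0)"
    using locus_in_chart[OF D \<gamma>] by blast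
  have w': "fst w = 0" "snd (snd w) = 0" "fst (snd w) \<noteq> 0"
    using normal_vector_if_singular[OF HX q(1,3)] k by auto
  have W00: "W (0, 0) = 0" using eventually_nhds_x_imp_x[OF W0] k by simp
  have s\<tau>: "smooth_germ (\<lambda>p :: real \<times> real. \<tau> (fst p))"
    by (rule smooth_germ_compose[OF \<tau>]) (auto intro!: smooth_intros)
  define b1 where "b1 = (\<lambda>p. snd p - fst p * \<tau> (fst p))"
  define b2 where "b2 = (\<lambda>p. fst p - (snd p + fst p * \<tau> (fst p)) * W (fst p, (snd p)\<^sup>2 - (fst p * \<tau> (fst p))\<^sup>2))"
  have sb1: "smooth_germ b1" "b1 0 = 0" unfolding b1_def by (auto intro!: smooth_intros s\<tau>)
  have sb2: "smooth_germ b2" "b2 0 = 0" unfolding b2_def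
    by (auto intro!: smooth_intros s\<tau> smooth_germ_compose[OF W] simp: zero_prod_def)
  define f1 f2 where "f1 = (\<lambda>p. b1 (\<phi>' p))" and "f2 = (\<lambda>p. b2 (\<phi>' p))"
  have sf1: "smooth_germ f1" "f1 0 = 0" and sf2: "smooth_germ f2" "f2 0 = 0"
    unfolding f1_def f2_def
    using \<phi>_facts sb1 sb2 smooth_germ_compose[OF sb1(1), of \<phi>'] smooth_germ_compose[OF sb2(1), of \<phi>'] by auto
  have Df: "frechet_derivative (\<lambda>p. f (\<phi>' p)) (at 0) (frechet_derivative \<phi> (at 0) d) = frechet_derivative f (at 0) d"
    if "smooth_germ f" for f :: "real \<times> real \<Rightarrow> real" and d
    using frechet_derivative_compose_0[OF that, of \<phi>' "frechet_derivative \<phi> (at 0) d"] \<phi>_facts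
      inverse_germs_frechet_derivative[OF \<phi>, of d] by simp
  have "\<forall>\<^sub>F t in nhds 0. b1 (t *\<^sub>R (0, 1)) = t * 1" by (simp add: b1_def)
  from frechet_derivative_along_line[OF sb1(1) smooth_germ_const this]
  have ns1: "nonsingular f1" unfolding nonsingular_def using Df[OF sb1(1), of "(0, 1)"]
    by (intro exI[of _ "frechet_derivative \<phi> (at 0) (0, 1)"]) (simp add: f1_def)
  define c2 where "c2 = (\<lambda>t. 1 - \<tau> t * W (t, - (t * \<tau> t)\<^sup>2))"
  have sc2: "smooth_germ c2" unfolding c2_def
    by (auto intro!: smooth_intros \<tau> smooth_germ_compose[OF W] simp: zero_prod_def)
  have "\<forall>\<^sub>F t in nhds 0. b2 (t *\<^sub>R (1, 0)) = t * c2 t" by (simp add: b2_def c2_def algebra_simps)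
  from frechet_derivative_along_line[OF sb2(1) sc2 this]
  have "frechet_derivative b2 (at 0) (1, 0) = 1" by (simp add: c2_def W00)
  then have ns2: "nonsingular f2" unfolding nonsingular_def using Df[OF sb2(1), of "(1, 0)"]
    by (intro exI[of _ "frechet_derivative \<phi> (at 0) (1, 0)"]) (simp add: f2_def)

  have curve1: "defines_curve f1 {p. f1 p = 0}" and curve2: "defines_curve f2 {p. f2 p = 0}"
    using sf1 sf2 ns1 ns2 by (simp_all add: defines_curve_def germ_eq_def)
  have union: "germ_eq {p. height g w p = 0} ({p. f2 p = 0} \<union> {p. f1 p = 0})"
  proof -
    have "\<forall>\<^sub>F p in nhds 0. H (standard_umbrella (\<phi>' p)) = 0 \<longleftrightarrow> f1 p = 0 \<or> f2 p = 0"
      using smooth_germ_eventually[of \<phi>', OF _ _ zero] \<phi>_facts by (auto simp: f1_def f2_def b1_def b2_def)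
    with height_eq show ?thesis unfolding germ_eq_def by eventually_elim auto
  qed

  define \<rho> where "\<rho> = (\<lambda>v. - (\<theta> v ^ (2 * k + 1) * r ((v * \<theta> v)\<^sup>2)))"
  have s: "smooth_germ (\<lambda>v. (v * \<theta> v)\<^sup>2)" "(0 * \<theta> 0)\<^sup>2 = 0" by (auto intro!: smooth_intros \<theta>)
  have s\<rho>: "smooth_germ \<rho>" unfolding \<rho>_def
    by (intro smooth_germ_minus smooth_germ_mult smooth_germ_power \<theta> smooth_germ_compose[OF r(1) s])
  have \<rho>0: "\<rho> 0 \<noteq> 0" using \<theta>(2) r(2) by (simp add: \<rho>_def)
  have f2\<gamma>: "\<forall>\<^sub>F v in nhds 0. (f2 \<circ> \<gamma>) v = v ^ (2 * k + 1) * \<rho> v"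
    using \<gamma>_chart smooth_germ_eventually[OF s W0]
    by eventually_elim (simp add: f2_def b2_def \<rho>_def power_mult_distrib power_mult[symmetric])
  have contact: "point_contact (2 * k + 1) {p. f2 p = 0} \<gamma>"
    unfolding point_contact_def using curve2 vanishes_to_order_factor[OF s\<rho> \<rho>0 f2\<gamma>] by blast

  \<comment> \<open>The equation of the second branch vanishes to order at least three along \<open>\<gamma>\<close>, so its derivative
    annihilates the velocity \<open>(0, 1)\<close>.\<close>
  have sf2\<gamma>: "smooth_germ (\<lambda>v. f2 (\<gamma> v))" using smooth_germ_compose[OF sf2(1)] \<gamma>_germ' by blast
  have "\<forall>\<^sub>F v in nhds 0. f2 (\<gamma> (v *\<^sub>R 1)) = v * (v ^ (2 * k) * \<rho> v)"
    using f2\<gamma> by eventually_elim (simp add: mult.assoc)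
  from frechet_derivative_along_line[OF sf2\<gamma> smooth_germ_mult[OF smooth_germ_power[OF smooth_germ_id] s\<rho>] this]
  have "frechet_derivative (\<lambda>v. f2 (\<gamma> v)) (at 0) 1 = 0" using k by simp
  then have "frechet_derivative f2 (at 0) (0, 1) = 0"
    using frechet_derivative_compose_0[OF sf2(1) \<gamma>_germ'(1,2), of 1] \<gamma>_germ'(3) by simp
  then have tangent2: "regular_curve_tangent_to {p. f2 p = 0} (0, 1)"
    unfolding regular_curve_tangent_to_def using curve2 by blast

  define l where "l = (\<lambda>t :: real. (t, t * \<tau> t))"
  have sl: "smooth_germ l" "l 0 = 0" unfolding l_def by (auto intro!: smooth_intros \<tau> simp: zero_prod_def)
  define c where "c = (\<lambda>t. \<phi> (l t))"
  have sc: "smooth_germ c" "c 0 = 0" unfolding c_def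
    using \<phi>_facts sl smooth_germ_compose[of \<phi> l] by auto
  have \<phi>'c: "\<forall>\<^sub>F t in nhds 0. \<phi>' (c t) = l t"
    using smooth_germ_eventually[OF sl, of "\<lambda>p. \<phi>' (\<phi> p) = p"] \<phi>_facts by (auto simp: c_def)
  have "\<forall>\<^sub>F t in nhds 0. height g w (c t) = 0"
    using smooth_germ_eventually[OF sc height_eq] smooth_germ_eventually[OF sl zero] \<phi>'c
    by eventually_elim (simp add: l_def)
  from tangent_to_u_axis[OF nf w' sc this]
  have c': "fst (frechet_derivative c (at 0) 1) = 0 \<or> snd (frechet_derivative c (at 0) 1) = 0" .
  define d where "d = frechet_derivative c (at 0) 1"
  have "frechet_derivative (\<lambda>t. \<phi>' (c t)) (at 0) 1 = frechet_derivative l (at 0) 1"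
    using frechet_derivative_cong_eventually[OF \<phi>'c] \<phi>_facts sc smooth_germ_compose[of \<phi>' c] by auto
  then have D\<phi>'d: "frechet_derivative \<phi>' (at 0) d = frechet_derivative l (at 0) 1"
    unfolding d_def using frechet_derivative_compose_0[of \<phi>' c 1] \<phi>_facts sc by simp
  have sl1: "smooth_germ (\<lambda>t. fst (l t))" by (intro smooth_intros sl)
  have "frechet_derivative (\<lambda>t. fst (l t)) (at 0) 1 = 1"
    by (rule frechet_derivative_along_line[OF sl1 smooth_germ_const]) (simp add: l_def)
  then have l1: "fst (frechet_derivative l (at 0) 1) = 1"
    using frechet_derivative_compose_0[OF smooth_germ_fst[OF smooth_germ_id] sl, of 1]
    by (simp add: frechet_derivative_bounded_linear bounded_linear_fst)
  have "fst d \<noteq> 0"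
  proof
    assume "fst d = 0"
    then have "d = snd d *\<^sub>R (0, 1)" by (simp add: prod_eq_iff)
    then have "frechet_derivative \<phi>' (at 0) d = snd d *\<^sub>R frechet_derivative \<phi>' (at 0) (0, 1)"
      using linear_scale[OF linear_frechet_derivative[of \<phi>']] \<phi>_facts by metis
    then show False using l1 unfolding D\<phi>'d[symmetric] D\<phi>' by simp
  qed
  with c' have d: "d = fst d *\<^sub>R (1, 0)" by (simp add: d_def prod_eq_iff)
  have sf1c: "smooth_germ (\<lambda>t. f1 (c t))" using smooth_germ_compose[OF sf1(1) sc] .
  have "\<forall>\<^sub>F t in nhds 0. f1 (c (t *\<^sub>R 1)) = t * 0"
    using \<phi>'c by eventually_elim (simp add: f1_def b1_def l_def)
  from frechet_derivative_along_line[OF sf1c smooth_germ_const this]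
  have "frechet_derivative f1 (at 0) d = 0"
    unfolding d_def using frechet_derivative_compose_0[OF sf1(1) sc, of 1] by simp
  then have "fst d * frechet_derivative f1 (at 0) (1, 0) = 0"
    using linear_scale[OF linear_frechet_derivative[OF sf1(1)], of "fst d" "(1, 0)"] d by simp
  then have "frechet_derivative f1 (at 0) (1, 0) = 0" using \<open>fst d \<noteq> 0\<close> by simp
  then have tangent1: "regular_curve_tangent_to {p. f1 p = 0} (1, 0)"
    unfolding regular_curve_tangent_to_def using curve1 by blast
  show ?thesis unfolding non_u_axis_component_def
    using union tangent1 tangent2 contact by blast
qed

end

end

theorem theorem4p2:
  fixes g :: "real \<times> real \<Rightarrow> real \<times> real \<times> real"
    and N :: nat and b :: "nat \<Rightarrow> real" and a :: "nat \<Rightarrow> nat \<Rightarrow> real"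
    and D :: "(real \<times> real) set" and \<gamma> :: "real \<Rightarrow> real \<times> real"
    and L :: "(real \<times> real \<times> real) set" and w\<^sub>0 :: "real \<times> real \<times> real"
  assumes "whitney_umbrella g" and "normal_form g N b a"
    and "double_point_locus g D" and "parameterizes_locus (b 3) \<gamma> D"
    and "image_tangent_line g D L"
    and "w\<^sub>0 \<in> sphere 0 1"
  shows
    "(L \<subseteq> plane w\<^sub>0 \<and> \<not> flat_at_0 (height g w\<^sub>0 \<circ> \<gamma>) \<longrightarrow>
        (nonsingular (height g w\<^sub>0) \<longrightarrow>
           (\<exists>k\<ge>2. point_contact (2 * k) {p. height g w\<^sub>0 p = 0} \<gamma> \<and>
             (\<exists>Y. local_intersection g w\<^sub>0 Y \<and> A_curve (plane w\<^sub>0) (2 * k) Y))) \<and>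
        (\<not> nonsingular (height g w\<^sub>0) \<longrightarrow>
           (\<exists>C. non_u_axis_component (height g w\<^sub>0) C \<and>
             (\<exists>k\<ge>1. point_contact (2 * k + 1) C \<gamma> \<and>
               (\<exists>Y. local_intersection g w\<^sub>0 Y \<and> D_curve (plane w\<^sub>0) (2 * k + 3) Y))))) \<and>
     (\<not> L \<subseteq> plane w\<^sub>0 \<longrightarrow>
        (\<forall>k. A_singularity k (height g w\<^sub>0) \<longrightarrow>
          (\<exists>Y. local_intersection g w\<^sub>0 Y \<and> A_curve (plane w\<^sub>0) (k + 2) Y)))"
proof -
  obtain \<phi> \<Psi> where g: "smooth_germ g" "g 0 = 0" and diffeo: "diffeo_germ \<phi>" "diffeo_germ \<Psi>"
    and eq: "\<forall>\<^sub>F (u, v) in nhds 0. g (\<phi> (u, v)) = \<Psi> (u, u * v, v\<^sup>2)"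
    using assms(1) unfolding whitney_umbrella_def by blast
  obtain \<phi>' where \<phi>': "inverse_germs \<phi> \<phi>'" using diffeo_germ_imp_inverse_germs[OF diffeo(1)] .
  obtain \<Psi>' where \<Psi>': "inverse_germs \<Psi> \<Psi>'" using diffeo_germ_imp_inverse_germs[OF diffeo(2)] .
  interpret umbrella_chart g \<phi> \<phi>' \<Psi> \<Psi>' w\<^sub>0
  proof
    show "\<forall>\<^sub>F p in nhds 0. g (\<phi> p) = \<Psi> (standard_umbrella p)"
      using eq by (rule eventually_mono) (simp add: split_beta standard_umbrella_def)
  qed (use g \<phi>' \<Psi>' assms(6) in auto)
  note locus = assms(3,4)
  note tangent = tangent_line_in_plane_iff[OF locus assms(5)]
  show ?thesis
  proof (intro conjI impI allI; (elim conjE)?)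
    assume L: "L \<subseteq> plane w\<^sub>0" and nonflat: "\<not> flat_at_0 (height g w\<^sub>0 \<circ> \<gamma>)" and ns: "nonsingular (height g w\<^sub>0)"
    obtain k q where q: "k \<ge> 1" "smooth_germ q" "q 0 \<noteq> 0" "\<forall>\<^sub>F t in nhds 0. H (0, 0, t) = t ^ k * q t"
      using finite_order_if_not_flat[OF locus nonflat] .
    have "k \<ge> 2" using order_ge_2[OF q(2-4,1)] tangent L by blast
    moreover have "point_contact (2 * k) {p. height g w\<^sub>0 p = 0} \<gamma>"
    proof -
      obtain r where r: "smooth_germ r" "r 0 \<noteq> 0" "\<forall>\<^sub>F v in nhds 0. (height g w\<^sub>0 \<circ> \<gamma>) v = v ^ (2 * k) * r v"
        using height_on_locus_factor[OF locus q(2,4)] q(3) by blast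
      have "defines_curve (height g w\<^sub>0) {p. height g w\<^sub>0 p = 0}"
        using smooth_height height_0 ns by (simp add: defines_curve_def germ_eq_def)
      with vanishes_to_order_factor[OF r] show ?thesis unfolding point_contact_def by blast
    qed
    moreover have "A_curve (plane w\<^sub>0) (2 * k) section_curve"
      using A_curve_if_nonsingular[OF _ q(2-4)] ns nonsingular_height_iff by blast
    ultimately show "\<exists>k\<ge>2. point_contact (2 * k) {p. height g w\<^sub>0 p = 0} \<gamma> \<and>
             (\<exists>Y. local_intersection g w\<^sub>0 Y \<and> A_curve (plane w\<^sub>0) (2 * k) Y)"
      using local_intersection_section_curve by blast
  next
    assume L: "L \<subseteq> plane w\<^sub>0" and nonflat: "\<not> flat_at_0 (height g w\<^sub>0 \<circ> \<gamma>)" and s: "\<not> nonsingular (height g w\<^sub>0)"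
    obtain k' q where q: "k' \<ge> 1" "smooth_germ q" "q 0 \<noteq> 0" "\<forall>\<^sub>F t in nhds 0. H (0, 0, t) = t ^ k' * q t"
      using finite_order_if_not_flat[OF locus nonflat] .
    have "k' \<ge> 2" using order_ge_2[OF q(2-4,1)] tangent L by blast
    define k where "k = k' - 1"
    have k: "k \<ge> 1" "k' = k + 1" using \<open>k' \<ge> 2\<close> by (simp_all add: k_def)
    have HX: "frechet_derivative H (at 0) (1, 0, 0) = 0" using s nonsingular_height_iff by blast
    obtain C where "non_u_axis_component (height g w\<^sub>0) C" "point_contact (2 * k + 1) C \<gamma>"
      using singular_contact[OF locus assms(2) HX q(2,3) q(4)[unfolded k(2)] k(1)] by blast
    moreover have "D_curve (plane w\<^sub>0) (2 * k + 3) section_curve"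
      using D_curve_if_singular(1)[OF HX q(2,3) q(4)[unfolded k(2)] k(1)] .
    ultimately show "\<exists>C. non_u_axis_component (height g w\<^sub>0) C \<and>
             (\<exists>k\<ge>1. point_contact (2 * k + 1) C \<gamma> \<and>
               (\<exists>Y. local_intersection g w\<^sub>0 Y \<and> D_curve (plane w\<^sub>0) (2 * k + 3) Y))"
      using local_intersection_section_curve k(1) by blast
  next
    fix k assume "\<not> L \<subseteq> plane w\<^sub>0" and A: "A_singularity k (height g w\<^sub>0)"
    then have HZ: "frechet_derivative H (at 0) (0, 0, 1) \<noteq> 0" using tangent by blast
    have "A_curve (plane w\<^sub>0) (k + 2) section_curve"
    proof (cases "k = 0")
      case True
      have sE: "smooth_germ (\<lambda>t. H (0, 0, t))"
        by (rule smooth_germ_compose[OF smooth_H]) (auto intro!: smooth_intros simp: zero_prod_def)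
      have "H (0, 0, 0) = 0" using H_0 by (simp add: zero_prod_def)
      then obtain q where q: "smooth_germ q" "\<forall>\<^sub>F t in nhds 0. H (0, 0, t) = t * q t"
        using hadamard_real[OF sE] by auto
      have "q 0 \<noteq> 0" using frechet_derivative_along_line[OF smooth_H q(1), of "(0, 0, 1)"] q(2) HZ by simp
      moreover have "\<forall>\<^sub>F t in nhds 0. H (0, 0, t) = t ^ 1 * q t" using q(2) by simp
      moreover have "frechet_derivative H (at 0) (1, 0, 0) \<noteq> 0"
        using A True nonsingular_height_iff by (simp add: A_singularity_def)
      ultimately have "A_curve (plane w\<^sub>0) (2 * 1) section_curve" using A_curve_if_nonsingular q(1) by blast
      then show ?thesis using True by (simp add: numeral_2_eq_2)
    next
      case False
      then show ?thesis using A_curve_if_singular_height[OF HZ _ A] by simp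
    qed
    then show "\<exists>Y. local_intersection g w\<^sub>0 Y \<and> A_curve (plane w\<^sub>0) (k + 2) Y"
      using local_intersection_section_curve by blast
  qed
qed

end
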